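(* Let $S=\Phi(\mathbb{W})\subset\mathbb{H}^1$ be the intrinsic graph of a compactly supported intrinsic Lipschitz function $\varphi\colon\mathbb{W}\to\mathbb{V}$, defined on all of $\mathbb{W}$, which has extra vertical H\"older regularity with some constants $0<\alpha\le1$ and $H>0$. Then $S$ has big pieces of bilipschitz images of the parabolic plane $(\Pi,d_\Pi)$. In particular, $S$ is LI rectifiable.
   Context: **Heisenberg group.** $\mathbb{H}^1=\mathbb{R}^3$ with group law $(x,y,t)\cdot(x',y',t')=(x+x',y+y',t+t'+\tfrac12(xy'-yx'))$, norm $\|(x,y,t)\|=((x^2+y^2)^2+16t^2)^{1/4}$ and metric $d_{\mathbb{H}}(p,q)=\|q^{-1}\cdot p\|$. All metric notions in $\mathbb{H}^1$ (balls $B(p,r)$, Lipschitz maps, Hausdorff measures) are with respect to $d_{\mathbb{H}}$. **Intrinsic Lipschitz functions.** $\mathbb{W}=\{(0,y,t)\}\cong\mathbb{R}^2$, $\mathbb{V}=\{(x,0,0)\}\cong\mathbb{R}$. Every $p\in\mathbb{H}^1$ is uniquely $p=\pi_{\mathbb{W}}(p)\cdot\pi_{\mathbb{V}}(p)$ with $\pi_{\mathbb{W}}(p)\in\mathbb{W}$, $\pi_{\mathbb{V}}(p)\in\mathbb{V}$. For $\varphi\colon\mathbb{W}\to\mathbb{V}$, the graph map is $\Phi(w)=w\cdot\varphi(w)$ and $S=\Phi(\mathbb{W})$ is the intrinsic graph. The function $\varphi$ is intrinsic $L$-Lipschitz if $S\cap(p\cdot\mathcal{C}(\beta))=\{p\}$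 for all $p\in S$ and $0<\beta<L^{-1}$, where $\mathcal{C}(\beta)=\{q\in\mathbb{H}^1:\|\pi_{\mathbb{W}}(q)\|\le\beta\|\pi_{\mathbb{V}}(q)\|\}$; it is intrinsic Lipschitz if this holds for some $L$. Compactly supported means $\varphi\equiv0$ outside a compact set. **Extra vertical H\"older regularity.** An intrinsic Lipschitz function $\varphi$ (viewed as $\mathbb{R}^2\to\mathbb{R}$) has extra vertical H\"older regularity with constants $0<\alpha\le1$ and $H>0$ if $|\varphi(y,t)-\varphi(y,t')|\le H|t-t'|^{(1+\alpha)/2}$ for all $y,t,t'\in\mathbb{R}$. **Parabolic plane.** $\Pi=\mathbb{R}^2$ with addition, $\|(y,t)\|=(y^4+16t^2)^{1/4}$, $d_\Pi(a,b)=\|a-b\|$. **Big pieces.** A closed, $3$-regular set $E\subset\mathbb{H}^1$ (i.e. $\mathcal{H}^{3}(E\cap B(p,r))$ is comparable to $r^{3}$ for $p\in E$, $0<r\le\operatorname{diam}E$) has big pieces of bilipschitz images of $\Pi$ if there are $L\ge1$ and $\theta>0$ such that for every $p\in E$ and $0<r\le\operatorname{diam}_{\mathbb{H}}(E)$ (with $r<\infty$) there are a compact $K\subset B(0,r)\subset\Pi$ and an $L$-bilipschitz map $f\colon K\to\mathbb{H}^1$ with $\mathcal{H}^{3}(f(K)\cap E\cap B(p,r))\ge\theta r^{3}$. **LI rectifiability.** An $\mathcal{H}^3$-measurable $E\subset\mathbb{H}^1$ is LI rectifiable if $\mathcal{H}^3$ almost all of $E$ can be covered by countably many Lipschitz images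 of closed subsets of codimension-1 vertical subgroups (planes in $\mathbb{R}^3$ containing the $t$-axis, with metric $d_{\mathbb{H}}$), each of which is isometrically isomorphic to $(\Pi,d_\Pi)$. *)

theory Defs
  imports "HOL-Analysis.Analysis"
begin

section \<open>The Heisenberg group\<close>

datatype heis = Heis (hx: real) (hy: real) (ht: real)

instantiation heis :: monoid_mult
begin

definition one_heis :: heis where
  "1 = Heis 0 0 0"

definition times_heis :: "heis \<Rightarrow> heis \<Rightarrow> heis" where
  "p * q = Heis (hx p + hx q) (hy p + hy q) (ht p + ht q + (hx p * hy q - hy p * hx q) / 2)"

instance
  by standard (auto simp: one_heis_def times_heis_def field_simps)

end

instantiation heis :: inverse
begin

definition inverse_heis :: "heis \<Rightarrow> heis" where
  "inverse p = Heis (- hx p) (- hy p) (- ht p)"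

definition divide_heis :: "heis \<Rightarrow> heis \<Rightarrow> heis" where
  "p div q = p * inverse q" for p q :: heis

instance ..

end

lemma heis_inverse [simp]:
  fixes p :: heis
  shows "inverse p * p = 1" "p * inverse p = 1"
  by (auto simp: one_heis_def times_heis_def inverse_heis_def)

lemma heis_inverse_inverse [simp]: "inverse (inverse p) = (p :: heis)"
  by (simp add: inverse_heis_def)

lemma heis_inverse_times: "inverse (p * q) = inverse q * inverse (p :: heis)"
  by (simp add: inverse_heis_def times_heis_def field_simps)

definition hnorm :: "heis \<Rightarrow> real" where
  "hnorm p = root 4 (((hx p)\<^sup>2 + (hy p)\<^sup>2)\<^sup>2 + 16 * (ht p)\<^sup>2)"

lemma root_4_eq_sqrt_sqrt: "root 4 a = sqrt (sqrt a)"
  by (simp add: sqrt_def flip: real_root_mult_exp)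

lemma hnorm_power2:
  "(hnorm p)\<^sup>2 = cmod (Complex ((hx p)\<^sup>2 + (hy p)\<^sup>2) (4 * ht p))"
  by (simp add: hnorm_def root_4_eq_sqrt_sqrt cmod_def power_mult_distrib)

lemma hnorm_nonneg: "0 \<le> hnorm p"
  by (simp add: hnorm_def)

lemma hnorm_horizontal: "cmod (Complex (hx p) (hy p)) \<le> hnorm p"
proof -
  have "((hx p)\<^sup>2 + (hy p)\<^sup>2) \<le> (hnorm p)\<^sup>2"
    unfolding hnorm_power2 using abs_Re_le_cmod[of "Complex ((hx p)\<^sup>2 + (hy p)\<^sup>2) (4 * ht p)"]
    by simp
  then show ?thesis
    by (simp add: cmod_def hnorm_nonneg real_le_lsqrt)
qed

lemma hnorm_triangle: "hnorm (p * q) \<le> hnorm p + hnorm q"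
proof -
  define A where "A = (\<lambda>p. Complex ((hx p)\<^sup>2 + (hy p)\<^sup>2) (4 * ht p))"
  define Z where "Z = (\<lambda>p. Complex (hx p) (hy p))"
  have "A (p * q) = A p + A q + 2 * (cnj (Z p) * Z q)"
    by (auto simp: A_def Z_def times_heis_def complex_eq_iff power2_eq_square field_simps)
  then have "cmod (A (p * q)) \<le> cmod (A p) + cmod (A q) + 2 * (cmod (Z p) * cmod (Z q))"
    by (metis complex_mod_cnj norm_mult norm_numeral norm_triangle_ineq norm_triangle_le
        add_mono_thms_linordered_semiring(3))
  also have "\<dots> \<le> (hnorm p)\<^sup>2 + (hnorm q)\<^sup>2 + 2 * (hnorm p * hnorm q)"
    using mult_mono[OF hnorm_horizontal hnorm_horizontal, of p q]
    by (simp add: A_def Z_def hnorm_power2 hnorm_nonneg)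
  finally have "(hnorm (p * q))\<^sup>2 \<le> (hnorm p + hnorm q)\<^sup>2"
    by (simp add: hnorm_power2[of "p * q"] A_def power2_sum)
  then show ?thesis
    by (rule power2_le_imp_le) (simp add: hnorm_nonneg)
qed

lemma hnorm_inverse: "hnorm (inverse p) = hnorm p"
  by (simp add: hnorm_def inverse_heis_def)

lemma hnorm_eq_0_iff: "hnorm p = 0 \<longleftrightarrow> p = 1"
  by (cases p) (auto simp: hnorm_def one_heis_def add_nonneg_eq_0_iff)

instantiation heis :: metric_space
begin

definition dist_heis :: "heis \<Rightarrow> heis \<Rightarrow> real" where
  "dist p q = hnorm (inverse q * p)"

definition uniformity_heis :: "(heis \<times> heis) filter" where
  "uniformity_heis = (INF e\<in>{0 <..}. principal {(p, q). dist p q < e})"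

definition open_heis :: "heis set \<Rightarrow> bool" where
  "open_heis U \<longleftrightarrow> (\<forall>p\<in>U. eventually (\<lambda>(p', q). p' = p \<longrightarrow> q \<in> U) uniformity)"

instance
proof
  fix p q z :: heis
  show "dist p q = 0 \<longleftrightarrow> p = q"
    by (cases p; cases q)
      (auto simp: dist_heis_def hnorm_eq_0_iff times_heis_def inverse_heis_def one_heis_def)
  have "dist p q = hnorm ((inverse q * z) * (inverse z * p))"
    by (metis (no_types) dist_heis_def heis_inverse(2) mult.assoc mult.right_neutral)
  also have "\<dots> \<le> hnorm (inverse q * z) + hnorm (inverse z * p)"
    by (rule hnorm_triangle)
  also have "hnorm (inverse q * z) = hnorm (inverse z * q)"
    by (metis heis_inverse_inverse heis_inverse_times hnorm_inverse)
  finally show "dist p q \<le> dist p z + dist q z"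
    by (simp add: dist_heis_def)
qed (rule uniformity_heis_def open_heis_def)+

end


section \<open>The parabolic plane\<close>

datatype para = Para (py: real) (pt: real)

instantiation para :: ab_group_add
begin

definition zero_para :: para where "0 = Para 0 0"
definition plus_para :: "para \<Rightarrow> para \<Rightarrow> para" where "a + b = Para (py a + py b) (pt a + pt b)"
definition uminus_para :: "para \<Rightarrow> para" where "- a = Para (- py a) (- pt a)"
definition minus_para :: "para \<Rightarrow> para \<Rightarrow> para" where "a - b = Para (py a - py b) (pt a - pt b)"

instance
  by standard (auto simp: zero_para_def plus_para_def uminus_para_def minus_para_def)

end

definition pnorm :: "para \<Rightarrow> real" where
  "pnorm a = root 4 ((py a) ^ 4 + 16 * (pt a)\<^sup>2)"

lemma pnorm_diff: "pnorm (a - b) = dist (Heis 0 (py a) (pt a)) (Heis 0 (py b) (pt b))"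
  by (simp add: pnorm_def minus_para_def dist_heis_def hnorm_def times_heis_def inverse_heis_def)

instantiation para :: metric_space
begin

definition dist_para :: "para \<Rightarrow> para \<Rightarrow> real" where
  "dist a b = pnorm (a - b)"

definition uniformity_para :: "(para \<times> para) filter" where
  "uniformity_para = (INF e\<in>{0 <..}. principal {(a, b). dist a b < e})"

definition open_para :: "para set \<Rightarrow> bool" where
  "open_para U \<longleftrightarrow> (\<forall>a\<in>U. eventually (\<lambda>(a', b). a' = a \<longrightarrow> b \<in> U) uniformity)"

instance
proof
  fix a b c :: para
  show "dist a b = 0 \<longleftrightarrow> a = b"
    by (cases a; cases b) (simp add: dist_para_def pnorm_diff)
  show "dist a b \<le> dist a c + dist b c"
    by (simp add: dist_para_def pnorm_diff dist_triangle2)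
qed (rule uniformity_para_def open_para_def)+

end


section \<open>Hausdorff measure\<close>

text \<open>The library's \<^const>\<open>diameter\<close> is real-valued and carries no information for unbounded sets.\<close>

definition ediam :: "'a::metric_space set \<Rightarrow> ennreal" where
  "ediam A = (SUP x\<in>A. SUP y\<in>A. ennreal (dist x y))"

definition hausdorff_pre :: "nat \<Rightarrow> real \<Rightarrow> 'a::metric_space set \<Rightarrow> ennreal" where
  "hausdorff_pre s \<delta> A =
    (INF C\<in>{C :: nat \<Rightarrow> 'a set. A \<subseteq> (\<Union>i. C i) \<and> (\<forall>i. ediam (C i) \<le> ennreal \<delta>)}.
      \<Sum>i. if C i = {} then 0 else ediam (C i) ^ s)"

text \<open>The outer measure, defined on all sets and without a normalising constant.\<close>

definition hausdorff_measure :: "nat \<Rightarrow> 'a::metric_space set \<Rightarrow> ennreal" where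
  "hausdorff_measure s A = (SUP \<delta>\<in>{0<..}. hausdorff_pre s \<delta> A)"

text \<open>Measurability in the sense of Caratheodory.\<close>

definition hausdorff_measurable :: "nat \<Rightarrow> 'a::metric_space set \<Rightarrow> bool" where
  "hausdorff_measurable s E \<longleftrightarrow> E \<in> lambda_system UNIV (Pow UNIV) (hausdorff_measure s)"


section \<open>Intrinsic Lipschitz functions\<close>

definition W_plane :: "heis set" where
  "W_plane = {Heis 0 y t | y t. True}"

definition V_line :: "heis set" where
  "V_line = {Heis x 0 0 | x. True}"

definition proj_W :: "heis \<Rightarrow> heis" where
  "proj_W p = Heis 0 (hy p) (ht p + hx p * hy p / 2)"

definition proj_V :: "heis \<Rightarrow> heis" where
  "proj_V p = Heis (hx p) 0 0"

lemma heis_splitting: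
  "w \<in> W_plane \<and> v \<in> V_line \<and> p = w * v \<longleftrightarrow> w = proj_W p \<and> v = proj_V p"
  by (cases p) (auto simp: W_plane_def V_line_def proj_W_def proj_V_def times_heis_def)

text \<open>
  A function from \<^const>\<open>W_plane\<close> to \<^const>\<open>V_line\<close> is represented by \<open>\<phi> :: real \<times> real \<Rightarrow> real\<close>
  through the coordinates \<open>(y, t) \<mapsto> Heis 0 y t\<close> and \<open>x \<mapsto> Heis x 0 0\<close>.
\<close>

definition graph_map :: "(real \<times> real \<Rightarrow> real) \<Rightarrow> real \<times> real \<Rightarrow> heis" where
  "graph_map \<phi> = (\<lambda>(y, t). Heis 0 y t * Heis (\<phi> (y, t)) 0 0)"

definition intrinsic_graph :: "(real \<times> real \<Rightarrow> real) \<Rightarrow> heis set" where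
  "intrinsic_graph \<phi> = range (graph_map \<phi>)"

definition intrinsic_cone :: "real \<Rightarrow> heis set" where
  "intrinsic_cone \<beta> = {q. hnorm (proj_W q) \<le> \<beta> * hnorm (proj_V q)}"

definition intrinsic_lipschitz_with :: "real \<Rightarrow> (real \<times> real \<Rightarrow> real) \<Rightarrow> bool" where
  "intrinsic_lipschitz_with L \<phi> \<longleftrightarrow>
    (\<forall>p\<in>intrinsic_graph \<phi>. \<forall>\<beta>. 0 < \<beta> \<and> \<beta> < inverse L \<longrightarrow>
      intrinsic_graph \<phi> \<inter> (*) p ` intrinsic_cone \<beta> = {p})"

text \<open>For \<open>L \<le> 0\<close> the previous condition is vacuous, as \<open>inverse 0 = 0\<close>; hence the restriction to positive \<open>L\<close>.\<close>

definition intrinsic_lipschitz :: "(real \<times> real \<Rightarrow> real) \<Rightarrow> bool" where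
  "intrinsic_lipschitz \<phi> \<longleftrightarrow> (\<exists>L>0. intrinsic_lipschitz_with L \<phi>)"

definition compactly_supported :: "(real \<times> real \<Rightarrow> real) \<Rightarrow> bool" where
  "compactly_supported \<phi> \<longleftrightarrow> (\<exists>K. compact K \<and> (\<forall>w. w \<notin> K \<longrightarrow> \<phi> w = 0))"

definition extra_vertical_hoelder :: "real \<Rightarrow> real \<Rightarrow> (real \<times> real \<Rightarrow> real) \<Rightarrow> bool" where
  "extra_vertical_hoelder \<alpha> H \<phi> \<longleftrightarrow>
    (\<forall>y t t'. \<bar>\<phi> (y, t) - \<phi> (y, t')\<bar> \<le> H * \<bar>t - t'\<bar> powr ((1 + \<alpha>) / 2))"


section \<open>Big pieces and rectifiability\<close>

definition bilipschitz_on :: "real \<Rightarrow> 'a::metric_space set \<Rightarrow> ('a \<Rightarrow> 'b::metric_space) \<Rightarrow> bool" where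
  "bilipschitz_on L K f \<longleftrightarrow>
    (\<forall>a\<in>K. \<forall>b\<in>K. dist a b / L \<le> dist (f a) (f b) \<and> dist (f a) (f b) \<le> L * dist a b)"

definition regular3 :: "heis set \<Rightarrow> bool" where
  "regular3 E \<longleftrightarrow>
    (\<exists>C\<ge>1. \<forall>p\<in>E. \<forall>r>0. ennreal r \<le> ediam E \<longrightarrow>
      ennreal (r ^ 3 / C) \<le> hausdorff_measure 3 (E \<inter> ball p r) \<and>
      hausdorff_measure 3 (E \<inter> ball p r) \<le> ennreal (C * r ^ 3))"

definition big_pieces_parabolic :: "heis set \<Rightarrow> bool" where
  "big_pieces_parabolic E \<longleftrightarrow> closed E \<and> regular3 E \<and>
    (\<exists>L\<ge>1. \<exists>\<theta>>0. \<forall>p\<in>E. \<forall>r>0. ennreal r \<le> ediam E \<longrightarrow>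
      (\<exists>(K :: para set) (f :: para \<Rightarrow> heis).
        compact K \<and> K \<subseteq> ball 0 r \<and> bilipschitz_on L K f \<and>
        ennreal (\<theta> * r ^ 3) \<le> hausdorff_measure 3 (f ` K \<inter> E \<inter> ball p r)))"

text \<open>A plane containing the \<open>t\<close>-axis passes through the origin, so it is a linear subspace.\<close>

definition vertical_subgroup :: "heis set \<Rightarrow> bool" where
  "vertical_subgroup V \<longleftrightarrow> (\<forall>t. Heis 0 0 t \<in> V) \<and>
    (let V' = (\<lambda>p. (hx p, hy p, ht p)) ` V in subspace V' \<and> dim V' = 2)"

definition LI_rectifiable :: "heis set \<Rightarrow> bool" where
  "LI_rectifiable E \<longleftrightarrow> hausdorff_measurable 3 E \<and>
    (\<exists>(V :: nat \<Rightarrow> heis set) (C :: nat \<Rightarrow> heis set) (f :: nat \<Rightarrow> heis \<Rightarrow> heis).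
      (\<forall>i. vertical_subgroup (V i) \<and> C i \<subseteq> V i \<and> closed (C i) \<and>
        (\<exists>L. L-lipschitz_on (C i) (f i))) \<and>
      hausdorff_measure 3 (E - (\<Union>i. f i ` C i)) = 0)"

end

theory Submission
  imports Defs
begin

text \<open>
  Write \<open>f y t\<close> for \<open>\<phi> (y, t)\<close> and \<open>\<tau> = t' - t - f y t (y' - y)\<close>. The intrinsic Lipschitz condition says
  that the squared distance of two points of the graph is comparable to \<open>(y' - y)\<^sup>2 + \<bar>\<tau>\<bar>\<close>.
  In coordinates \<open>(y, s)\<close> that label points by approximate solutions of \<open>t' = f y t\<close>, the quantity \<open>\<tau>\<close>
  should become \<open>s' - s\<close>. At scale \<open>l\<close> the extra vertical regularity makes the flow of this equation
  over times at most \<open>l\<close> distort vertical distances by a factor \<open>1 + O(l\<^sup>\<alpha>)\<close> only, up to an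
  error \<open>O(l\<^sup>\<alpha> l\<^sup>2)\<close>. Composing these flows along the left endpoints of the dyadic intervals
  shrinking to \<open>y\<close> yields a bijection \<open>s \<mapsto> T y s\<close> for each \<open>y\<close>; the errors add up to
  \<open>O(l\<^sup>\<alpha> l\<^sup>2)\<close>, where \<open>l\<close> is the length of the last dyadic interval that \<open>y\<close> and \<open>y'\<close> share.
  They are absorbed by \<open>(y' - y)\<^sup>2\<close> as soon as \<open>y\<close> and \<open>y'\<close> lie in a Cantor set whose gaps of
  generation \<open>l\<close> have length about \<open>l\<^sup>\<alpha>\<^sup>/\<^sup>2 l\<close>. Such Cantor sets have positive measure and exhaust almost
  all of the line, and over each of them the graph is a bilipschitz image of a product with the line.
  At large scales the graph contains a large flat piece, because \<open>\<phi>\<close> has compact support.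
\<close>

section \<open>Hausdorff measures\<close>

lemma ediam_empty [simp]: "ediam {} = 0"
  by (simp add: ediam_def bot_ennreal)

lemma dist_le_ediam: "x \<in> A \<Longrightarrow> y \<in> A \<Longrightarrow> ennreal (dist x y) \<le> ediam A"
  unfolding ediam_def by (meson SUP_upper2 order_refl)

lemma ediam_le: "(\<And>x y. x \<in> A \<Longrightarrow> y \<in> A \<Longrightarrow> dist x y \<le> d) \<Longrightarrow> ediam A \<le> ennreal d"
  unfolding ediam_def by (intro SUP_least ennreal_leI)

lemma hausdorff_pre_le:
  assumes "A \<subseteq> (\<Union>i. C i)" and "\<And>i::nat. ediam (C i) \<le> ennreal \<delta>"
  shows "hausdorff_pre s \<delta> A \<le> (\<Sum>i. if C i = {} then 0 else ediam (C i) ^ s)"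
  unfolding hausdorff_pre_def by (rule INF_lower) (use assms in auto)

lemma hausdorff_pre_antimono:
  assumes "\<delta> \<le> \<delta>'"
  shows "hausdorff_pre s \<delta>' A \<le> hausdorff_pre s \<delta> A"
  unfolding hausdorff_pre_def
  by (rule INF_superset_mono) (use assms ennreal_leI order_trans in \<open>blast+\<close>)

lemma hausdorff_pre_mono: "A \<subseteq> B \<Longrightarrow> hausdorff_pre s \<delta> A \<le> hausdorff_pre s \<delta> B"
  unfolding hausdorff_pre_def by (rule INF_superset_mono) auto

lemma hausdorff_pre_le_measure: "0 < \<delta> \<Longrightarrow> hausdorff_pre s \<delta> A \<le> hausdorff_measure s A"
  unfolding hausdorff_measure_def by (rule SUP_upper) auto

lemma hausdorff_measure_leI:
  "(\<And>\<delta>. 0 < \<delta> \<Longrightarrow> hausdorff_pre s \<delta> A \<le> c) \<Longrightarrow> hausdorff_measure s A \<le> c"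
  unfolding hausdorff_measure_def by (rule SUP_least) auto

lemma hausdorff_measure_mono: "A \<subseteq> B \<Longrightarrow> hausdorff_measure s A \<le> hausdorff_measure s B"
  unfolding hausdorff_measure_def by (rule SUP_mono) (auto intro: hausdorff_pre_mono)

lemma hausdorff_pre_empty: "hausdorff_pre s \<delta> {} = 0"
  using hausdorff_pre_le[of "{}" "\<lambda>_. {}" \<delta> s] by simp

lemma hausdorff_pre_approx:
  assumes "hausdorff_pre s \<delta> A < c"
  obtains C :: "nat \<Rightarrow> 'a::metric_space set" where "A \<subseteq> (\<Union>i. C i)" 
    and "\<And>i. ediam (C i) \<le> ennreal \<delta>" and "(\<Sum>i. if C i = {} then 0 else ediam (C i) ^ s) < c"
  using assms unfolding hausdorff_pre_def by (auto simp: INF_less_iff)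

lemma hausdorff_pre_finite_le:
  fixes B :: "'b \<Rightarrow> 'a::metric_space set"
  assumes "finite I" and "A \<subseteq> (\<Union>i\<in>I. B i)" and d: "\<And>i. i \<in> I \<Longrightarrow> ediam (B i) \<le> ennreal d"
    and "d \<le> \<delta>"
  shows "hausdorff_pre s \<delta> A \<le> of_nat (card I) * ennreal d ^ s"
proof -
  obtain h where h: "bij_betw h {..<card I} I"
    using assms(1) by (metis bij_betw_from_nat_into_finite)
  define C where "C i = (if i < card I then B (h i) else {})" for i
  have hI: "h i \<in> I" if "i < card I" for i using h that by (auto dest: bij_betwE)
  have "A \<subseteq> (\<Union>i. C i)"
  proof
    fix x assume "x \<in> A"
    then obtain i where "i \<in> I" "x \<in> B i" using assms by blast
    then obtain j where "j < card I" "h j = i" using h by (metis bij_betw_iff_bijections lessThan_iff)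
    then show "x \<in> (\<Union>i. C i)" using \<open>x \<in> B i\<close> by (auto simp: C_def)
  qed
  moreover have "ediam (C i) \<le> ennreal \<delta>" for i
    using d[OF hI] assms(4) by (auto simp: C_def intro: order_trans ennreal_leI)
  ultimately have "hausdorff_pre s \<delta> A \<le> (\<Sum>i. if C i = {} then 0 else ediam (C i) ^ s)"
    by (rule hausdorff_pre_le)
  also have "\<dots> = (\<Sum>i<card I. if C i = {} then 0 else ediam (C i) ^ s)"
    by (rule suminf_finite) (auto simp: C_def)
  also have "\<dots> \<le> (\<Sum>i<card I. ennreal d ^ s)"
    by (rule sum_mono) (use d[OF hI] in \<open>auto simp: C_def intro: power_mono\<close>)
  finally show ?thesis by simp
qed

lemma hausdorff_pre_countably_subadditive:
  fixes A :: "nat \<Rightarrow> 'a::metric_space set"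
  shows "hausdorff_pre s \<delta> (\<Union>i. A i) \<le> (\<Sum>i. hausdorff_pre s \<delta> (A i))"
proof (rule ennreal_le_epsilon)
  fix e :: real assume fin: "(\<Sum>i. hausdorff_pre s \<delta> (A i)) < top" and e: "0 < e"
  define G where "G i C \<longleftrightarrow> A i \<subseteq> (\<Union>j. C j) \<and> (\<forall>j. ediam (C j) \<le> ennreal \<delta>) \<and>
      (\<Sum>j. if C j = {} then 0 else ediam (C j) ^ s) \<le> hausdorff_pre s \<delta> (A i) + ennreal (e * (1/2) ^ Suc i)"
    for i and C :: "nat \<Rightarrow> 'a set"
  have "\<exists>C. G i C" for i
  proof -
    have "hausdorff_pre s \<delta> (A i) < top"
      using fin ennreal_suminf_lessD by blast
    then have "hausdorff_pre s \<delta> (A i) < hausdorff_pre s \<delta> (A i) + ennreal (e * (1/2) ^ Suc i)"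
      using e ennreal_add_left_cancel_less[of "hausdorff_pre s \<delta> (A i)" 0] by simp
    then show ?thesis
    proof (rule hausdorff_pre_approx)
      fix C :: "nat \<Rightarrow> 'a set"
      assume "A i \<subseteq> (\<Union>j. C j)" "\<And>j. ediam (C j) \<le> ennreal \<delta>"
        "(\<Sum>j. if C j = {} then 0 else ediam (C j) ^ s) < hausdorff_pre s \<delta> (A i) + ennreal (e * (1/2) ^ Suc i)"
      then show "\<exists>C. G i C" unfolding G_def by (intro exI[of _ C]) simp
    qed
  qed
  then have "\<forall>i. \<exists>C. G i C" by simp
  from choice[OF this] obtain C where CG: "\<And>i. G i (C i)" by auto
  have C: "A i \<subseteq> (\<Union>j. C i j)" "\<And>j. ediam (C i j) \<le> ennreal \<delta>"
      "(\<Sum>j. if C i j = {} then 0 else ediam (C i j) ^ s) \<le> hausdorff_pre s \<delta> (A i) + ennreal (e * (1/2) ^ Suc i)" for i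
    using CG[of i] by (simp_all add: G_def)
  let ?D = "\<lambda>n. case_prod C (prod_decode n)"
  have "(\<Union>i. A i) \<subseteq> (\<Union>n. ?D n)"
  proof
    fix x assume "x \<in> (\<Union>i. A i)"
    then obtain i where "x \<in> A i" by blast
    then obtain j where "x \<in> C i j" using C(1)[of i] by auto
    then have "x \<in> ?D (prod_encode (i, j))" by simp
    then show "x \<in> (\<Union>n. ?D n)" by (rule UN_I[OF UNIV_I])
  qed
  then have h1: "hausdorff_pre s \<delta> (\<Union>i. A i) \<le> (\<Sum>n. if ?D n = {} then 0 else ediam (?D n) ^ s)"
    by (rule hausdorff_pre_le) (auto simp: C(2) split: prod.split)
  define S where "S p = (if case_prod C p = {} then 0 else ediam (case_prod C p) ^ s)" for p
  note h1
  also have "(\<Sum>n. if ?D n = {} then 0 else ediam (?D n) ^ s) = (\<Sum>n. S (prod_decode n))"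
    by (simp add: S_def)
  also have "(\<Sum>n. S (prod_decode n)) = (\<Sum>i. \<Sum>j. S (i, j))"
    by (rule suminf_ennreal_2dimen) simp
  also have "(\<Sum>i. \<Sum>j. S (i, j)) \<le> (\<Sum>i. hausdorff_pre s \<delta> (A i) + ennreal (e * (1/2) ^ Suc i))"
    by (rule suminf_le) (use C(3) in \<open>auto simp: S_def\<close>)
  also have "(\<Sum>i. hausdorff_pre s \<delta> (A i) + ennreal (e * (1/2) ^ Suc i))
      = (\<Sum>i. hausdorff_pre s \<delta> (A i)) + (\<Sum>i. ennreal (e * (1/2) ^ Suc i))"
    by (rule suminf_add[symmetric]) auto
  also have "(\<Sum>i. ennreal (e * (1/2) ^ Suc i)) = ennreal e"
    using power_half_series e sums_mult[OF power_half_series, of e]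
    by (subst suminf_ennreal_eq) auto
  finally show "hausdorff_pre s \<delta> (\<Union>i. A i) \<le> (\<Sum>i. hausdorff_pre s \<delta> (A i)) + ennreal e" .
qed

lemma hausdorff_measure_countably_subadditive:
  fixes A :: "nat \<Rightarrow> 'a::metric_space set"
  shows "hausdorff_measure s (\<Union>i. A i) \<le> (\<Sum>i. hausdorff_measure s (A i))"
proof (rule hausdorff_measure_leI)
  fix \<delta> :: real assume "0 < \<delta>"
  then have "(\<Sum>i. hausdorff_pre s \<delta> (A i)) \<le> (\<Sum>i. hausdorff_measure s (A i))"
    by (intro suminf_le hausdorff_pre_le_measure) auto
  then show "hausdorff_pre s \<delta> (\<Union>i. A i) \<le> (\<Sum>i. hausdorff_measure s (A i))"
    by (rule order_trans[OF hausdorff_pre_countably_subadditive])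
qed

lemma hausdorff_measure_UN_null:
  assumes "\<And>i::nat. hausdorff_measure s (A i) = 0"
  shows "hausdorff_measure s (\<Union>i. A i) = 0"
  using hausdorff_measure_countably_subadditive[of s A] assms by simp

lemma hausdorff_measure_empty [simp]: "hausdorff_measure s {} = 0"
  using hausdorff_measure_leI[of s "{}" 0] by (simp add: hausdorff_pre_empty)

lemma hausdorff_measure_Un_le:
  "hausdorff_measure s (A \<union> B) \<le> hausdorff_measure s A + hausdorff_measure s B"
proof -
  have "hausdorff_measure s (\<Union>i. (binaryset A B) i) \<le> (\<Sum>i. hausdorff_measure s (binaryset A B i))"
    by (rule hausdorff_measure_countably_subadditive)
  then show ?thesis
    by (subst (asm) suminf_finite[of "{..<2}"])
       (auto simp: UN_binaryset_eq binaryset_def numeral_2_eq_2 lessThan_Suc add.commute)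
qed

lemma hausdorff_measure_separated:
  assumes "0 < e" and sep: "\<And>x y. x \<in> A \<Longrightarrow> y \<in> B \<Longrightarrow> e \<le> dist x y"
  shows "hausdorff_measure s A + hausdorff_measure s B \<le> hausdorff_measure s (A \<union> B)"
proof -
  have main: "hausdorff_pre s \<delta> A + hausdorff_pre s \<delta> B \<le> hausdorff_measure s (A \<union> B)" if "0 < \<delta>" for \<delta>
  proof -
    define \<eta> where "\<eta> = min \<delta> (e/2)"
    have \<eta>: "0 < \<eta>" "\<eta> \<le> \<delta>" "\<eta> < e" using assms(1) that by (auto simp: \<eta>_def)
    have "hausdorff_pre s \<eta> A + hausdorff_pre s \<eta> B \<le> hausdorff_pre s \<eta> (A \<union> B)"
      unfolding hausdorff_pre_def[of s \<eta> "A \<union> B"]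
    proof (rule INF_greatest, clarify)
      fix C :: "nat \<Rightarrow> 'a set"
      assume C: "A \<union> B \<subseteq> (\<Union>i. C i)" "\<forall>i. ediam (C i) \<le> ennreal \<eta>"
      define D where "D X i = (if C i \<inter> X = {} then {} else C i)" for X i
      have cover: "hausdorff_pre s \<eta> X \<le> (\<Sum>i. if D X i = {} then 0 else ediam (D X i) ^ s)" 
        if "X \<subseteq> A \<union> B" for X
        by (rule hausdorff_pre_le) (use C that in \<open>auto simp: D_def, blast\<close>)
      have disj: "D A i = {} \<or> D B i = {}" for i
      proof (rule ccontr)
        assume "\<not> ?thesis"
        then obtain x y where "x \<in> A" "y \<in> B" "x \<in> C i" "y \<in> C i" by (auto simp: D_def split: if_splits)
        then have "ennreal e \<le> ennreal \<eta>"
          using sep dist_le_ediam C(2) by (meson ennreal_leI order_trans)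
        then show False using \<eta> by (simp add: ennreal_le_iff2)
      qed
      have "hausdorff_pre s \<eta> A + hausdorff_pre s \<eta> B \<le> 
         (\<Sum>i. if D A i = {} then 0 else ediam (D A i) ^ s) + (\<Sum>i. if D B i = {} then 0 else ediam (D B i) ^ s)"
        by (intro add_mono cover) auto
      also have "\<dots> = (\<Sum>i. (if D A i = {} then 0 else ediam (D A i) ^ s) + (if D B i = {} then 0 else ediam (D B i) ^ s))"
        by (rule suminf_add) auto
      also have "\<dots> \<le> (\<Sum>i. if C i = {} then 0 else ediam (C i) ^ s)"
      proof (rule suminf_le)
        show "(if D A i = {} then 0 else ediam (D A i) ^ s) + (if D B i = {} then 0 else ediam (D B i) ^ s)
            \<le> (if C i = {} then 0 else ediam (C i) ^ s)" for i
          using disj[of i] unfolding D_def by (cases "C i = {}"; cases "C i \<inter> A = {}"; cases "C i \<inter> B = {}") simp_all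
      qed auto
      finally show "hausdorff_pre s \<eta> A + hausdorff_pre s \<eta> B \<le> (\<Sum>i. if C i = {} then 0 else ediam (C i) ^ s)" .
    qed
    moreover have "hausdorff_pre s \<delta> A + hausdorff_pre s \<delta> B \<le> hausdorff_pre s \<eta> A + hausdorff_pre s \<eta> B"
      by (intro add_mono hausdorff_pre_antimono \<eta>)
    ultimately show ?thesis
      by (meson hausdorff_pre_le_measure[OF \<eta>(1)] order_trans)
  qed
  have "hausdorff_measure s A + hausdorff_measure s B
      = (SUP \<delta>\<in>{0<..}. hausdorff_pre s \<delta> A + hausdorff_measure s B)"
    unfolding hausdorff_measure_def[of s A] by (intro ennreal_SUP_add_left[symmetric]) auto
  also have "\<dots> \<le> hausdorff_measure s (A \<union> B)"
  proof (rule SUP_least)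
    fix \<delta> :: real assume \<delta>: "\<delta> \<in> {0<..}"
    have "hausdorff_pre s \<delta> A + hausdorff_measure s B
        = (SUP \<delta>'\<in>{0<..}. hausdorff_pre s \<delta> A + hausdorff_pre s \<delta>' B)"
      unfolding hausdorff_measure_def[of s B] by (intro ennreal_SUP_add_right) auto
    also have "\<dots> \<le> hausdorff_measure s (A \<union> B)"
    proof (rule SUP_least)
      fix \<delta>' :: real assume \<delta>': "\<delta>' \<in> {0<..}"
      have "hausdorff_pre s \<delta> A + hausdorff_pre s \<delta>' B \<le> 
            hausdorff_pre s (min \<delta> \<delta>') A + hausdorff_pre s (min \<delta> \<delta>') B"
        by (intro add_mono hausdorff_pre_antimono) auto
      also have "\<dots> \<le> hausdorff_measure s (A \<union> B)" using \<delta> \<delta>' by (intro main) auto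
      finally show "hausdorff_pre s \<delta> A + hausdorff_pre s \<delta>' B \<le> hausdorff_measure s (A \<union> B)" .
    qed
    finally show "hausdorff_pre s \<delta> A + hausdorff_measure s B \<le> hausdorff_measure s (A \<union> B)" .
  qed
  finally show ?thesis .
qed

text \<open>Caratheodory's criterion: the rings \<open>R n\<close> of points of \<open>X\<close> at distance about \<open>1 / n\<close> from \<open>E\<close>
  are separated from each other when their indices differ by two, so their measures are summable.\<close>

lemma closed_hausdorff_measurable:
  fixes E :: "'a::metric_space set"
  assumes "closed E"
  shows "hausdorff_measurable s E"
proof -
  let ?f = "hausdorff_measure s :: 'a set \<Rightarrow> ennreal"
  have split: "?f (E \<inter> X) + ?f (X - E) \<le> ?f X" if fin: "?f X < top" for X
  proof -
    define Y where "Y n = {x \<in> X. \<forall>e\<in>E. 1 / Suc n \<le> dist x e}" for n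
    define R where "R n = Y (Suc n) - Y n" for n
    have Ymono: "Y m \<subseteq> Y n" if "m \<le> n" for m n
    proof -
      have "1 / Suc n \<le> 1 / Suc m" using that by (simp add: frac_le)
      then show ?thesis by (force simp: Y_def)
    qed
    have sep: "1 / Suc m - 1 / Suc n \<le> dist x y" if "x \<in> Y m" "y \<in> R n" for m n x y
    proof -
      have "\<exists>e\<in>E. dist y e < 1 / Suc n"
        using that by (auto simp: R_def Y_def not_le)
      then obtain e where e: "e \<in> E" "dist y e < 1 / Suc n" by blast
      then have "1 / Suc m \<le> dist x e" using that by (auto simp: Y_def)
      then show ?thesis using e dist_triangle[of x e y] by linarith
    qed
    have alt: "(\<Sum>i<k. ?f (R (2*i+d))) \<le> ?f (\<Union>i<k. R (2*i+d))" for k d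
    proof (induction k)
      case (Suc k)
      let ?A = "\<Union>i<k. R (2*i+d)"
      have "?f ?A + ?f (R (2*k+d)) \<le> ?f (?A \<union> R (2*k+d))"
      proof (cases "k = 0")
        case False
        have sub: "?A \<subseteq> Y (2*k+d-1)"
          unfolding R_def using False by (intro UN_least order_trans[OF Diff_subset] Ymono) auto
        have "0 < 1 / Suc (2*k+d-1) - 1 / real (Suc (2*k+d))"
          using False by (simp add: frac_less2)
        then show ?thesis
          by (rule hausdorff_measure_separated) (use sep[OF subsetD[OF sub]] in blast)
      qed simp
      then have "?f ?A + ?f (R (2*k+d)) \<le> ?f (\<Union>i<Suc k. R (2*i+d))"
        by (simp add: lessThan_Suc Un_commute)
      from order_trans[OF add_right_mono[OF Suc.IH] this] show ?case by simp
    qed simp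
    have "R n \<subseteq> X" for n by (auto simp: R_def Y_def)
    then have alt': "(\<Sum>i<k. ?f (R (2*i+d))) \<le> ?f X" for k d
      by (intro order_trans[OF alt] hausdorff_measure_mono) auto
    have "(\<Sum>n<2*k. ?f (R n)) = (\<Sum>i<k. ?f (R (2*i))) + (\<Sum>i<k. ?f (R (2*i+1)))" for k
      by (induction k) (auto simp: algebra_simps)
    then have "(\<Sum>n<2*k. ?f (R n)) \<le> ?f X + ?f X" for k
      using add_mono[OF alt'[where d=0] alt'[where d=1]] by simp
    moreover have "(\<Sum>n<k. ?f (R n)) \<le> (\<Sum>n<2*k. ?f (R n))" for k
      by (rule sum_mono2) auto
    ultimately have "(\<Sum>n. ?f (R n)) \<le> ?f X + ?f X"
      by (intro suminf_le_const) (auto intro: order_trans)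
    then have sumfin: "(\<Sum>n. ?f (R n)) < top" using fin
      using le_less_trans ennreal_add_less_top by blast
    define a where "a n = enn2real (?f (R n))" for n
    have a: "?f (R n) = ennreal (a n)" for n
      using ennreal_suminf_lessD[OF sumfin, of n] by (simp add: a_def less_top)
    have a0: "0 \<le> a n" for n by (simp add: a_def)
    have suma: "summable a"
      using sumfin unfolding a by (intro summable_suminf_not_top a0) (auto simp: less_top)
    have "?f (E \<inter> X) + ?f (X - E) \<le> ?f X + ennreal e" if e: "0 < e" for e
    proof -
      obtain N where N: "norm (\<Sum>i. a (i + N)) < e" 
        using suminf_exist_split[OF e suma] by auto
      have "X - E \<subseteq> Y N \<union> (\<Union>i. R (i + N))"
      proof
        fix x assume x: "x \<in> X - E"
        then obtain r where r: "0 < r" "\<And>e. e \<in> E \<Longrightarrow> r \<le> dist x e"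
        proof -
          have "open (- E)" "x \<in> - E" using assms x by auto
          then obtain r where "0 < r" "ball x r \<subseteq> - E" by (meson open_contains_ball)
          then have "\<And>e. e \<in> E \<Longrightarrow> r \<le> dist x e" by (meson ComplD mem_ball not_le subsetD)
          then show ?thesis using that \<open>0 < r\<close> by blast
        qed
        obtain m where "1 / Suc m < r" using r(1) by (meson nat_approx_posE)
        then have "x \<in> Y m" using r x by (auto simp: Y_def intro: order_trans[OF less_imp_le])
        define k where "k = (LEAST n. x \<in> Y n)"
        have k: "x \<in> Y k" "\<And>j. j < k \<Longrightarrow> x \<notin> Y j" unfolding k_def
          using LeastI[of "\<lambda>n. x \<in> Y n", OF \<open>x \<in> Y m\<close>] not_less_Least by auto
        show "x \<in> Y N \<union> (\<Union>i. R (i + N))"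
        proof (cases "k \<le> N")
          case True then show ?thesis using Ymono k by auto
        next
          case False
          then have "x \<in> R ((k - 1 - N) + N)" using k by (auto simp: R_def)
          then show ?thesis by blast
        qed
      qed
      then have "?f (X - E) \<le> ?f (Y N) + (\<Sum>i. ?f (R (i + N)))"
        by (rule order_trans[OF hausdorff_measure_mono order_trans[OF hausdorff_measure_Un_le
              add_left_mono[OF hausdorff_measure_countably_subadditive]]])
      also have "(\<Sum>i. ?f (R (i + N))) = ennreal (\<Sum>i. a (i + N))"
        unfolding a using suma by (intro suminf_ennreal2 a0) (simp add: summable_iff_shift)
      also have "\<dots> \<le> ennreal e" using N by (intro ennreal_leI) auto
      finally have h: "?f (X - E) \<le> ?f (Y N) + ennreal e" by (simp add: add_left_mono)
      have "?f (E \<inter> X) + ?f (Y N) \<le> ?f ((E \<inter> X) \<union> Y N)"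
        by (rule hausdorff_measure_separated[of "1 / Suc N"]) (auto simp: Y_def dist_commute)
      also have "\<dots> \<le> ?f X" by (rule hausdorff_measure_mono) (auto simp: Y_def)
      finally have "(?f (E \<inter> X) + ?f (Y N)) + ennreal e \<le> ?f X + ennreal e" by (rule add_right_mono)
      with add_left_mono[OF h, of "?f (E \<inter> X)"] show ?thesis
        unfolding add.assoc by (rule order_trans)
    qed
    then show ?thesis by (rule ennreal_le_epsilon)
  qed
  have "?f (E \<inter> X) + ?f ((UNIV - E) \<inter> X) = ?f X" for X
  proof (rule antisym)
    have "(UNIV - E) \<inter> X = X - E" by auto
    then show "?f (E \<inter> X) + ?f ((UNIV - E) \<inter> X) \<le> ?f X"
      using split[of X] by (cases "?f X = top") (auto simp: less_top)
    show "?f X \<le> ?f (E \<inter> X) + ?f ((UNIV - E) \<inter> X)"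
      using hausdorff_measure_Un_le[of s "E \<inter> X" "(UNIV - E) \<inter> X"]
      by (simp add: Int_Un_distrib2[symmetric])
  qed
  then show ?thesis by (simp add: hausdorff_measurable_def lambda_system_def)
qed

section \<open>The metric and the measure on an intrinsic Lipschitz graph\<close>

lemma hnorm_power2_bounds:
  shows "(hx p)\<^sup>2 + (hy p)\<^sup>2 \<le> (hnorm p)\<^sup>2" and "4 * \<bar>ht p\<bar> \<le> (hnorm p)\<^sup>2"
    and "(hnorm p)\<^sup>2 \<le> (hx p)\<^sup>2 + (hy p)\<^sup>2 + 4 * \<bar>ht p\<bar>"
proof -
  let ?z = "Complex ((hx p)\<^sup>2 + (hy p)\<^sup>2) (4 * ht p)"
  show "(hx p)\<^sup>2 + (hy p)\<^sup>2 \<le> (hnorm p)\<^sup>2" "4 * \<bar>ht p\<bar> \<le> (hnorm p)\<^sup>2"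
    "(hnorm p)\<^sup>2 \<le> (hx p)\<^sup>2 + (hy p)\<^sup>2 + 4 * \<bar>ht p\<bar>"
    using abs_Re_le_cmod[of ?z] abs_Im_le_cmod[of ?z] cmod_le[of ?z] by (simp_all add: hnorm_power2 abs_mult)
qed

lemma dist_heis_power2_bounds:
  fixes p q :: heis
  defines "t \<equiv> ht p - ht q + (hy q * hx p - hx q * hy p) / 2"
  shows "(hx p - hx q)\<^sup>2 + (hy p - hy q)\<^sup>2 \<le> (dist p q)\<^sup>2" and "4 * \<bar>t\<bar> \<le> (dist p q)\<^sup>2"
    and "(dist p q)\<^sup>2 \<le> (hx p - hx q)\<^sup>2 + (hy p - hy q)\<^sup>2 + 4 * \<bar>t\<bar>"
  using hnorm_power2_bounds[of "inverse q * p"]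
  by (simp_all add: dist_heis_def inverse_heis_def times_heis_def t_def algebra_simps)

lemma dist_para_power2_bounds:
  fixes a b :: para
  shows "(py a - py b)\<^sup>2 \<le> (dist a b)\<^sup>2" and "4 * \<bar>pt a - pt b\<bar> \<le> (dist a b)\<^sup>2"
    and "(dist a b)\<^sup>2 \<le> (py a - py b)\<^sup>2 + 4 * \<bar>pt a - pt b\<bar>"
  using dist_heis_power2_bounds[of "Heis 0 (py a) (pt a)" "Heis 0 (py b) (pt b)"]
  by (simp_all add: dist_para_def pnorm_diff)

lemma hx_hy_dist: "\<bar>hx p - hx q\<bar> \<le> dist p q" "\<bar>hy p - hy q\<bar> \<le> dist p q"
proof -
  have "\<bar>hx p - hx q\<bar>\<^sup>2 \<le> (dist p q)\<^sup>2" "\<bar>hy p - hy q\<bar>\<^sup>2 \<le> (dist p q)\<^sup>2"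
    using dist_heis_power2_bounds(1)[of p q] zero_le_power2[of "hx p - hx q"] zero_le_power2[of "hy p - hy q"] 
    unfolding power2_abs by linarith+
  then show "\<bar>hx p - hx q\<bar> \<le> dist p q" "\<bar>hy p - hy q\<bar> \<le> dist p q"
    using zero_le_dist power2_le_imp_le by blast+
qed

lemma heis_tendsto_coords:
  assumes "(p \<longlongrightarrow> q) F"
  shows "((\<lambda>i. hx (p i)) \<longlongrightarrow> hx q) F" "((\<lambda>i. hy (p i)) \<longlongrightarrow> hy q) F" "((\<lambda>i. ht (p i)) \<longlongrightarrow> ht q) F"
proof -
  have d: "((\<lambda>i. dist (p i) q) \<longlongrightarrow> 0) F" using assms by (rule tendsto_dist_iff[THEN iffD1])
  show x: "((\<lambda>i. hx (p i)) \<longlongrightarrow> hx q) F"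
    by (rule metric_tendsto_imp_tendsto[OF assms]) (simp add: hx_hy_dist dist_real_def)
  show y: "((\<lambda>i. hy (p i)) \<longlongrightarrow> hy q) F"
    by (rule metric_tendsto_imp_tendsto[OF assms]) (simp add: hx_hy_dist dist_real_def)
  let ?t = "\<lambda>i. ht (p i) - ht q + (hy q * hx (p i) - hx q * hy (p i)) / 2"
  have "((\<lambda>i. (dist (p i) q)\<^sup>2) \<longlongrightarrow> 0) F" using tendsto_power[OF d, of 2] by simp
  then have "(?t \<longlongrightarrow> 0) F"
  proof (rule Lim_null_comparison[rotated])
    have "\<bar>?t i\<bar> \<le> (dist (p i) q)\<^sup>2" for i
      by (rule order_trans[OF _ dist_heis_power2_bounds(2)]) simp
    then show "\<forall>\<^sub>F i in F. norm (?t i) \<le> (dist (p i) q)\<^sup>2" by simp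
  qed
  then have "((\<lambda>i. ?t i + ht q - (hy q * hx (p i) - hx q * hy (p i)) / 2) \<longlongrightarrow> 
      0 + ht q - (hy q * hx q - hx q * hy q) / 2) F"
    by (intro tendsto_intros x y) simp_all
  then show "((\<lambda>i. ht (p i)) \<longlongrightarrow> ht q) F" by simp
qed

definition strip :: "real set \<Rightarrow> (real \<Rightarrow> real) \<Rightarrow> real \<Rightarrow> (real \<times> real) set" where
  "strip Y g h = {w. fst w \<in> Y \<and> \<bar>snd w - g (fst w)\<bar> \<le> h}"

lemma compact_strip:
  assumes "compact Y" and "continuous_on UNIV g"
  shows "compact (strip Y g h)"
proof -
  have "strip Y g h = (\<lambda>(y, s). (y, g y + s)) ` (Y \<times> {-h..h})"
  proof (intro equalityI subsetI)
    fix w assume "w \<in> strip Y g h"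
    then show "w \<in> (\<lambda>(y, s). (y, g y + s)) ` (Y \<times> {-h..h})"
      by (intro image_eqI[of _ _ "(fst w, snd w - g (fst w))"]) (auto simp: strip_def abs_le_iff)
  qed (auto simp: strip_def)
  moreover have "continuous_on (Y \<times> {-h..h}) (\<lambda>w. (fst w, g (fst w) + snd w))"
    by (intro continuous_intros continuous_on_compose2[OF assms(2)]) auto
  ultimately show ?thesis
    using assms(1) by (auto simp: case_prod_unfold intro!: compact_continuous_image compact_Times)
qed

lemma emeasure_strip:
  assumes "Y \<in> sets borel" and "continuous_on UNIV g" and "0 \<le> h"
  shows "strip Y g h \<in> sets borel" and "emeasure lborel (strip Y g h) = ennreal (2 * h) * emeasure lborel Y"
proof -
  have [measurable]: "g \<in> borel_measurable borel" "Y \<in> sets borel"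
    using assms borel_measurable_continuous_onI by auto
  have "Measurable.pred (borel \<Otimes>\<^sub>M borel) (\<lambda>w. fst w \<in> Y \<and> \<bar>snd w - g (fst w)\<bar> \<le> h)"
    by measurable
  then show borel: "strip Y g h \<in> sets borel"
    unfolding strip_def borel_prod pred_def by simp
  have "emeasure lborel (strip Y g h) = (\<integral>\<^sup>+ y. emeasure lborel (Pair y -` strip Y g h) \<partial>lborel)"
    unfolding lborel_prod[symmetric] 
    by (subst lborel.emeasure_pair_measure_alt) (use borel in \<open>simp_all add: borel_prod[symmetric]\<close>)
  also have "\<dots> = (\<integral>\<^sup>+ y. ennreal (2 * h) * indicator Y y \<partial>lborel)"
  proof (rule nn_integral_cong)
    fix y
    have "Pair y -` strip Y g h = (if y \<in> Y then {g y - h..g y + h} else {})"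
      by (auto simp: strip_def)
    then show "emeasure lborel (Pair y -` strip Y g h) = ennreal (2 * h) * indicator Y y"
      using assms(3) by simp
  qed
  also have "\<dots> = ennreal (2 * h) * emeasure lborel Y"
    using assms by (simp add: nn_integral_cmult_indicator)
  finally show "emeasure lborel (strip Y g h) = ennreal (2 * h) * emeasure lborel Y" .
qed

locale lipschitz_graph =
  fixes f :: "real \<Rightarrow> real \<Rightarrow> real" and L B :: real
  assumes lip: "\<bar>f y' t' - f y t\<bar> \<le> L * (\<bar>y' - y\<bar> + sqrt \<bar>t' - t - f y t * (y' - y)\<bar>)"
    and L_ge_1: "1 \<le> L"
    and bounded: "\<bar>f y t\<bar> \<le> B"
begin

definition \<Phi> :: "real \<times> real \<Rightarrow> heis" where
  "\<Phi> w = Heis 0 (fst w) (snd w) * Heis (f (fst w) (snd w)) 0 0"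

definition \<tau> :: "real \<times> real \<Rightarrow> real \<times> real \<Rightarrow> real" where
  "\<tau> w w' = snd w' - snd w - f (fst w) (snd w) * (fst w' - fst w)"

lemma \<Phi>_coords: "hx (\<Phi> w) = f (fst w) (snd w)" "hy (\<Phi> w) = fst w"
    "ht (\<Phi> w) = snd w - fst w * f (fst w) (snd w) / 2"
  by (simp_all add: \<Phi>_def times_heis_def)

lemma dist_\<Phi>_bounds:
  shows "(dist (\<Phi> w) (\<Phi> w'))\<^sup>2 \<le> 8 * L\<^sup>2 * ((fst w' - fst w)\<^sup>2 + \<bar>\<tau> w w'\<bar>)"
    and "(fst w' - fst w)\<^sup>2 + \<bar>\<tau> w w'\<bar> \<le> 2 * (dist (\<Phi> w) (\<Phi> w'))\<^sup>2"
proof -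
  define x where "x = f (fst w') (snd w') - f (fst w) (snd w)"
  define y where "y = fst w' - fst w"
  define d where "d = dist (\<Phi> w) (\<Phi> w')"
  have "ht (\<Phi> w') - ht (\<Phi> w) + (hy (\<Phi> w) * hx (\<Phi> w') - hx (\<Phi> w) * hy (\<Phi> w')) / 2 = \<tau> w w' - x * y / 2"
    by (simp add: \<Phi>_coords \<tau>_def x_def y_def field_simps)
  moreover have "hx (\<Phi> w') - hx (\<Phi> w) = x" "hy (\<Phi> w') - hy (\<Phi> w) = y" "dist (\<Phi> w') (\<Phi> w) = d"
    by (simp_all add: \<Phi>_coords x_def y_def d_def dist_commute)
  ultimately have b: "x\<^sup>2 + y\<^sup>2 \<le> d\<^sup>2" "4 * \<bar>\<tau> w w' - x * y / 2\<bar> \<le> d\<^sup>2" "d\<^sup>2 \<le> x\<^sup>2 + y\<^sup>2 + 4 * \<bar>\<tau> w w' - x * y / 2\<bar>"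
    using dist_heis_power2_bounds[of "\<Phi> w'" "\<Phi> w"] by simp_all
  have xy: "2 * \<bar>x * y\<bar> \<le> x\<^sup>2 + y\<^sup>2"
    using sum_squares_bound[of "\<bar>x\<bar>" "\<bar>y\<bar>"] by (simp add: abs_mult)
  have "\<bar>x\<bar> \<le> L * (\<bar>y\<bar> + sqrt \<bar>\<tau> w w'\<bar>)"
    using lip[of "fst w'" "snd w'" "fst w" "snd w"] by (simp add: x_def y_def \<tau>_def)
  then have "\<bar>x\<bar>\<^sup>2 \<le> (L * (\<bar>y\<bar> + sqrt \<bar>\<tau> w w'\<bar>))\<^sup>2" by (intro power_mono) auto
  also have "\<dots> = L\<^sup>2 * (y\<^sup>2 + \<bar>\<tau> w w'\<bar> + 2 * \<bar>y\<bar> * sqrt \<bar>\<tau> w w'\<bar>)"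
    by (simp add: power_mult_distrib power2_sum)
  also have "\<dots> \<le> L\<^sup>2 * (2 * (y\<^sup>2 + \<bar>\<tau> w w'\<bar>))"
    using sum_squares_bound[of "\<bar>y\<bar>" "sqrt \<bar>\<tau> w w'\<bar>"] by (intro mult_left_mono) auto
  finally have x2: "x\<^sup>2 \<le> 2 * L\<^sup>2 * (y\<^sup>2 + \<bar>\<tau> w w'\<bar>)" by (simp add: algebra_simps)
  have "1 \<le> L\<^sup>2" using L_ge_1 by (simp add: one_le_power)
  then have "1 * (y\<^sup>2 + \<bar>\<tau> w w'\<bar>) \<le> L\<^sup>2 * (y\<^sup>2 + \<bar>\<tau> w w'\<bar>)" by (intro mult_right_mono) auto
  moreover have "d\<^sup>2 \<le> 2 * x\<^sup>2 + 4 * (y\<^sup>2 + \<bar>\<tau> w w'\<bar>)"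
  proof -
    have "d2 \<le> 2 * x2 + 4 * (y2 + T)"
      if "d2 \<le> x2 + y2 + 4 * D" "2 * C \<le> x2 + y2" "D \<le> T + C / 2" "0 \<le> y2" for d2 x2 y2 D C T :: real
      using that by simp
    from this[OF b(3) xy _ zero_le_power2] show ?thesis
      using abs_triangle_ineq4[of "\<tau> w w'" "x * y / 2"] by simp
  qed
  ultimately show "(dist (\<Phi> w) (\<Phi> w'))\<^sup>2 \<le> 8 * L\<^sup>2 * ((fst w' - fst w)\<^sup>2 + \<bar>\<tau> w w'\<bar>)"
    using x2 unfolding d_def[symmetric] y_def[symmetric] by simp
  show "(fst w' - fst w)\<^sup>2 + \<bar>\<tau> w w'\<bar> \<le> 2 * (dist (\<Phi> w) (\<Phi> w'))\<^sup>2"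
  proof -
    have "y2 + T \<le> 2 * d2"
      if "x2 + y2 \<le> d2" "4 * D \<le> d2" "2 * C \<le> x2 + y2" "T \<le> D + C / 2" "0 \<le> x2" "0 \<le> d2" for d2 x2 y2 D C T :: real
      using that by simp
    from this[OF b(1,2) xy _ zero_le_power2 zero_le_power2] show ?thesis
      using abs_triangle_ineq[of "\<tau> w w' - x * y / 2" "x * y / 2"] by (simp add: d_def y_def)
  qed
qed

definition sbox :: "real \<times> real \<Rightarrow> real \<Rightarrow> (real \<times> real) set" where
  "sbox w \<rho> = strip {fst w - \<rho>..fst w + \<rho>} (\<lambda>y. snd w + f (fst w) (snd w) * (y - fst w)) (\<rho>\<^sup>2)"

lemma mem_sbox: "w' \<in> sbox w \<rho> \<longleftrightarrow> \<bar>fst w' - fst w\<bar> \<le> \<rho> \<and> \<bar>\<tau> w w'\<bar> \<le> \<rho>\<^sup>2"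
  by (auto simp: sbox_def strip_def \<tau>_def algebra_simps abs_le_iff)

lemma dist_sbox: "w' \<in> sbox w \<rho> \<Longrightarrow> dist (\<Phi> w) (\<Phi> w') \<le> 4 * L * \<rho>"
proof -
  assume "w' \<in> sbox w \<rho>"
  then have "\<bar>fst w' - fst w\<bar> \<le> \<rho>" and t: "\<bar>\<tau> w w'\<bar> \<le> \<rho>\<^sup>2" by (auto simp: mem_sbox)
  then have "(fst w' - fst w)\<^sup>2 \<le> \<rho>\<^sup>2" "0 \<le> \<rho>" by (auto simp: abs_le_square_iff[symmetric])
  then have "8 * L\<^sup>2 * ((fst w' - fst w)\<^sup>2 + \<bar>\<tau> w w'\<bar>) \<le> 8 * L\<^sup>2 * (\<rho>\<^sup>2 + \<rho>\<^sup>2)"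
    using t by (intro mult_left_mono) auto
  then have "(dist (\<Phi> w) (\<Phi> w'))\<^sup>2 \<le> (4 * L * \<rho>)\<^sup>2"
    using dist_\<Phi>_bounds(1)[of w w'] by (simp add: power_mult_distrib)
  then show ?thesis using L_ge_1 \<open>0 \<le> \<rho>\<close> by (intro power2_le_imp_le[of "dist _ _"]) auto
qed

lemma sbox_if_dist: "dist (\<Phi> w) (\<Phi> w') \<le> \<rho> \<Longrightarrow> w' \<in> sbox w (2 * \<rho>)"
proof -
  assume d: "dist (\<Phi> w) (\<Phi> w') \<le> \<rho>"
  then have "(dist (\<Phi> w) (\<Phi> w'))\<^sup>2 \<le> \<rho>\<^sup>2" by (intro power_mono) auto
  then have *: "(fst w' - fst w)\<^sup>2 + \<bar>\<tau> w w'\<bar> \<le> 2 * \<rho>\<^sup>2" using dist_\<Phi>_bounds(2)[of w' w] dist_\<Phi>_bounds(2)[of w w'] by linarith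
  have "0 \<le> \<rho>" using d zero_le_dist order_trans by blast
  have "\<bar>fst w' - fst w\<bar> \<le> \<bar>2 * \<rho>\<bar>"
    using * zero_le_power2[of \<rho>] abs_ge_zero[of "\<tau> w w'"]
    unfolding abs_le_square_iff power_mult_distrib power2_eq_square[of "2::real"] by linarith
  moreover have "\<bar>\<tau> w w'\<bar> \<le> (2 * \<rho>)\<^sup>2"
    using * zero_le_power2[of "fst w' - fst w"] zero_le_power2[of \<rho>]
    unfolding power_mult_distrib power2_eq_square[of "2::real"] by linarith
  ultimately show ?thesis using \<open>0 \<le> \<rho>\<close> by (simp add: mem_sbox)
qed

lemma compact_sbox: "compact (sbox w \<rho>)"
  unfolding sbox_def by (intro compact_strip continuous_intros) auto

lemma emeasure_sbox:
  assumes "0 \<le> \<rho>" shows "emeasure lborel (sbox w \<rho>) = ennreal (4 * \<rho> ^ 3)"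
  unfolding sbox_def using assms
  by (subst emeasure_strip(2)) (auto intro!: continuous_intros simp: ennreal_mult[symmetric] power2_eq_square power3_eq_cube)

lemma sbox_borel: "sbox w \<rho> \<in> sets borel"
  using compact_sbox compact_imp_closed borel_closed by blast

lemma continuous_f: "continuous_on UNIV (\<lambda>w. f (fst w) (snd w))"
  unfolding continuous_on_def
proof
  fix w :: "real \<times> real"
  have "((\<lambda>w'. L * (\<bar>fst w' - fst w\<bar> + sqrt \<bar>snd w' - snd w - f (fst w) (snd w) * (fst w' - fst w)\<bar>)) \<longlongrightarrow>
      L * (\<bar>fst w - fst w\<bar> + sqrt \<bar>snd w - snd w - f (fst w) (snd w) * (fst w - fst w)\<bar>)) (at w)"
    by (intro tendsto_intros)
  then have "((\<lambda>w'. L * (\<bar>fst w' - fst w\<bar> + sqrt \<bar>snd w' - snd w - f (fst w) (snd w) * (fst w' - fst w)\<bar>)) \<longlongrightarrow> 0) (at w)"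
    by simp
  then have "((\<lambda>w'. f (fst w') (snd w') - f (fst w) (snd w)) \<longlongrightarrow> 0) (at w)"
    by (rule Lim_null_comparison[OF always_eventually, rotated]) (simp add: lip)
  then show "((\<lambda>w'. f (fst w') (snd w')) \<longlongrightarrow> f (fst w) (snd w)) (at w)"
    by (simp add: LIM_zero_iff)
qed

lemma continuous_\<Phi>: "continuous_on UNIV \<Phi>"
  unfolding continuous_on_def
proof
  fix w :: "real \<times> real"
  have "((\<lambda>w'. sqrt (8 * L\<^sup>2 * ((fst w' - fst w)\<^sup>2 + \<bar>\<tau> w w'\<bar>))) \<longlongrightarrow>
     sqrt (8 * L\<^sup>2 * ((fst w - fst w)\<^sup>2 + \<bar>\<tau> w w\<bar>))) (at w)"
    unfolding \<tau>_def by (intro tendsto_intros)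
  then have *: "((\<lambda>w'. sqrt (8 * L\<^sup>2 * ((fst w' - fst w)\<^sup>2 + \<bar>\<tau> w w'\<bar>))) \<longlongrightarrow> 0) (at w)"
    by (simp add: \<tau>_def)
  have le: "dist (\<Phi> w') (\<Phi> w) \<le> sqrt (8 * L\<^sup>2 * ((fst w' - fst w)\<^sup>2 + \<bar>\<tau> w w'\<bar>))" for w'
    using dist_\<Phi>_bounds(1)[of w w'] by (simp add: real_le_rsqrt dist_commute)
  have "((\<lambda>w'. dist (\<Phi> w') (\<Phi> w)) \<longlongrightarrow> 0) (at w)"
    by (rule Lim_null_comparison[OF always_eventually *]) (simp add: le)
  then show "(\<Phi> \<longlongrightarrow> \<Phi> w) (at w)" by (rule tendsto_dist_iff[THEN iffD2])
qed

lemma closed_graph: "closed (range \<Phi>)"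
  unfolding closed_sequential_limits
proof (intro allI impI, elim conjE)
  fix p q assume "\<forall>n. p n \<in> range \<Phi>" and lim: "p \<longlonglongrightarrow> q"
  note c = heis_tendsto_coords[OF lim]
  define w where "w n = (hy (p n), ht (p n) + hy (p n) * hx (p n) / 2)" for n
  have w: "p n = \<Phi> (w n)" for n
  proof -
    obtain v where "p n = \<Phi> v" using \<open>\<forall>n. p n \<in> range \<Phi>\<close> by blast
    then show ?thesis by (simp add: w_def \<Phi>_coords)
  qed
  define v where "v = (hy q, ht q + hy q * hx q / 2)"
  have "w \<longlonglongrightarrow> v" unfolding v_def w_def by (intro tendsto_intros c) simp
  then have "(\<lambda>n. \<Phi> (w n)) \<longlonglongrightarrow> \<Phi> v"
    using continuous_on_tendsto_compose[OF continuous_\<Phi>, of w v] by simp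
  then have "p \<longlonglongrightarrow> \<Phi> v" unfolding w[symmetric] .
  then have "q = \<Phi> v" using lim LIMSEQ_unique by blast
  then show "q \<in> range \<Phi>" by simp
qed

text \<open>The sheared boxes around a maximal separated subset of \<open>A\<close> are disjoint and stay in \<open>U\<close>.\<close>

lemma hausdorff_pre_le_open:
  assumes "compact A" and "open U" and "A \<subseteq> U" and "0 < \<delta>"
  shows "hausdorff_pre 3 \<delta> (\<Phi> ` A) \<le> ennreal (1024 * L ^ 3) * emeasure lborel U"
proof (cases "A = {} \<or> emeasure lborel U = top")
  case True
  then show ?thesis
  proof
    assume "emeasure lborel U = top"
    then show ?thesis using L_ge_1 by (simp add: ennreal_mult_top)
  qed (simp add: hausdorff_pre_empty)
next
  case False
  then obtain e where e: "0 < e" "{x. infdist x A \<le> e} \<subseteq> U"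
    using compact_in_open_separated assms by metis
  have B0: "0 \<le> B" using bounded[of 0 0] by linarith
  define \<rho> where "\<rho> = min 1 (min (e / (2 + B)) (\<delta> / (16 * L)))"
  have \<rho>01: "0 < \<rho>" "\<rho> \<le> 1" "\<rho> \<le> e / (2 + B)" "\<rho> \<le> \<delta> / (16 * L)"
    using e assms(4) L_ge_1 B0 by (auto simp: \<rho>_def)
  then have \<rho>: "0 < \<rho>" "\<rho> \<le> 1" "\<rho> * (2 + B) \<le> e" "16 * L * \<rho> \<le> \<delta>"
    using L_ge_1 B0 by (auto simp: pos_le_divide_eq mult.commute)
  have sub: "sbox w \<rho> \<subseteq> U" if "w \<in> A" for w
  proof
    fix w' assume "w' \<in> sbox w \<rho>"
    then have y: "\<bar>fst w' - fst w\<bar> \<le> \<rho>" and t: "\<bar>\<tau> w w'\<bar> \<le> \<rho>\<^sup>2" by (auto simp: mem_sbox)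
    have "\<bar>f (fst w) (snd w) * (fst w' - fst w)\<bar> \<le> B * \<rho>"
      unfolding abs_mult using y bounded B0 by (intro mult_mono) auto
    moreover have "\<rho>\<^sup>2 \<le> \<rho>" using \<rho> by (simp add: power2_eq_square mult_left_le)
    ultimately have "\<bar>snd w' - snd w\<bar> \<le> \<rho> + B * \<rho>" using t unfolding \<tau>_def by linarith
    moreover have "dist w' w \<le> \<bar>fst w' - fst w\<bar> + \<bar>snd w' - snd w\<bar>"
      by (simp add: dist_prod_def dist_real_def sqrt_sum_squares_le_sum_abs)
    ultimately have "dist w' w \<le> e" using y \<rho>(3) by (simp add: algebra_simps)
    then have "infdist w' A \<le> e" using infdist_le[OF that, of w'] by linarith
    then show "w' \<in> U" using e by auto
  qed
  define P where "P F \<longleftrightarrow> finite F \<and> F \<subseteq> A \<and> (\<forall>v\<in>F. \<forall>w\<in>F. v \<noteq> w \<longrightarrow> 8 * L * \<rho> < dist (\<Phi> v) (\<Phi> w))" for F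
  have card: "of_nat (card F) * ennreal (4 * \<rho> ^ 3) \<le> emeasure lborel U" if "P F" for F
  proof -
    have "disjoint_family_on (\<lambda>w. sbox w \<rho>) F"
    proof (unfold disjoint_family_on_def, intro ballI impI)
      fix v w assume vw: "v \<in> F" "w \<in> F" "v \<noteq> w"
      show "sbox v \<rho> \<inter> sbox w \<rho> = {}"
      proof (rule ccontr)
        assume "sbox v \<rho> \<inter> sbox w \<rho> \<noteq> {}"
        then obtain z where "z \<in> sbox v \<rho>" "z \<in> sbox w \<rho>" by blast
        then have "dist (\<Phi> v) (\<Phi> w) \<le> 4 * L * \<rho> + 4 * L * \<rho>"
          using dist_sbox[of z v \<rho>] dist_sbox[of z w \<rho>] dist_triangle2[of "\<Phi> v" "\<Phi> w" "\<Phi> z"] by linarith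
        moreover have "8 * L * \<rho> < dist (\<Phi> v) (\<Phi> w)" using that vw by (auto simp: P_def)
        ultimately show False by simp
      qed
    qed
    then have "(\<Sum>w\<in>F. emeasure lborel (sbox w \<rho>)) = emeasure lborel (\<Union>w\<in>F. sbox w \<rho>)"
      using that by (intro sum_emeasure) (auto simp: P_def sbox_borel)
    also have "\<dots> \<le> emeasure lborel U"
      using that sub assms(2) by (intro emeasure_mono) (auto simp: P_def)
    finally show ?thesis using \<rho> by (simp add: emeasure_sbox)
  qed
  obtain u where u: "emeasure lborel U = ennreal u" "0 \<le> u"
    using False by (cases "emeasure lborel U") auto
  have bound: "card F \<le> nat \<lceil>u / (4 * \<rho> ^ 3)\<rceil>" if "P F" for F
  proof -
    have "ennreal (real (card F) * (4 * \<rho> ^ 3)) \<le> ennreal u"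
      using card[OF that] \<rho> by (simp add: u ennreal_mult ennreal_of_nat_eq_real_of_nat)
    then have "real (card F) * (4 * \<rho> ^ 3) \<le> u" using u by (simp add: ennreal_le_iff)
    then have "real (card F) \<le> u / (4 * \<rho> ^ 3)" using \<rho> by (simp add: field_simps)
    then show ?thesis by linarith
  qed
  have "P {}" by (simp add: P_def)
  then obtain F where F: "P F" "\<And>G. P G \<Longrightarrow> card G \<le> card F"
    using ex_has_greatest_nat[of P "{}" card "Suc (nat \<lceil>u / (4 * \<rho> ^ 3)\<rceil>)"] bound
    by (auto simp: less_Suc_eq_le)
  have cover: "\<Phi> ` A \<subseteq> (\<Union>w\<in>F. cball (\<Phi> w) (8 * L * \<rho>))"
  proof
    fix p assume "p \<in> \<Phi> ` A"
    then obtain v where v: "v \<in> A" "p = \<Phi> v" by blast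
    show "p \<in> (\<Union>w\<in>F. cball (\<Phi> w) (8 * L * \<rho>))"
    proof (rule ccontr)
      assume "\<not> ?thesis"
      then have far: "8 * L * \<rho> < dist (\<Phi> w) (\<Phi> v)" if "w \<in> F" for w
        using that v by force
      have "v \<notin> F" using far[of v] L_ge_1 \<rho> by (auto simp: mult_less_0_iff)
      moreover have "P (insert v F)"
        using F(1) v far by (auto simp: P_def dist_commute)
      ultimately show False using F(2)[of "insert v F"] F(1) by (simp add: P_def)
    qed
  qed
  have "hausdorff_pre 3 \<delta> (\<Phi> ` A) \<le> of_nat (card F) * ennreal (16 * L * \<rho>) ^ 3"
  proof (rule hausdorff_pre_finite_le[OF _ cover])
    show "finite F" using F by (simp add: P_def)
    show "ediam (cball (\<Phi> i) (8 * L * \<rho>)) \<le> ennreal (16 * L * \<rho>)" for i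
    proof (rule ediam_le)
      fix x y assume "x \<in> cball (\<Phi> i) (8 * L * \<rho>)" "y \<in> cball (\<Phi> i) (8 * L * \<rho>)"
      then show "dist x y \<le> 16 * L * \<rho>"
        using dist_triangle3[of x y "\<Phi> i"] by simp
    qed
  qed (use \<rho> in auto)
  also have "\<dots> = ennreal (1024 * L ^ 3) * (of_nat (card F) * ennreal (4 * \<rho> ^ 3))"
    using L_ge_1 \<rho> by (simp add: ennreal_of_nat_eq_real_of_nat ennreal_mult[symmetric] ennreal_power power_mult_distrib algebra_simps)
  also have "\<dots> \<le> ennreal (1024 * L ^ 3) * emeasure lborel U"
    using card[OF F(1)] by (rule mult_left_mono) simp
  finally show ?thesis .
qed

lemma hausdorff_measure_compact_le:
  assumes "compact A"
  shows "hausdorff_measure 3 (\<Phi> ` A) \<le> ennreal (1024 * L ^ 3) * emeasure lborel A"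
proof (rule ennreal_le_epsilon)
  fix e :: real assume e: "0 < e"
  define \<eta> where "\<eta> = e / (1024 * L ^ 3)"
  have \<eta>: "0 < \<eta>" "1024 * L ^ 3 * \<eta> = e" using e L_ge_1 by (auto simp: \<eta>_def)
  have "A \<in> sets lebesgue" using assms by (simp add: lmeasurable_compact fmeasurableD)
  then obtain U where U: "open U" "A \<subseteq> U" "U - A \<in> lmeasurable" "emeasure lebesgue (U - A) < ennreal \<eta>"
    using sets_lebesgue_outer_open \<eta>(1) by metis
  have "A \<in> sets borel" using assms by (simp add: borel_compact)
  then have "emeasure lborel U = emeasure lborel A + emeasure lborel (U - A)"
    using U by (subst plus_emeasure) (auto simp: Un_absorb1)
  also have "emeasure lborel (U - A) \<le> ennreal \<eta>"
    using U \<open>A \<in> sets borel\<close> by (simp add: less_imp_le)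
  finally have "ennreal (1024 * L ^ 3) * emeasure lborel U \<le> ennreal (1024 * L ^ 3) * (emeasure lborel A + ennreal \<eta>)"
    by (intro mult_left_mono) (auto simp: add_left_mono)
  also have "\<dots> = ennreal (1024 * L ^ 3) * emeasure lborel A + ennreal e"
    using L_ge_1 \<eta> by (simp add: distrib_left ennreal_mult[symmetric])
  finally have le: "ennreal (1024 * L ^ 3) * emeasure lborel U \<le> ennreal (1024 * L ^ 3) * emeasure lborel A + ennreal e" .
  show "hausdorff_measure 3 (\<Phi> ` A) \<le> ennreal (1024 * L ^ 3) * emeasure lborel A + ennreal e"
    by (rule hausdorff_measure_leI) (rule order_trans[OF hausdorff_pre_le_open[OF assms U(1,2)] le])
qed

lemma emeasure_le_hausdorff_measure:
  assumes "A \<in> sets borel"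
  shows "emeasure lborel A \<le> 32 * hausdorff_measure 3 (\<Phi> ` A)"
proof -
  have "emeasure lborel A / 32 \<le> hausdorff_pre 3 1 (\<Phi> ` A)"
    unfolding hausdorff_pre_def
  proof (rule INF_greatest, clarify)
    fix C :: "nat \<Rightarrow> heis set"
    assume C: "\<Phi> ` A \<subseteq> (\<Union>i. C i)" "\<forall>i. ediam (C i) \<le> ennreal 1"
    define d where "d i = enn2real (ediam (C i))" for i
    have d: "ediam (C i) = ennreal (d i)" "0 \<le> d i" for i
      using le_less_trans[OF C(2)[rule_format, of i] ennreal_less_top] by (auto simp: d_def)
    define w where "w i = (SOME w. w \<in> A \<and> \<Phi> w \<in> C i)" for i
    define R where "R i = (if C i = {} then {} else sbox (w i) (2 * d i))" for i
    have "A \<subseteq> (\<Union>i. R i)"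
    proof
      fix v assume v: "v \<in> A"
      then obtain i where i: "\<Phi> v \<in> C i" using C(1) by blast
      then have "w i \<in> A \<and> \<Phi> (w i) \<in> C i"
        unfolding w_def using v by (intro someI[of "\<lambda>w. w \<in> A \<and> \<Phi> w \<in> C i"]) auto
      then have "ennreal (dist (\<Phi> (w i)) (\<Phi> v)) \<le> ennreal (d i)"
        using i dist_le_ediam d(1) by metis
      then have "dist (\<Phi> (w i)) (\<Phi> v) \<le> d i" using d(2) by (simp add: ennreal_le_iff)
      then have "v \<in> R i" using sbox_if_dist i by (auto simp: R_def)
      then show "v \<in> (\<Union>i. R i)" by blast
    qed
    moreover have R: "R i \<in> sets borel" for i by (simp add: R_def sbox_borel)
    ultimately have "emeasure lborel A \<le> emeasure lborel (\<Union>i. R i)"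
      by (intro emeasure_mono) auto
    also have "\<dots> \<le> (\<Sum>i. emeasure lborel (R i))"
      using R by (intro emeasure_subadditive_countably) auto
    also have "(\<Sum>i. emeasure lborel (R i)) = (\<Sum>i. 32 * (if C i = {} then 0 else ediam (C i) ^ 3))"
    proof (rule suminf_cong)
      fix i
      have "ennreal (4 * (2 * d i) ^ 3) = 32 * ennreal (d i) ^ 3"
        using d(2)[of i] by (simp add: ennreal_power power_mult_distrib ennreal_mult')
      then show "emeasure lborel (R i) = 32 * (if C i = {} then 0 else ediam (C i) ^ 3)"
        using d[of i] by (simp add: R_def emeasure_sbox)
    qed
    also have "\<dots> = 32 * (\<Sum>i. if C i = {} then 0 else ediam (C i) ^ 3)"
      by (rule ennreal_suminf_cmult)
    finally show "emeasure lborel A / 32 \<le> (\<Sum>i. if C i = {} then 0 else ediam (C i) ^ 3)"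
      by (subst divide_le_posI_ennreal) auto
  qed
  also have "\<dots> \<le> hausdorff_measure 3 (\<Phi> ` A)" by (rule hausdorff_pre_le_measure) simp
  finally have "32 * (emeasure lborel A / 32) \<le> 32 * hausdorff_measure 3 (\<Phi> ` A)"
    by (rule mult_left_mono) simp
  then show ?thesis
    by (simp add: ennreal_times_divide mult.commute[of 32] ennreal_mult_divide_eq)
qed

lemma hausdorff_measure_ball_le:
  assumes "p \<in> range \<Phi>" and "0 < r"
  shows "hausdorff_measure 3 (range \<Phi> \<inter> ball p r) \<le> ennreal (32768 * L ^ 3 * r ^ 3)"
proof -
  obtain w where w: "p = \<Phi> w" using assms by blast
  have "range \<Phi> \<inter> ball p r \<subseteq> \<Phi> ` sbox w (2 * r)"
    by (auto simp: w intro!: imageI sbox_if_dist)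
  then have "hausdorff_measure 3 (range \<Phi> \<inter> ball p r) \<le> hausdorff_measure 3 (\<Phi> ` sbox w (2 * r))"
    by (rule hausdorff_measure_mono)
  also have "\<dots> \<le> ennreal (1024 * L ^ 3) * emeasure lborel (sbox w (2 * r))"
    by (rule hausdorff_measure_compact_le[OF compact_sbox])
  also have "\<dots> = ennreal (32768 * L ^ 3 * r ^ 3)"
    using assms L_ge_1 by (simp add: emeasure_sbox ennreal_mult[symmetric] power_mult_distrib algebra_simps)
  finally show ?thesis .
qed

end

section \<open>Approximate characteristics\<close>

lemma lipschitz_rounding:
  fixes F :: "real \<Rightarrow> real"
  assumes "0 \<le> c" and F: "\<And>u v. \<bar>F u - F v\<bar> \<le> c * (A + \<bar>u - v\<bar>)"
  shows "\<exists>G. (\<forall>u v. \<bar>G u - G v\<bar> \<le> c * \<bar>u - v\<bar>) \<and> (\<forall>u. \<bar>G u - F u\<bar> \<le> c * A)"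
proof -
  define G where "G u = (SUP v. F v - c * \<bar>u - v\<bar>)" for u
  have le: "F v - c * \<bar>u - v\<bar> \<le> F u + c * A" for u v
    using F[of v u] by (simp add: algebra_simps abs_le_iff abs_minus_commute)
  then have bdd: "bdd_above (range (\<lambda>v. F v - c * \<bar>u - v\<bar>))" for u by (auto intro!: bdd_aboveI2[where M="F u + c * A"])
  have G1: "G u \<le> F u + c * A" for u
    unfolding G_def using le by (auto intro: cSUP_least)
  have up: "F v - c * \<bar>u - v\<bar> \<le> G u" for u v
    unfolding G_def by (intro cSUP_upper bdd) auto
  have G3: "G u \<le> G w + c * \<bar>u - w\<bar>" for u w
    unfolding G_def[of u]
  proof (rule cSUP_least)
    fix v
    have "c * \<bar>w - v\<bar> \<le> c * \<bar>u - v\<bar> + c * \<bar>u - w\<bar>"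
      using assms(1) by (simp add: distrib_left[symmetric] mult_left_mono)
    then show "F v - c * \<bar>u - v\<bar> \<le> G w + c * \<bar>u - w\<bar>" using up[of v w] by linarith
  qed simp
  have "\<bar>G u - G v\<bar> \<le> c * \<bar>u - v\<bar>" for u v
    using G3[of u v] G3[of v u] by (simp add: abs_le_iff abs_minus_commute)
  moreover have "\<bar>G u - F u\<bar> \<le> c * A" for u
    using G1[of u] up[of u u] F[of u u] by (simp add: abs_le_iff)
  ultimately show ?thesis by blast
qed

lemma geometric_limit:
  fixes v :: "nat \<Rightarrow> real"
  assumes "\<And>j. \<bar>v (Suc j) - v j\<bar> \<le> c * (1/4) ^ j"
  shows "convergent v" and "\<bar>lim v - v 0\<bar> \<le> 2 * c"
proof -
  have sm: "summable (\<lambda>j. c * (1/4) ^ j)" by (intro summable_mult summable_geometric) simp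
  have "summable (\<lambda>j. v (Suc j) - v j)"
    by (rule summable_comparison_test[OF _ sm]) (use assms in auto)
  then have "convergent (\<lambda>n. \<Sum>j<n. v (Suc j) - v j)" by (simp add: summable_iff_convergent)
  then have "convergent (\<lambda>n. (v n - v 0) + v 0)"
    unfolding sum_lessThan_telescope by (intro convergent_add convergent_const)
  then show conv: "convergent v" by simp
  have c: "0 \<le> c" using assms[of 0] by simp
  have "\<bar>v n - v 0\<bar> \<le> 2 * c" for n
  proof -
    have "\<bar>v n - v 0\<bar> \<le> c * (\<Sum>j<n. (1/4) ^ j)"
    proof (induction n)
      case (Suc n) then show ?case using assms[of n] by (simp add: distrib_left)
    qed simp
    moreover have "(\<Sum>j<n. (1/4::real) ^ j) \<le> 2"
    proof -
      have "(\<Sum>j<n. (1/4::real) ^ j) = 4/3 * (1 - (1/4) ^ n)" by (simp add: sum_gp_strict)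
      moreover have "0 \<le> (1/4::real) ^ n" by simp
      moreover have "4/3 * (1 - x) \<le> 2" if "0 \<le> x" for x :: real using that by simp
      ultimately show ?thesis by metis
    qed
    ultimately show ?thesis using mult_left_mono[OF _ c] by (metis order_trans mult.commute)
  qed
  moreover have "(\<lambda>n. \<bar>v n - v 0\<bar>) \<longlonglongrightarrow> \<bar>lim v - v 0\<bar>"
    using conv by (intro tendsto_intros) (simp add: convergent_LIMSEQ_iff)
  ultimately show "\<bar>lim v - v 0\<bar> \<le> 2 * c" by (intro LIMSEQ_le_const2) auto
qed

lemma floor_double: "\<lfloor>2 * x\<rfloor> div 2 = \<lfloor>x::real\<rfloor>"
  using floor_divide_real_eq_div[of 2 "2 * x"] by simp

definition base :: "nat \<Rightarrow> real \<Rightarrow> real" where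
  "base n y = \<lfloor>2 ^ n * y\<rfloor> / 2 ^ n"

lemma base_le: "base n y \<le> y" and base_gt: "y < base n y + (1/2) ^ n"
proof -
  have "2 ^ n * base n y = \<lfloor>2 ^ n * y\<rfloor>" by (simp add: base_def)
  then have "2 ^ n * base n y \<le> 2 ^ n * y" "2 ^ n * y < 2 ^ n * (base n y + (1/2) ^ n)"
    by (simp_all add: distrib_left power_one_over)
  then show "base n y \<le> y" "y < base n y + (1/2) ^ n" by simp_all
qed

lemma base_mono: "base n y \<le> base (Suc n) y"
proof -
  have "2 * \<lfloor>2 ^ n * y\<rfloor> \<le> \<lfloor>2 * (2 ^ n * y)\<rfloor>" by (simp add: le_floor_iff)
  then have "real_of_int (2 * \<lfloor>2 ^ n * y\<rfloor>) \<le> real_of_int \<lfloor>2 * (2 ^ n * y)\<rfloor>" by (rule of_int_le_iff[THEN iffD2])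
  then show ?thesis by (simp add: base_def field_simps)
qed

lemma base_eq_iff: "base n y = base n y' \<longleftrightarrow> \<lfloor>2 ^ n * y\<rfloor> = \<lfloor>2 ^ n * y'\<rfloor>"
  by (simp add: base_def)

locale hoelder_graph = lipschitz_graph +
  fixes \<alpha> H :: real
  assumes \<alpha>: "0 < \<alpha>" "\<alpha> \<le> 1" and H_ge_1: "1 \<le> H"
    and hoelder: "\<bar>f y t - f y t'\<bar> \<le> H * \<bar>t - t'\<bar> powr ((1 + \<alpha>) / 2)"
begin

text \<open>At scale \<open>l\<close> the vertical Hoelder condition is used only in this linearised form.\<close>

lemma hoelder_linear:
  assumes "0 < l"
  shows "\<bar>f y t - f y t'\<bar> \<le> H * l powr \<alpha> * (l + \<bar>t - t'\<bar> / l)"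
proof -
  define x where "x = \<bar>t - t'\<bar>"
  have x: "0 \<le> x" by (simp add: x_def)
  have l2: "l\<^sup>2 = l powr 2" using assms by (simp add: powr_numeral)
  have "x powr ((1 + \<alpha>) / 2) \<le> l powr \<alpha> * (l + x / l)"
  proof (cases "x \<le> l\<^sup>2")
    case True
    then have "x powr ((1 + \<alpha>) / 2) \<le> (l\<^sup>2) powr ((1 + \<alpha>) / 2)"
      using x \<alpha> by (intro powr_mono2) auto
    also have "\<dots> = l powr \<alpha> * l" 
    proof -
      have e: "2 * ((1 + \<alpha>) / 2) = \<alpha> + 1" by (simp add: field_simps)
      have "(l powr 2) powr ((1 + \<alpha>) / 2) = l powr (\<alpha> + 1)" unfolding powr_powr e ..
      then show ?thesis unfolding l2 using assms by (simp add: powr_add)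
    qed
    also have "\<dots> \<le> l powr \<alpha> * (l + x / l)" using x assms by (intro mult_left_mono) auto
    finally show ?thesis .
  next
    case False
    then have x0: "0 < x" using zero_le_power2[of l] by linarith
    have "(1 + \<alpha>) / 2 = 1 + (\<alpha> - 1) / 2" by (simp add: field_simps)
    then have "x powr ((1 + \<alpha>) / 2) = x powr (1 + (\<alpha> - 1) / 2)" by (simp only:)
    also have "\<dots> = x * x powr ((\<alpha> - 1) / 2)" using x0 by (simp add: powr_add)
    also have "\<dots> \<le> x * (l\<^sup>2) powr ((\<alpha> - 1) / 2)"
      using x0 False \<alpha> assms by (intro mult_left_mono powr_mono2') auto
    also have "\<dots> = x * l powr (\<alpha> - 1)" proof -
      have e: "2 * ((\<alpha> - 1) / 2) = \<alpha> - 1" by simp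
      show ?thesis unfolding l2 powr_powr e ..
    qed
    also have "\<dots> = l powr \<alpha> * (x / l)" using assms by (simp add: powr_diff)
    also have "\<dots> \<le> l powr \<alpha> * (l + x / l)" using assms by (intro mult_left_mono) auto
    finally show ?thesis .
  qed
  then have "H * x powr ((1 + \<alpha>) / 2) \<le> H * (l powr \<alpha> * (l + x / l))"
    using H_ge_1 by (intro mult_left_mono) auto
  then show ?thesis using hoelder[of y t t'] by (simp add: x_def)
qed

lemma H_nonneg: "0 \<le> H" and L_nonneg: "0 \<le> L" and B_nonneg: "0 \<le> B"
  using H_ge_1 L_ge_1 bounded[of 0 0] by auto

text \<open>The curve through \<open>(b, u)\<close> obtained by integrating \<open>f\<close> along the tangent line at \<open>(b, u)\<close>:
  it stays within \<open>O(l\<^sup>2)\<close> of that line, so it solves the characteristic equation up to \<open>O(l\<^bsup>1 + \<alpha>\<^esup>)\<close>.\<close>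

definition \<Gamma> :: "real \<Rightarrow> real \<Rightarrow> real \<Rightarrow> real" where
  "\<Gamma> b u y = u + integral {b..y} (\<lambda>r. f r (u + f b u * (r - b)))"

lemma integrable_line: "(\<lambda>r. f r (p + q * (r - c))) integrable_on {b..y}"
proof -
  have "continuous_on {b..y} (\<lambda>r. (\<lambda>w. f (fst w) (snd w)) (r, p + q * (r - c)))"
    by (intro continuous_on_compose2[OF continuous_f] continuous_intros) auto
  then show ?thesis by (simp add: integrable_continuous_interval)
qed

lemma integral_line_diff:
  assumes "b \<le> y" and "\<And>r. b \<le> r \<Longrightarrow> r \<le> y \<Longrightarrow> \<bar>f r (p + q * (r - c)) - f r (p' + q' * (r - c'))\<bar> \<le> M"
  shows "\<bar>integral {b..y} (\<lambda>r. f r (p + q * (r - c))) - integral {b..y} (\<lambda>r. f r (p' + q' * (r - c')))\<bar> \<le> M * (y - b)"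
proof -
  have "norm (integral {b..y} (\<lambda>r. f r (p + q * (r - c)) - f r (p' + q' * (r - c')))) 
      \<le> integral {b..y} (\<lambda>r. M)"
    by (rule integral_norm_bound_integral) (use assms in \<open>auto intro: integrable_diff integrable_line\<close>)
  then show ?thesis
    using assms(1) by (simp add: integral_diff integrable_line mult.commute)
qed

lemma along_line: "\<bar>f r (u + f b u * (r - b)) - f b u\<bar> \<le> L * \<bar>r - b\<bar>"
  using lip[of r "u + f b u * (r - b)" b u] by simp

lemma \<Gamma>_linear:
  assumes "b \<le> y"
  shows "\<bar>\<Gamma> b u y - u - f b u * (y - b)\<bar> \<le> L * (y - b)\<^sup>2"
proof -
  have "norm (integral {b..y} (\<lambda>r. f r (u + f b u * (r - b)) - f b u)) \<le> integral {b..y} (\<lambda>r. L * (y - b))"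
  proof (rule integral_norm_bound_integral)
    fix r assume r: "r \<in> {b..y}"
    have "L * \<bar>r - b\<bar> \<le> L * (y - b)" using r L_nonneg by (intro mult_left_mono) auto
    then show "norm (f r (u + f b u * (r - b)) - f b u) \<le> L * (y - b)"
      using along_line[of r u b] by simp
  qed (auto intro: integrable_diff integrable_line)
  moreover have "integral {b..y} (\<lambda>r. f r (u + f b u * (r - b)) - f b u) 
      = integral {b..y} (\<lambda>r. f r (u + f b u * (r - b))) - integral {b..y} (\<lambda>r. f b u)"
    by (rule integral_diff[OF integrable_line integrable_const_ivl])
  ultimately show ?thesis using assms
    by (simp add: \<Gamma>_def power2_eq_square ac_simps)
qed

lemma \<Gamma>_bounded:
  assumes "b \<le> y"
  shows "\<bar>\<Gamma> b u y - u\<bar> \<le> B * (y - b)"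
proof -
  have "norm (integral {b..y} (\<lambda>r. f r (u + f b u * (r - b)))) \<le> integral {b..y} (\<lambda>r. B)"
    by (rule integral_norm_bound_integral) (auto intro: integrable_line bounded)
  then show ?thesis using assms by (simp add: \<Gamma>_def mult.commute)
qed

definition "C0 = H * (1 + L) + 2 * L"
definition "C1 = H * (1 + C0)"
definition "C2 = H * (1 + H)"
definition "C3 = C1 + 2 * C2 + C2\<^sup>2"

lemma C_nonneg: "0 \<le> C0" "0 \<le> C1" "0 \<le> C2" "0 \<le> C3"
  using H_nonneg L_nonneg by (auto simp: C0_def C1_def C2_def C3_def)

lemma powr_le_1: "0 < l \<Longrightarrow> l \<le> 1 \<Longrightarrow> l powr \<alpha> \<le> 1"
  using powr_mono2[of \<alpha> l 1] \<alpha> by simp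

lemma \<Gamma>_diff:
  assumes l: "0 < l" "l \<le> 1" and y: "b \<le> y" "y \<le> b + l"
  shows "\<bar>\<Gamma> b u y - \<Gamma> b v y - (u - v)\<bar> \<le> C2 * l powr \<alpha> * (l\<^sup>2 + \<bar>u - v\<bar>)"
proof -
  define d where "d = \<bar>u - v\<bar>"
  have d: "0 \<le> d" by (simp add: d_def)
  define \<kappa> where "\<kappa> = l powr \<alpha>"
  have \<kappa>: "0 \<le> \<kappa>" "\<kappa> \<le> 1" using powr_le_1[OF l] by (auto simp: \<kappa>_def)
  define M where "M = C2 * \<kappa> * (l + d / l)"
  have M0: "0 \<le> M" using C_nonneg \<kappa> d l by (simp add: M_def)
  have "\<bar>f r (u + f b u * (r - b)) - f r (v + f b v * (r - b))\<bar> \<le> M" if r: "b \<le> r" "r \<le> y" for r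
  proof -
    have "\<bar>f b u - f b v\<bar> \<le> H * \<kappa> * (l + d / l)" using hoelder_linear[OF l(1)] by (simp add: \<kappa>_def d_def)
    also have "\<dots> \<le> H * 1 * (l + d / l)" using \<kappa> H_nonneg d l by (intro mult_right_mono mult_left_mono) auto
    finally have "\<bar>f b u - f b v\<bar> * \<bar>r - b\<bar> \<le> H * 1 * (l + d / l) * l"
      using r y H_nonneg d l by (intro mult_mono) auto
    moreover have "H * 1 * (l + d / l) * l = H * (l\<^sup>2 + d)" using l by (simp add: power2_eq_square field_simps)
    ultimately have s: "\<bar>(f b u - f b v) * (r - b)\<bar> \<le> H * (l\<^sup>2 + d)" by (metis abs_mult)
    have "(u + f b u * (r - b)) - (v + f b v * (r - b)) = (u - v) + (f b u - f b v) * (r - b)"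
      by (simp add: algebra_simps)
    then have "\<bar>(u + f b u * (r - b)) - (v + f b v * (r - b))\<bar> \<le> d + H * (l\<^sup>2 + d)"
      using s abs_triangle_ineq[of "u - v" "(f b u - f b v) * (r - b)"] by (simp add: d_def)
    then have "\<bar>f r (u + f b u * (r - b)) - f r (v + f b v * (r - b))\<bar> \<le> H * \<kappa> * (l + (d + H * (l\<^sup>2 + d)) / l)"
      using hoelder_linear[OF l(1), of r "u + f b u * (r - b)" "v + f b v * (r - b)"] H_nonneg \<kappa> l
      unfolding \<kappa>_def[symmetric]
      by (elim order_trans) (intro mult_left_mono add_left_mono divide_right_mono, auto)
    also have "\<dots> = M" using l by (simp add: M_def C2_def power2_eq_square field_simps)
    finally show ?thesis .
  qed
  then have "\<bar>\<Gamma> b u y - \<Gamma> b v y - (u - v)\<bar> \<le> M * (y - b)"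
    unfolding \<Gamma>_def using integral_line_diff[OF y(1), of u "f b u" b v "f b v" b M] by simp
  also have "\<dots> \<le> M * l" using M0 y by (intro mult_left_mono) auto
  also have "\<dots> = C2 * \<kappa> * (l\<^sup>2 + d)" using l by (simp add: M_def power2_eq_square field_simps)
  finally show ?thesis by (simp add: d_def \<kappa>_def)
qed

lemma \<Gamma>_consistent:
  assumes l: "0 < l" "l \<le> 1" and b: "b \<le> b'" "b' \<le> y" "y \<le> b + l"
  shows "\<bar>\<Gamma> b' (\<Gamma> b u b') y - \<Gamma> b u y\<bar> \<le> C1 * l powr \<alpha> * l\<^sup>2"
proof -
  define \<kappa> where "\<kappa> = l powr \<alpha>"
  have \<kappa>: "0 \<le> \<kappa>" "\<kappa> \<le> 1" using powr_le_1[OF l] by (auto simp: \<kappa>_def)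
  define p where "p = \<Gamma> b u b'"
  define q where "q = f b' p"
  define a where "a r = u + f b u * (r - b)" for r
  have split: "\<Gamma> b u y = p + integral {b'..y} (\<lambda>r. f r (u + f b u * (r - b)))"
    using Henstock_Kurzweil_Integration.integral_combine[OF b(1,2) integrable_line, of u "f b u" b]
    by (simp add: p_def \<Gamma>_def)
  have b'b: "\<bar>b' - b\<bar> \<le> l" using b by simp
  have "L * (b' - b)\<^sup>2 \<le> L * l\<^sup>2" using b'b L_nonneg l by (intro mult_left_mono) (auto simp: abs_le_square_iff[symmetric])
  then have pa: "\<bar>p - a b'\<bar> \<le> L * l\<^sup>2"
    using \<Gamma>_linear[OF b(1), of u] unfolding p_def a_def by (simp add: diff_diff_eq)
  have "\<bar>q - f b' (a b')\<bar> \<le> H * \<kappa> * (l + \<bar>p - a b'\<bar> / l)"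
    unfolding q_def \<kappa>_def by (rule hoelder_linear[OF l(1)])
  also have "\<dots> \<le> H * 1 * (l + (L * l\<^sup>2) / l)"
    using pa \<kappa> H_nonneg l by (intro mult_mono add_mono divide_right_mono) auto
  finally have q1: "\<bar>q - f b' (a b')\<bar> \<le> H * (1 + L) * l"
    using l by (simp add: power2_eq_square algebra_simps)
  have "L * \<bar>b' - b\<bar> \<le> L * l" using b'b L_nonneg by (intro mult_left_mono)
  then have q2: "\<bar>f b' (a b') - f b u\<bar> \<le> L * l"
    using along_line[of b' u b] unfolding a_def by linarith
  have q: "\<bar>q - f b u\<bar> \<le> (H * (1 + L) + L) * l"
    using abs_triangle_ineq[of "q - f b' (a b')" "f b' (a b') - f b u"] q1 q2 by (simp add: distrib_right)
  define M where "M = C1 * \<kappa> * l"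
  have M0: "0 \<le> M" using C_nonneg \<kappa> l by (simp add: M_def)
  have "\<bar>f r (p + q * (r - b')) - f r (u + f b u * (r - b))\<bar> \<le> M" if r: "b' \<le> r" "r \<le> y" for r
  proof -
    have "\<bar>(q - f b u) * (r - b')\<bar> \<le> (H * (1 + L) + L) * l * l"
      unfolding abs_mult using q r b H_nonneg L_nonneg l by (intro mult_mono) auto
    moreover have "(p + q * (r - b')) - (u + f b u * (r - b)) = (p - a b') + (q - f b u) * (r - b')"
      by (simp add: a_def algebra_simps)
    ultimately have "\<bar>(p + q * (r - b')) - (u + f b u * (r - b))\<bar> \<le> L * l\<^sup>2 + (H * (1 + L) + L) * l * l"
      using pa abs_triangle_ineq[of "p - a b'" "(q - f b u) * (r - b')"] by simp
    also have "\<dots> = C0 * l\<^sup>2" by (simp add: C0_def power2_eq_square algebra_simps)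
    finally have pq: "\<bar>(p + q * (r - b')) - (u + f b u * (r - b))\<bar> \<le> C0 * l\<^sup>2" .
    have "\<bar>f r (p + q * (r - b')) - f r (u + f b u * (r - b))\<bar> 
        \<le> H * \<kappa> * (l + \<bar>(p + q * (r - b')) - (u + f b u * (r - b))\<bar> / l)"
      unfolding \<kappa>_def by (rule hoelder_linear[OF l(1)])
    also have "\<dots> \<le> H * \<kappa> * (l + C0 * l\<^sup>2 / l)"
      using pq H_nonneg \<kappa> l by (intro mult_left_mono add_left_mono divide_right_mono) auto
    also have "\<dots> = M" using l by (simp add: M_def C1_def power2_eq_square algebra_simps)
    finally show ?thesis .
  qed
  then have "\<bar>\<Gamma> b' p y - \<Gamma> b u y\<bar> \<le> M * (y - b')"
    unfolding split unfolding \<Gamma>_def q_def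
    using integral_line_diff[OF b(2), of p "f b' p" b' u "f b u" b M] by simp
  also have "\<dots> \<le> M * l" using M0 b by (intro mult_left_mono) auto
  finally show ?thesis by (simp add: p_def M_def \<kappa>_def power2_eq_square mult.assoc)
qed

definition \<kappa> :: "nat \<Rightarrow> real" where
  "\<kappa> n = ((1/2) ^ n) powr \<alpha>"

lemma \<kappa>_eq_power: "\<kappa> n = ((1/2) powr \<alpha>) ^ n"
proof -
  have "\<kappa> n = ((1/2) powr n) powr \<alpha>" by (simp add: \<kappa>_def powr_realpow)
  then show ?thesis by (simp add: powr_power powr_powr mult.commute)
qed

lemma \<kappa>_pos: "0 < \<kappa> n" and \<kappa>_le_1: "\<kappa> n \<le> 1"
  using powr_le_1[of "(1/2) ^ n"] by (auto simp: \<kappa>_def power_le_one)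

lemma \<kappa>_Suc: "\<kappa> n / 2 \<le> \<kappa> (Suc n)" "\<kappa> (Suc n) \<le> \<kappa> n"
proof -
  have eq: "\<kappa> (Suc n) = (1/2) powr \<alpha> * \<kappa> n" by (simp add: \<kappa>_eq_power)
  have "(1/2) powr 1 \<le> (1/2::real) powr \<alpha>" using \<alpha> by (intro powr_mono') auto
  then have "(1/2) * \<kappa> n \<le> (1/2) powr \<alpha> * \<kappa> n" using \<kappa>_pos[of n] by (intro mult_right_mono) auto
  then show "\<kappa> n / 2 \<le> \<kappa> (Suc n)" by (simp add: eq)
  have "(1/2) powr \<alpha> * \<kappa> n \<le> 1 * \<kappa> n" using \<kappa>_pos[of n] powr_le_1[of "1/2"] by (intro mult_right_mono) auto
  then show "\<kappa> (Suc n) \<le> \<kappa> n" by (simp add: eq)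
qed

lemma \<kappa>_antimono: "m \<le> n \<Longrightarrow> \<kappa> n \<le> \<kappa> m"
  by (induction n rule: dec_induct) (auto intro: order_trans \<kappa>_Suc)

text \<open>As a function of the starting height, \<open>\<Gamma>\<close> is only Hoelder continuous; a good step replaces it, within
  the admissible error, by a map close to the identity in the Lipschitz sense.\<close>

definition good_step :: "nat \<Rightarrow> real \<Rightarrow> real \<Rightarrow> (real \<Rightarrow> real) \<Rightarrow> bool" where
  "good_step n b b' P \<longleftrightarrow> (\<forall>u v. \<bar>P u - P v - (u - v)\<bar> \<le> C2 * \<kappa> n * \<bar>u - v\<bar>) \<and>
    (\<forall>u. \<bar>P u - \<Gamma> b u b'\<bar> \<le> C2 * \<kappa> n * ((1/2) ^ n)\<^sup>2)"

definition step :: "nat \<Rightarrow> real \<Rightarrow> real \<Rightarrow> real \<Rightarrow> real" where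
  "step n b b' = (SOME P. good_step n b b' P)"

lemma good_step:
  assumes "b \<le> b'" "b' \<le> b + (1/2) ^ n"
  shows "good_step n b b' (step n b b')"
proof -
  have "\<exists>G. (\<forall>u v. \<bar>G u - G v\<bar> \<le> C2 * \<kappa> n * \<bar>u - v\<bar>) \<and> 
      (\<forall>u. \<bar>G u - (\<Gamma> b u b' - u)\<bar> \<le> C2 * \<kappa> n * ((1/2) ^ n)\<^sup>2)"
  proof (rule lipschitz_rounding)
    fix u v
    have "\<bar>\<Gamma> b u b' - \<Gamma> b v b' - (u - v)\<bar> \<le> C2 * \<kappa> n * (((1/2) ^ n)\<^sup>2 + \<bar>u - v\<bar>)"
      unfolding \<kappa>_def using assms by (intro \<Gamma>_diff) (auto simp: power_le_one)
    then show "\<bar>(\<Gamma> b u b' - u) - (\<Gamma> b v b' - v)\<bar> \<le> C2 * \<kappa> n * (((1/2) ^ n)\<^sup>2 + \<bar>u - v\<bar>)"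
      by (simp add: algebra_simps)
  qed (use C_nonneg \<kappa>_pos[of n] in auto)
  then obtain G where G: "\<And>u v. \<bar>G u - G v\<bar> \<le> C2 * \<kappa> n * \<bar>u - v\<bar>"
      "\<And>u. \<bar>G u - (\<Gamma> b u b' - u)\<bar> \<le> C2 * \<kappa> n * ((1/2) ^ n)\<^sup>2" by blast
  have "good_step n b b' (\<lambda>u. u + G u)"
    unfolding good_step_def using G by (simp add: algebra_simps)
  then show ?thesis unfolding step_def by (rule someI[of "good_step n b b'"])
qed

primrec U :: "nat \<Rightarrow> real \<Rightarrow> real \<Rightarrow> nat \<Rightarrow> real" where
  "U k y s 0 = s"
| "U k y s (Suc i) = step (k + i) (base (k + i) y) (base (k + Suc i) y) (U k y s i)"

definition V :: "nat \<Rightarrow> real \<Rightarrow> real \<Rightarrow> nat \<Rightarrow> real" where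
  "V k y s i = \<Gamma> (base (k + i) y) (U k y s i) y"

definition T :: "nat \<Rightarrow> real \<Rightarrow> real \<Rightarrow> real" where
  "T k y s = lim (V k y s)"

lemma V_step: "\<bar>V k y s (Suc i) - V k y s i\<bar> \<le> C3 * \<kappa> (k + i) * ((1/2) ^ (k + i))\<^sup>2"
proof -
  define n where "n = k + i"
  define l where "l = (1/2::real) ^ n"
  define b b' where "b = base n y" and "b' = base (Suc n) y"
  define u u' where "u = U k y s i" and "u' = U k y s (Suc i)"
  have l: "0 < l" "l \<le> 1" "l powr \<alpha> = \<kappa> n" by (auto simp: l_def power_le_one \<kappa>_def)
  have b: "b \<le> b'" "b' \<le> y" "y \<le> b + l"
    using base_mono[of n y] base_le[of "Suc n" y] base_gt[of y n] by (auto simp: b_def b'_def l_def)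
  have u': "u' = step n b b' u" by (simp add: u'_def u_def n_def b_def b'_def)
  have e1: "\<bar>u' - \<Gamma> b u b'\<bar> \<le> C2 * \<kappa> n * l\<^sup>2"
    using good_step[of b b' n] b unfolding good_step_def u' l_def by auto
  have "\<bar>\<Gamma> b' u' y - \<Gamma> b' (\<Gamma> b u b') y - (u' - \<Gamma> b u b')\<bar> \<le> C2 * \<kappa> n * (l\<^sup>2 + \<bar>u' - \<Gamma> b u b'\<bar>)"
    using \<Gamma>_diff[OF l(1,2), of b' y u' "\<Gamma> b u b'"] b l(3) by simp
  also have "\<dots> \<le> C2 * \<kappa> n * (l\<^sup>2 + C2 * 1 * l\<^sup>2)"
    using e1 C_nonneg \<kappa>_pos[of n] \<kappa>_le_1[of n]
    by (intro mult_left_mono add_left_mono order_trans[OF e1] mult_right_mono) auto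
  finally have e2: "\<bar>\<Gamma> b' u' y - \<Gamma> b' (\<Gamma> b u b') y - (u' - \<Gamma> b u b')\<bar> \<le> C2 * \<kappa> n * (l\<^sup>2 + C2 * 1 * l\<^sup>2)" .
  have e3: "\<bar>\<Gamma> b' (\<Gamma> b u b') y - \<Gamma> b u y\<bar> \<le> C1 * \<kappa> n * l\<^sup>2"
    using \<Gamma>_consistent[OF l(1,2) b, of u] l(3) by simp
  have tri: "\<bar>a - d\<bar> \<le> e + e' + e''" if "\<bar>a - c - (x - z)\<bar> \<le> e" "\<bar>x - z\<bar> \<le> e'" "\<bar>c - d\<bar> \<le> e''"
    for a c d e e' e'' x z :: real using that by linarith
  have "\<bar>\<Gamma> b' u' y - \<Gamma> b u y\<bar> \<le> C2 * \<kappa> n * (l\<^sup>2 + C2 * 1 * l\<^sup>2) + C2 * \<kappa> n * l\<^sup>2 + C1 * \<kappa> n * l\<^sup>2"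
    by (rule tri[OF e2 e1 e3])
  also have "\<dots> = C3 * \<kappa> n * l\<^sup>2" by (simp add: C3_def power2_eq_square algebra_simps)
  finally show ?thesis by (simp add: V_def n_def l_def b_def b'_def u_def u'_def)
qed

lemma V_step_shift: "\<bar>V k y s (Suc (i + j)) - V k y s (i + j)\<bar> \<le> C3 * \<kappa> (k + i) * ((1/2) ^ (k + i))\<^sup>2 * (1/4) ^ j"
proof -
  have "((1/2) ^ (k + (i + j)))\<^sup>2 = ((1/2) ^ (k + i))\<^sup>2 * (1/4::real) ^ j"
    by (simp add: power_add power_mult_distrib power2_eq_square power_mult_distrib[symmetric])
  then have "C3 * \<kappa> (k + (i + j)) * ((1/2) ^ (k + (i + j)))\<^sup>2 
      \<le> C3 * \<kappa> (k + i) * (((1/2) ^ (k + i))\<^sup>2 * (1/4) ^ j)"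
    using C_nonneg less_imp_le[OF \<kappa>_pos] by (intro mult_mono \<kappa>_antimono) auto
  then show ?thesis using V_step[of k y s "i + j"] by simp
qed

lemma V_tendsto: "V k y s \<longlonglongrightarrow> T k y s"
  using geometric_limit(1)[of "V k y s" "C3 * \<kappa> k * ((1/2) ^ k)\<^sup>2"] V_step_shift[of k y s 0]
  by (simp add: T_def convergent_LIMSEQ_iff)

lemma T_close: "\<bar>T k y s - V k y s i\<bar> \<le> 2 * C3 * \<kappa> (k + i) * ((1/2) ^ (k + i))\<^sup>2"
proof -
  have "(\<lambda>j. V k y s (i + j)) \<longlonglongrightarrow> T k y s"
    using LIMSEQ_ignore_initial_segment[OF V_tendsto[of k y s], of i] by (simp add: add.commute)
  then have "lim (\<lambda>j. V k y s (i + j)) = T k y s" by (rule limI)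
  then show ?thesis
    using geometric_limit(2)[of "\<lambda>j. V k y s (i + j)" "C3 * \<kappa> (k + i) * ((1/2) ^ (k + i))\<^sup>2"] V_step_shift[of k y s i]
    by (simp add: mult.assoc)
qed

lemma U_cong: "(\<And>j. j \<le> i \<Longrightarrow> base (k + j) y = base (k + j) y') \<Longrightarrow> U k y s i = U k y' s i"
proof (induction i)
  case (Suc i)
  then have "U k y s i = U k y' s i" by simp
  then show ?case using Suc.prems[of i] Suc.prems[of "Suc i"] by simp
qed simp

definition small :: "nat \<Rightarrow> bool" where
  "small k \<longleftrightarrow> (\<forall>i. (\<Sum>j<i. C2 * \<kappa> (k + j)) \<le> 1/4)"

lemma U_diff:
  assumes "small k"
  shows "\<bar>U k y s' i - U k y s i - (s' - s)\<bar> \<le> \<bar>s' - s\<bar> / 2"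
proof -
  define S where "S i = (\<Sum>j<i. C2 * \<kappa> (k + j))" for i
  have S: "S i \<le> 1/4" for i using assms by (simp add: small_def S_def)
  have "\<bar>U k y s' i - U k y s i - (s' - s)\<bar> \<le> 2 * S i * \<bar>s' - s\<bar>"
  proof (induction i)
    case (Suc i)
    define c where "c = C2 * \<kappa> (k + i)"
    define D where "D = U k y s' i - U k y s i"
    define D' where "D' = U k y s' (Suc i) - U k y s (Suc i)"
    have c: "0 \<le> c" using C_nonneg \<kappa>_pos[of "k + i"] by (simp add: c_def)
    have "base (k + i) y \<le> base (k + Suc i) y" "base (k + Suc i) y \<le> base (k + i) y + (1/2) ^ (k + i)"
      using base_mono[of "k + i" y] base_le[of "k + Suc i" y] base_gt[of y "k + i"] by auto
    from good_step[OF this] have "\<bar>D' - D\<bar> \<le> c * \<bar>D\<bar>"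
      by (simp add: good_step_def D_def D'_def c_def)
    moreover have IH: "\<bar>D - (s' - s)\<bar> \<le> 2 * S i * \<bar>s' - s\<bar>" using Suc by (simp add: D_def)
    moreover have "c * \<bar>D\<bar> \<le> c * (2 * \<bar>s' - s\<bar>)"
    proof (rule mult_left_mono[OF _ c])
      have "2 * S i * \<bar>s' - s\<bar> \<le> 1 * \<bar>s' - s\<bar>" using S[of i] by (intro mult_right_mono) auto
      then show "\<bar>D\<bar> \<le> 2 * \<bar>s' - s\<bar>" using IH abs_triangle_ineq[of "D - (s' - s)" "s' - s"] by simp
    qed
    ultimately have "\<bar>D' - (s' - s)\<bar> \<le> 2 * S i * \<bar>s' - s\<bar> + c * (2 * \<bar>s' - s\<bar>)"
    proof -
      have "\<bar>a - e\<bar> \<le> y + z" if "\<bar>a - d\<bar> \<le> x" "\<bar>d - e\<bar> \<le> y" "x \<le> z" for a d e x y z :: real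
        using that by linarith
      then show ?thesis using \<open>\<bar>D' - D\<bar> \<le> c * \<bar>D\<bar>\<close> IH \<open>c * \<bar>D\<bar> \<le> c * (2 * \<bar>s' - s\<bar>)\<close> by blast
    qed
    also have "\<dots> = 2 * S (Suc i) * \<bar>s' - s\<bar>" by (simp add: S_def c_def algebra_simps)
    finally show ?case by (simp add: D'_def)
  qed (simp add: S_def)
  also have "\<dots> \<le> (1/2) * \<bar>s' - s\<bar>" using S[of i] by (intro mult_right_mono) auto
  finally show ?thesis by simp
qed

lemma T_same_fibre:
  assumes "small k"
  shows "\<bar>T k y s' - T k y s - (s' - s)\<bar> \<le> \<bar>s' - s\<bar> / 2"
proof -
  have bnd: "\<bar>U k y s i - V k y s i\<bar> \<le> B * (1/2) ^ (k + i)" for s i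
  proof -
    have "B * (y - base (k + i) y) \<le> B * (1/2) ^ (k + i)"
      using base_gt[of y "k + i"] B_nonneg by (intro mult_left_mono) auto
    then show ?thesis
      using \<Gamma>_bounded[OF base_le, of "k + i" y "U k y s i"] unfolding V_def
      by (simp add: abs_minus_commute)
  qed
  have "(\<lambda>i. B * ((1/2) ^ k * (1/2) ^ i)) \<longlonglongrightarrow> B * ((1/2) ^ k * 0)"
    by (intro tendsto_intros LIMSEQ_power_zero) simp
  then have *: "(\<lambda>i. B * (1/2) ^ (k + i)) \<longlonglongrightarrow> 0" by (simp add: power_add)
  have "(\<lambda>i. U k y s i - V k y s i) \<longlonglongrightarrow> 0" for s
    by (rule Lim_null_comparison[OF always_eventually *]) (use bnd in simp)
  then have Ulim: "(\<lambda>i. U k y s i) \<longlonglongrightarrow> T k y s" for s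
    using tendsto_add[OF _ V_tendsto, of "\<lambda>i. U k y s i - V k y s i" 0 k y s] by simp
  have "(\<lambda>i. \<bar>U k y s' i - U k y s i - (s' - s)\<bar>) \<longlonglongrightarrow> \<bar>T k y s' - T k y s - (s' - s)\<bar>"
    by (intro tendsto_intros Ulim)
  then show ?thesis using U_diff[OF assms] by (intro LIMSEQ_le_const2) auto
qed

lemma surj_T:
  assumes "small k"
  shows "surj (T k y)"
proof -
  have lipT: "\<bar>T k y s' - T k y s\<bar> \<le> 2 * \<bar>s' - s\<bar>" for s s'
  proof -
    have "\<bar>a\<bar> \<le> 2 * \<bar>d\<bar>" if "\<bar>a - d\<bar> \<le> \<bar>d\<bar> / 2" for a d :: real
      using that by (simp add: abs_if split: if_splits)
    then show ?thesis using T_same_fibre[OF assms] .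
  qed
  have cont: "continuous_on UNIV (T k y)"
  proof -
    have "2-lipschitz_on UNIV (T k y)" by (rule lipschitz_onI) (use lipT in \<open>auto simp: dist_real_def\<close>)
    then show ?thesis by (rule lipschitz_on_continuous_on)
  qed
  define M where "M = B + 2 * C3"
  have M: "\<bar>T k y s - s\<bar> \<le> M" for s
  proof -
    have "\<bar>V k y s 0 - s\<bar> \<le> B * (y - base k y)" using \<Gamma>_bounded[OF base_le, of k y s] by (simp add: V_def)
    also have "\<dots> \<le> B * 1" 
    proof -
      have "(1/2::real) ^ k \<le> 1" by (simp add: power_le_one)
      then show ?thesis using base_gt[of y k] B_nonneg by (intro mult_left_mono) auto
    qed
    finally have a: "\<bar>V k y s 0 - s\<bar> \<le> B" by simp
    have "2 * C3 * \<kappa> k * ((1/2) ^ k)\<^sup>2 \<le> 2 * C3 * 1 * 1\<^sup>2"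
      using C_nonneg \<kappa>_le_1 \<kappa>_pos[of k] by (intro mult_mono power_mono) (auto simp: power_le_one)
    then have "\<bar>T k y s - V k y s 0\<bar> \<le> 2 * C3" using T_close[of k y s 0] by simp
    then show ?thesis using a unfolding M_def by linarith
  qed
  show ?thesis
    unfolding surj_def
  proof
    fix t
    have "T k y (t - M) \<le> t" "t \<le> T k y (t + M)" using M[of "t - M"] M[of "t + M"] by (auto simp: abs_le_iff)
    moreover have "t - M \<le> t + M" using M[of 0] abs_ge_zero[of "T k y 0 - 0"] by linarith
    ultimately obtain x where "T k y x = t"
      using IVT'[of "T k y" "t - M" t "t + M"] cont continuous_on_subset by blast
    then show "\<exists>x. t = T k y x" by metis
  qed
qed

definition gaps :: "nat \<Rightarrow> real set" where
  "gaps k = {y. \<forall>n\<ge>k. \<forall>m::int. sqrt (\<kappa> n) \<le> \<bar>2 ^ n * y - m\<bar>}"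

lemma gaps_separated:
  assumes "y \<in> gaps k" "y' \<in> gaps k" "base k y = base k y'" "y < y'"
  obtains i where "\<And>j. j \<le> i \<Longrightarrow> base (k + j) y = base (k + j) y'"
    and "\<kappa> (k + i) * ((1/2) ^ (k + i))\<^sup>2 \<le> 8 * (y' - y)\<^sup>2"
proof -
  have "\<exists>n. \<lfloor>2 ^ n * y\<rfloor> \<noteq> \<lfloor>2 ^ n * y'\<rfloor>"
  proof -
    obtain n where "1 / (y' - y) < 2 ^ n" using real_arch_pow[of 2 "1 / (y' - y)"] by auto
    then have "2 ^ n * y + 1 < 2 ^ n * y'" using assms(4) by (simp add: field_simps)
    then have "\<lfloor>2 ^ n * y\<rfloor> \<noteq> \<lfloor>2 ^ n * y'\<rfloor>" by linarith
    then show ?thesis by blast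
  qed
  then obtain n0 where n0: "base n0 y \<noteq> base n0 y'" by (auto simp: base_eq_iff)
  have down: "base n y = base n y'" if "base (Suc n) y = base (Suc n) y'" for n
    using that floor_double[of "2 ^ n * y"] floor_double[of "2 ^ n * y'"] 
    by (simp add: base_eq_iff mult.assoc)
  have "base n y = base n y'" if "base (n + m) y = base (n + m) y'" for n m
    using that by (induction m) (use down in auto)
  then have "base (k + n0) y \<noteq> base (k + n0) y'" using n0 by (metis add.commute)
  define j where "j = (LEAST j. base (k + j) y \<noteq> base (k + j) y')"
  have j: "base (k + j) y \<noteq> base (k + j) y'" "\<And>i. i < j \<Longrightarrow> base (k + i) y = base (k + i) y'"
    unfolding j_def using LeastI[of "\<lambda>j. base (k + j) y \<noteq> base (k + j) y'" n0] \<open>base (k + n0) y \<noteq> base (k + n0) y'\<close>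
      not_less_Least by auto
  then have "j \<noteq> 0" using assms(3) by (metis add.right_neutral)
  then obtain i where i: "j = Suc i" by (cases j) auto
  define n where "n = k + j"
  define m where "m = \<lfloor>2 ^ n * y'\<rfloor>"
  have "2 ^ n * y \<le> 2 ^ n * y'" using assms(4) by simp
  then have "\<lfloor>2 ^ n * y\<rfloor> < m" 
    using j(1) floor_mono[of "2 ^ n * y" "2 ^ n * y'"] by (simp add: base_eq_iff n_def m_def)
  then have my: "2 ^ n * y < m" by (simp add: floor_less_iff)
  have "sqrt (\<kappa> n) \<le> \<bar>2 ^ n * y' - m\<bar>" using assms(2) by (simp add: gaps_def n_def)
  moreover have "\<bar>2 ^ n * y' - m\<bar> \<le> 2 ^ n * (y' - y)"
    using my of_int_floor_le[of "2 ^ n * y'"] by (simp add: m_def right_diff_distrib)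
  ultimately have "sqrt (\<kappa> n) \<le> 2 ^ n * (y' - y)" by linarith
  then have "(sqrt (\<kappa> n))\<^sup>2 \<le> (2 ^ n * (y' - y))\<^sup>2" by (intro power_mono) (auto simp: \<kappa>_pos less_imp_le)
  then have "\<kappa> n \<le> (2 ^ n)\<^sup>2 * (y' - y)\<^sup>2" by (simp add: \<kappa>_pos less_imp_le power_mult_distrib)
  then have "\<kappa> n * ((1/2) ^ n)\<^sup>2 \<le> (2 ^ n)\<^sup>2 * (y' - y)\<^sup>2 * ((1/2) ^ n)\<^sup>2" by (intro mult_right_mono) auto
  also have "\<dots> = (y' - y)\<^sup>2" by (simp add: power_one_over)
  finally have "\<kappa> n * ((1/2) ^ n)\<^sup>2 \<le> (y' - y)\<^sup>2" .
  moreover have "\<kappa> (k + i) / 2 * (((1/2) ^ (k + i))\<^sup>2 / 4) \<le> \<kappa> n * ((1/2) ^ n)\<^sup>2"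
    using \<kappa>_Suc(1)[of "k + i"] \<kappa>_pos[of "k + i"] by (intro mult_mono) (auto simp: n_def i power2_eq_square)
  ultimately have "\<kappa> (k + i) * ((1/2) ^ (k + i))\<^sup>2 \<le> 8 * (y' - y)\<^sup>2" by simp
  then show ?thesis using that j(2) i by (metis less_Suc_eq_le)
qed

definition "C4 = 4 * C3 + C2 + C1 + H * (1 + 2 * C3)"
definition "C5 = 8 * C4 + L"

lemma T_bilipschitz:
  fixes s s' :: real
  assumes k: "small k" and y: "y \<in> gaps k" "y' \<in> gaps k" "base k y = base k y'" "y \<le> y'"
  defines "tau \<equiv> \<tau> (y, T k y s) (y', T k y' s')"
  shows "\<bar>tau\<bar> \<le> C5 * (y' - y)\<^sup>2 + 2 * \<bar>s' - s\<bar>" and "\<bar>s' - s\<bar> \<le> 3 * (\<bar>tau\<bar> + C5 * (y' - y)\<^sup>2)"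
proof -
  have C45: "0 \<le> C4" "0 \<le> C5" using C_nonneg H_nonneg L_nonneg by (auto simp: C4_def C5_def)
  have final: "\<bar>tau\<bar> \<le> C5 * d + 2 * \<bar>D\<bar> \<and> \<bar>D\<bar> \<le> 3 * (\<bar>tau\<bar> + C5 * d)"
    if "\<bar>\<delta> - D\<bar> \<le> \<bar>D\<bar> / 2" "\<bar>tau - \<delta>\<bar> \<le> C5 * d + \<bar>\<delta>\<bar> / 4" "0 \<le> C5 * d" for d \<delta> D :: real
    using that by (simp add: abs_if split: if_splits)
  have "\<bar>tau\<bar> \<le> C5 * (y' - y)\<^sup>2 + 2 * \<bar>s' - s\<bar> \<and> \<bar>s' - s\<bar> \<le> 3 * (\<bar>tau\<bar> + C5 * (y' - y)\<^sup>2)"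
  proof (cases "y = y'")
    case True
    have "tau = T k y s' - T k y s" by (simp add: tau_def \<tau>_def True)
    then show ?thesis using T_same_fibre[OF k, of y s' s] True
      by (intro final[of tau]) auto
  next
    case False
    then obtain i where i: "\<And>j. j \<le> i \<Longrightarrow> base (k + j) y = base (k + j) y'"
        "\<kappa> (k + i) * ((1/2) ^ (k + i))\<^sup>2 \<le> 8 * (y' - y)\<^sup>2"
      using gaps_separated[OF y(1-3)] y(4) by (metis order_less_le)
    define n where "n = k + i"
    define l where "l = (1/2::real) ^ n"
    have l: "0 < l" "l \<le> 1" "l powr \<alpha> = \<kappa> n" by (auto simp: l_def power_le_one \<kappa>_def)
    define b where "b = base n y"
    have b': "b = base n y'" using i(1)[of i] by (simp add: b_def n_def)
    have by': "b \<le> y" "b \<le> y'" "y \<le> b + l" "y' \<le> b + l"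
      using base_le[of n y] base_gt[of y n] base_le[of n y'] base_gt[of y' n] b' by (auto simp: b_def l_def)
    define e where "e = \<kappa> n * l\<^sup>2"
    have e: "0 \<le> e" "e \<le> 8 * (y' - y)\<^sup>2" using i(2) \<kappa>_pos[of n] by (auto simp: e_def n_def l_def)
    define u u' where "u = U k y s i" and "u' = U k y' s' i"
    define \<delta> where "\<delta> = u' - u"
    have "u' = U k y s' i" unfolding u'_def by (rule U_cong[symmetric]) (use i in auto)
    then have d: "\<bar>\<delta> - (s' - s)\<bar> \<le> \<bar>s' - s\<bar> / 2"
      using U_diff[OF k] by (simp add: \<delta>_def u_def)
    define v v' t t' where "v = \<Gamma> b u y" and "v' = \<Gamma> b u' y'" and "t = T k y s" and "t' = T k y' s'"
    have tv: "\<bar>t - v\<bar> \<le> 2 * C3 * e" "\<bar>t' - v'\<bar> \<le> 2 * C3 * e"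
      using T_close[of k y s i] T_close[of k y' s' i] b' 
      by (simp_all add: t_def t'_def v_def v'_def V_def e_def l_def n_def b_def u_def u'_def mult.assoc)
    have "C2 * \<kappa> n \<le> (\<Sum>j<Suc i. C2 * \<kappa> (k + j))"
      unfolding n_def by (rule member_le_sum) (use C_nonneg less_imp_le[OF \<kappa>_pos] in auto)
    also have "\<dots> \<le> 1/4" using k unfolding small_def by blast
    finally have c14: "C2 * \<kappa> n * \<bar>\<delta>\<bar> \<le> 1/4 * \<bar>\<delta>\<bar>" by (intro mult_right_mono) auto
    have "\<bar>v' - \<Gamma> b u y' - \<delta>\<bar> \<le> C2 * \<kappa> n * (l\<^sup>2 + \<bar>\<delta>\<bar>)"
      using \<Gamma>_diff[OF l(1,2) by'(2,4), of u' u] l(3) by (simp add: v'_def \<delta>_def)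
    then have e1: "\<bar>v' - \<Gamma> b u y' - \<delta>\<bar> \<le> C2 * e + \<bar>\<delta>\<bar> / 4"
      using c14 by (simp add: e_def algebra_simps)
    have e2: "\<bar>\<Gamma> y v y' - \<Gamma> b u y'\<bar> \<le> C1 * e"
      using \<Gamma>_consistent[OF l(1,2) by'(1) y(4) by'(4), of u] l(3) by (simp add: v_def e_def mult.assoc)
    have e3: "\<bar>\<Gamma> y v y' - v - f y v * (y' - y)\<bar> \<le> L * (y' - y)\<^sup>2"
      by (rule \<Gamma>_linear[OF y(4)])
    have "\<bar>f y v - f y t\<bar> \<le> H * \<kappa> n * (l + \<bar>v - t\<bar> / l)"
      using hoelder_linear[OF l(1), of y v t] l(3) by simp
    also have "\<dots> \<le> H * \<kappa> n * (l + (2 * C3 * e) / l)"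
      using tv(1) H_nonneg \<kappa>_pos[of n] l
      by (intro mult_left_mono add_left_mono divide_right_mono) (auto simp: abs_minus_commute)
    also have "\<dots> \<le> H * \<kappa> n * (l + (2 * C3 * (1 * l\<^sup>2)) / l)"
      using H_nonneg \<kappa>_pos[of n] \<kappa>_le_1[of n] C_nonneg l unfolding e_def
      by (intro mult_left_mono add_left_mono divide_right_mono mult_right_mono) auto
    also have "\<dots> = H * (1 + 2 * C3) * \<kappa> n * l" using l by (simp add: power2_eq_square algebra_simps)
    finally have "\<bar>f y v - f y t\<bar> * \<bar>y' - y\<bar> \<le> (H * (1 + 2 * C3) * \<kappa> n * l) * l"
      using by' y(4) H_nonneg \<kappa>_pos[of n] C_nonneg l by (intro mult_mono) auto
    then have e4: "\<bar>f y v * (y' - y) - f y t * (y' - y)\<bar> \<le> H * (1 + 2 * C3) * e"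
      by (simp add: abs_mult left_diff_distrib[symmetric] e_def power2_eq_square mult.assoc)
    have tau: "tau = t' - t - f y t * (y' - y)" by (simp add: tau_def \<tau>_def t_def t'_def)
    have "\<bar>tau - \<delta>\<bar> \<le> 2 * C3 * e + 2 * C3 * e + (C2 * e + \<bar>\<delta>\<bar> / 4) + C1 * e + L * (y' - y)\<^sup>2 + H * (1 + 2 * C3) * e"
    proof -
      have "\<bar>(t' - t - q) - \<delta>\<bar> \<le> a1 + a2 + a3 + a4 + a5 + a6"
        if "\<bar>t - v\<bar> \<le> a1" "\<bar>t' - v'\<bar> \<le> a2" "\<bar>v' - x - \<delta>\<bar> \<le> a3" "\<bar>z - x\<bar> \<le> a4" "\<bar>z - v - p\<bar> \<le> a5" "\<bar>p - q\<bar> \<le> a6"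
        for q x z p a1 a2 a3 a4 a5 a6 :: real using that by (simp add: abs_le_iff)
      from this[OF tv e1 e2 e3 e4] show ?thesis by (simp add: tau)
    qed
    also have "\<dots> = C4 * e + L * (y' - y)\<^sup>2 + \<bar>\<delta>\<bar> / 4" by (simp add: C4_def algebra_simps)
    also have "\<dots> \<le> C4 * (8 * (y' - y)\<^sup>2) + L * (y' - y)\<^sup>2 + \<bar>\<delta>\<bar> / 4"
      using mult_left_mono[OF e(2) C45(1)] by simp
    also have "\<dots> = C5 * (y' - y)\<^sup>2 + \<bar>\<delta>\<bar> / 4" by (simp add: C5_def algebra_simps)
    finally show ?thesis using d C45 by (intro final[of \<delta>]) auto
  qed
  then show "\<bar>tau\<bar> \<le> C5 * (y' - y)\<^sup>2 + 2 * \<bar>s' - s\<bar>" "\<bar>s' - s\<bar> \<le> 3 * (\<bar>tau\<bar> + C5 * (y' - y)\<^sup>2)" by auto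
qed

end

section \<open>The size of the Cantor sets\<close>

definition interval_cover :: "(nat \<Rightarrow> real) \<Rightarrow> (nat \<Rightarrow> real) \<Rightarrow> real set \<Rightarrow> real \<Rightarrow> bool" where
  "interval_cover a b X M \<longleftrightarrow> (\<forall>q. a q \<le> b q) \<and> X \<subseteq> (\<Union>q. {a q..b q}) \<and> (\<Sum>q. ennreal (b q - a q)) \<le> ennreal M"

context hoelder_graph
begin

definition \<sigma> :: "nat \<Rightarrow> real" where
  "\<sigma> k = (\<Sum>n. sqrt (\<kappa> (n + k)))"

lemma sqrt_\<kappa>: "sqrt (\<kappa> n) = sqrt ((1/2) powr \<alpha>) ^ n"
  by (simp add: \<kappa>_eq_power real_sqrt_power)

lemma summable_sqrt_\<kappa>: "summable (\<lambda>n. sqrt (\<kappa> (n + k)))"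
proof -
  have "(1/2::real) powr \<alpha> < 1 powr \<alpha>" using \<alpha> by (intro powr_less_mono2) auto
  then have "summable (\<lambda>n. sqrt ((1/2) powr \<alpha>) ^ n)" by (intro summable_geometric) simp
  then show ?thesis by (simp add: sqrt_\<kappa>[symmetric] summable_iff_shift[of "\<lambda>n. sqrt (\<kappa> n)"])
qed

lemma \<sigma>_nonneg: "0 \<le> \<sigma> k"
  unfolding \<sigma>_def using less_imp_le[OF \<kappa>_pos] by (intro suminf_nonneg summable_sqrt_\<kappa>) simp

lemma \<sigma>_small: "0 < e \<Longrightarrow> \<exists>k0. \<forall>k\<ge>k0. \<sigma> k < e"
proof -
  assume e: "0 < e"
  have "summable (\<lambda>n. sqrt (\<kappa> n))" using summable_sqrt_\<kappa>[of 0] by simp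
  from suminf_exist_split[OF e this] obtain N where "\<forall>n\<ge>N. norm (\<sigma> n) < e"
    unfolding \<sigma>_def by blast
  then show ?thesis by (intro exI[of _ N]) auto
qed

lemma small_eventually: "\<exists>k0. \<forall>k\<ge>k0. small k \<and> \<sigma> k \<le> 1/8"
proof -
  define e where "e = min (1/8) (1 / (4 * (C2 + 1)))"
  have e: "0 < e" "e \<le> 1/8" "4 * (C2 + 1) * e \<le> 1"
    using C_nonneg by (auto simp: e_def min_def field_simps)
  obtain k0 where k0: "\<And>k. k \<ge> k0 \<Longrightarrow> \<sigma> k < e" using \<sigma>_small[OF e(1)] by blast
  have "small k" if "k \<ge> k0" for k
    unfolding small_def
  proof
    fix i
    have "(\<Sum>j<i. C2 * \<kappa> (k + j)) \<le> (\<Sum>j<i. C2 * sqrt (\<kappa> (j + k)))"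
    proof (intro sum_mono mult_left_mono C_nonneg)
      fix j
      have "\<kappa> (k + j) * \<kappa> (k + j) \<le> \<kappa> (k + j) * 1"
        using \<kappa>_pos[of "k + j"] \<kappa>_le_1 by (intro mult_left_mono) auto
      then show "\<kappa> (k + j) \<le> sqrt (\<kappa> (j + k))"
        by (intro real_le_rsqrt) (simp add: power2_eq_square add.commute)
    qed
    also have "\<dots> \<le> C2 * \<sigma> k"
      unfolding \<sigma>_def sum_distrib_left[symmetric] using C_nonneg less_imp_le[OF \<kappa>_pos]
      by (intro mult_left_mono sum_le_suminf summable_sqrt_\<kappa>) auto
    also have "\<dots> \<le> C2 * e" using k0[OF that] C_nonneg by (intro mult_left_mono) auto
    also have "\<dots> \<le> 1/4" using e by (simp add: algebra_simps)
    finally show "(\<Sum>j<i. C2 * \<kappa> (k + j)) \<le> 1/4" .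
  qed
  then show ?thesis using k0 e by (meson less_le_trans less_imp_le)
qed

definition dyadic :: "nat \<Rightarrow> int \<Rightarrow> real set" where
  "dyadic i j = {j / 2 ^ i..(j + 1) / 2 ^ i}"

lemma mem_dyadic: "y \<in> dyadic i j \<longleftrightarrow> j \<le> 2 ^ i * y \<and> 2 ^ i * y \<le> j + 1"
  by (auto simp: dyadic_def field_simps)

lemma closed_gaps: "closed (gaps k)"
proof -
  have "gaps k = (\<Inter>n\<in>{k..}. \<Inter>m::int. {y. sqrt (\<kappa> n) \<le> \<bar>2 ^ n * y - m\<bar>})"
    by (auto simp: gaps_def)
  also have "closed \<dots>" by (intro closed_INT ballI closed_Collect_le continuous_intros)
  finally show ?thesis .
qed

lemma gaps_mono: "k \<le> k' \<Longrightarrow> gaps k \<subseteq> gaps k'"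
  by (auto simp: gaps_def)

lemma base_gaps_dyadic:
  assumes "y \<in> gaps k" "y \<in> dyadic k j"
  shows "base k y = j / 2 ^ k"
proof -
  have "sqrt (\<kappa> k) \<le> \<bar>2 ^ k * y - (j + 1 :: int)\<bar>" using assms(1) unfolding gaps_def by blast
  then have "2 ^ k * y \<noteq> j + 1" using \<kappa>_pos[of k] by auto
  then have "\<lfloor>2 ^ k * y\<rfloor> = j" using assms(2) by (intro floor_unique) (auto simp: mem_dyadic)
  then show ?thesis by (simp add: base_def)
qed

lemma gaps_cover:
  assumes "i \<le> k"
  shows "\<exists>a b. interval_cover a b (dyadic i j - gaps k) (4 / 2 ^ i * \<sigma> k)"
proof -
  define N where "N n = (2::nat) ^ (n + k - i)" for n
  define \<epsilon> where "\<epsilon> n = sqrt (\<kappa> (n + k))" for n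
  have \<epsilon>: "0 \<le> \<epsilon> n" "\<epsilon> n \<le> 1" for n using less_imp_le[OF \<kappa>_pos] \<kappa>_le_1 by (auto simp: \<epsilon>_def)
  define c where "c n m = (if m \<le> N n then (real_of_int j * N n + real m) / 2 ^ (n + k) else 0)" for n m :: nat
  define h where "h n m = (if m \<le> N n then \<epsilon> n / 2 ^ (n + k) else 0)" for n m :: nat
  have h: "0 \<le> h n m" for n m using \<epsilon> by (simp add: h_def)
  define a where "a q = (case prod_decode q of (n, m) \<Rightarrow> c n m - h n m)" for q
  define b where "b q = (case prod_decode q of (n, m) \<Rightarrow> c n m + h n m)" for q
  have N: "2 ^ (n + k) = 2 ^ i * real (N n)" for n
    using assms by (simp add: N_def power_add[symmetric])
  have "interval_cover a b (dyadic i j - gaps k) (4 / 2 ^ i * \<sigma> k)"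
    unfolding interval_cover_def
  proof (intro conjI allI)
    show "a q \<le> b q" for q using h by (simp add: a_def b_def split: prod.split)
    show "dyadic i j - gaps k \<subseteq> (\<Union>q. {a q..b q})"
    proof
      fix y assume y: "y \<in> dyadic i j - gaps k"
      then obtain n' m' where n': "k \<le> n'" and m': "\<bar>2 ^ n' * y - real_of_int m'\<bar> < sqrt (\<kappa> n')"
        by (auto simp: gaps_def not_le)
      define n where "n = n' - k"
      have nn: "n' = n + k" using n' by (simp add: n_def)
      have my: "\<bar>2 ^ (n + k) * y - real_of_int m'\<bar> < \<epsilon> n" using m' by (simp add: nn \<epsilon>_def)
      have "j * real (N n) \<le> 2 ^ i * y * real (N n)" "2 ^ i * y * real (N n) \<le> (j + 1) * real (N n)"
        using y by (auto simp: mem_dyadic intro!: mult_right_mono)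
      then have "real_of_int (j * int (N n)) < real_of_int (m' + 1)" "real_of_int m' < real_of_int ((j + 1) * int (N n) + 1)"
        using my \<epsilon>(2)[of n] unfolding N by (auto simp: mult_ac abs_less_iff)
      then have m'': "j * int (N n) \<le> m'" "m' \<le> j * int (N n) + int (N n)"
        unfolding of_int_less_iff by (auto simp: algebra_simps)
      define m where "m = nat (m' - j * int (N n))"
      have m: "m \<le> N n" "real_of_int m' = real_of_int j * real (N n) + real m"
        using m'' by (auto simp: m_def of_nat_nat)
      have "c n m - h n m \<le> y \<and> y \<le> c n m + h n m"
        using my m by (simp add: c_def h_def diff_divide_distrib[symmetric] add_divide_distrib[symmetric]
            pos_divide_le_eq pos_le_divide_eq abs_less_iff mult.commute)
      then have "y \<in> {a (prod_encode (n, m))..b (prod_encode (n, m))}"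
        by (simp add: a_def b_def)
      then show "y \<in> (\<Union>q. {a q..b q})" by blast
    qed
    define g where "g p = ennreal (2 * h (fst p) (snd p))" for p
    have "(\<Sum>q. ennreal (b q - a q)) = (\<Sum>q. g (prod_decode q))"
      by (rule suminf_cong) (auto simp: a_def b_def g_def split: prod.split)
    also have "\<dots> = (\<Sum>n. \<Sum>m. g (n, m))" by (rule suminf_ennreal_2dimen) simp
    also have "\<dots> \<le> (\<Sum>n. ennreal (4 / 2 ^ i * \<epsilon> n))"
    proof (rule suminf_le)
      fix n
      have "(\<Sum>m. g (n, m)) = (\<Sum>m\<le>N n. g (n, m))"
        by (rule suminf_finite) (auto simp: g_def h_def)
      also have "\<dots> = (\<Sum>m\<le>N n. ennreal (2 * \<epsilon> n / 2 ^ (n + k)))"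
        by (rule sum.cong) (auto simp: g_def h_def)
      also have "\<dots> = ennreal ((1 + real (N n)) * (2 * \<epsilon> n / 2 ^ (n + k)))"
        using \<epsilon> by (simp add: ennreal_of_nat_eq_real_of_nat ennreal_mult[symmetric] add.commute flip: ennreal_1 ennreal_plus)
      also have "\<dots> \<le> ennreal (4 / 2 ^ i * \<epsilon> n)"
      proof (rule ennreal_leI)
        have N1: "1 \<le> real (N n)" by (simp add: N_def)
        have "(1 + real (N n)) * (2 * \<epsilon> n / 2 ^ (n + k)) \<le> (2 * real (N n)) * (2 * \<epsilon> n / 2 ^ (n + k))"
          using N1 \<epsilon> by (intro mult_right_mono) auto
        also have "\<dots> = 4 / 2 ^ i * \<epsilon> n" unfolding N using N1 by (simp add: field_simps)
        finally show "(1 + real (N n)) * (2 * \<epsilon> n / 2 ^ (n + k)) \<le> 4 / 2 ^ i * \<epsilon> n" .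
      qed
      finally show "(\<Sum>m. g (n, m)) \<le> ennreal (4 / 2 ^ i * \<epsilon> n)" .
    qed auto
    also have "\<dots> = ennreal (\<Sum>n. 4 / 2 ^ i * \<epsilon> n)"
      unfolding \<epsilon>_def using less_imp_le[OF \<kappa>_pos] by (intro suminf_ennreal2 summable_mult summable_sqrt_\<kappa>) auto
    also have "(\<Sum>n. 4 / 2 ^ i * \<epsilon> n) = 4 / 2 ^ i * \<sigma> k"
      unfolding \<epsilon>_def \<sigma>_def by (rule suminf_mult[OF summable_sqrt_\<kappa>])
    finally show "(\<Sum>q. ennreal (b q - a q)) \<le> ennreal (4 / 2 ^ i * \<sigma> k)" .
  qed
  then show ?thesis by blast
qed

lemma emeasure_gaps_ge:
  assumes "\<sigma> k \<le> 1/8"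
  shows "ennreal (1 / (2 * 2 ^ k)) \<le> emeasure lborel (dyadic k j \<inter> gaps k)"
proof -
  obtain a b where "interval_cover a b (dyadic k j - gaps k) (4 / 2 ^ k * \<sigma> k)"
    using gaps_cover[of k k j] by blast
  then have ab: "\<And>q. a q \<le> b q" "dyadic k j - gaps k \<subseteq> (\<Union>q. {a q..b q})"
    "(\<Sum>q. ennreal (b q - a q)) \<le> ennreal (4 / 2 ^ k * \<sigma> k)"
    unfolding interval_cover_def by simp_all
  have bor: "dyadic k j \<in> sets borel" "gaps k \<in> sets borel"
    using closed_gaps by (auto simp: dyadic_def)
  have "emeasure lborel (dyadic k j - gaps k) \<le> emeasure lborel (\<Union>q. {a q..b q})"
    by (rule emeasure_mono) (use ab in auto)
  also have "\<dots> \<le> (\<Sum>q. emeasure lborel {a q..b q})"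
    by (rule emeasure_subadditive_countably) auto
  also have "\<dots> = (\<Sum>q. ennreal (b q - a q))" using ab(1) by simp
  also note ab(3)
  also have "ennreal (4 / 2 ^ k * \<sigma> k) \<le> ennreal (1 / (2 * 2 ^ k))"
    using assms by (intro ennreal_leI) (simp add: field_simps)
  finally have small: "emeasure lborel (dyadic k j - gaps k) \<le> ennreal (1 / (2 * 2 ^ k))" .
  have "(j + 1) / 2 ^ k - j / 2 ^ k = 1 / (2 * 2 ^ k) + 1 / (2 * 2 ^ k :: real)" by (simp add: field_simps)
  then have "ennreal (1 / (2 * 2 ^ k)) + ennreal (1 / (2 * 2 ^ k)) = emeasure lborel (dyadic k j)"
    by (simp add: dyadic_def divide_right_mono flip: ennreal_plus)
  also have "dyadic k j = (dyadic k j \<inter> gaps k) \<union> (dyadic k j - gaps k)" by blast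
  also have "emeasure lborel \<dots> = emeasure lborel (dyadic k j \<inter> gaps k) + emeasure lborel (dyadic k j - gaps k)"
    using bor by (intro plus_emeasure[symmetric]) auto
  also have "\<dots> \<le> emeasure lborel (dyadic k j \<inter> gaps k) + ennreal (1 / (2 * 2 ^ k))"
    using small by (rule add_left_mono)
  finally show ?thesis by (subst (asm) (1 2) add.commute) (simp add: ennreal_add_left_cancel_le)
qed

lemma hausdorff_measure_no_gaps:
  "hausdorff_measure 3 (\<Phi> ` {w. \<forall>k. fst w \<notin> gaps k}) = 0"
proof -
  define Q where "Q j m = {w. fst w \<in> dyadic 0 j \<and> (\<forall>k. fst w \<notin> gaps k) \<and> \<bar>snd w\<bar> \<le> real m}" for j m
  have null: "hausdorff_measure 3 (\<Phi> ` Q j m) = 0" for j m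
  proof -
    define c where "c = 1024 * L ^ 3 * (2 * real m) * 4"
    have c: "0 \<le> c" using L_nonneg by (simp add: c_def)
    have le: "hausdorff_measure 3 (\<Phi> ` Q j m) \<le> ennreal (c * \<sigma> k)" for k
    proof -
      obtain a b where "interval_cover a b (dyadic 0 j - gaps k) (4 / 2 ^ 0 * \<sigma> k)"
        using gaps_cover[of 0 k j] by blast
      then have ab: "\<And>q. a q \<le> b q" "dyadic 0 j - gaps k \<subseteq> (\<Union>q. {a q..b q})"
        "(\<Sum>q. ennreal (b q - a q)) \<le> ennreal (4 / 2 ^ 0 * \<sigma> k)"
        unfolding interval_cover_def by simp_all
      define R where "R q = strip {a q..b q} (\<lambda>y. 0) (real m)" for q
      have "Q j m \<subseteq> (\<Union>q. R q)"
      proof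
        fix w assume w: "w \<in> Q j m"
        then have "fst w \<in> dyadic 0 j - gaps k" by (auto simp: Q_def)
        then obtain q where "fst w \<in> {a q..b q}" using ab(2) by blast
        then have "w \<in> R q" using w by (simp add: R_def strip_def Q_def)
        then show "w \<in> (\<Union>q. R q)" by blast
      qed
      then have "hausdorff_measure 3 (\<Phi> ` Q j m) \<le> hausdorff_measure 3 (\<Union>q. \<Phi> ` R q)"
        by (intro hausdorff_measure_mono) blast
      also have "\<dots> \<le> (\<Sum>q. hausdorff_measure 3 (\<Phi> ` R q))"
        by (rule hausdorff_measure_countably_subadditive)
      also have "\<dots> \<le> (\<Sum>q. ennreal (1024 * L ^ 3 * (2 * real m)) * ennreal (b q - a q))"
      proof (rule suminf_le)
        fix q
        have "compact (R q)" unfolding R_def by (intro compact_strip) auto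
        moreover have "emeasure lborel (R q) = ennreal (2 * real m) * ennreal (b q - a q)"
          unfolding R_def using ab(1)[of q] by (subst emeasure_strip(2)) auto
        ultimately show "hausdorff_measure 3 (\<Phi> ` R q) \<le> ennreal (1024 * L ^ 3 * (2 * real m)) * ennreal (b q - a q)"
          using hausdorff_measure_compact_le[of "R q"] L_nonneg ab(1)[of q]
          by (simp only: ennreal_mult[symmetric] mult.assoc mult_nonneg_nonneg zero_le_power zero_le_numeral
              of_nat_0_le_iff diff_ge_0_iff_ge)
      qed auto
      also have "\<dots> = ennreal (1024 * L ^ 3 * (2 * real m)) * (\<Sum>q. ennreal (b q - a q))"
        by (rule ennreal_suminf_cmult)
      also have "\<dots> \<le> ennreal (1024 * L ^ 3 * (2 * real m)) * ennreal (4 / 2 ^ 0 * \<sigma> k)"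
        by (rule mult_left_mono[OF ab(3)]) simp
      also have "\<dots> = ennreal (c * \<sigma> k)"
        using L_nonneg \<sigma>_nonneg[of k] by (simp add: c_def ennreal_mult[symmetric] mult.assoc)
      finally show ?thesis .
    qed
    have "hausdorff_measure 3 (\<Phi> ` Q j m) \<le> 0 + ennreal e" if e: "0 < e" for e
    proof -
      obtain k where "\<sigma> k < e / (c + 1)" using \<sigma>_small[of "e / (c + 1)"] e c by auto
      then have "c * \<sigma> k \<le> c * (e / (c + 1))" using c by (intro mult_left_mono) auto
      also have "\<dots> \<le> e" using e c by (simp add: field_simps)
      finally show ?thesis using order_trans[OF le[of k] ennreal_leI] by simp
    qed
    then have "hausdorff_measure 3 (\<Phi> ` Q j m) \<le> 0" by (rule ennreal_le_epsilon)
    then show ?thesis by simp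
  qed
  have "\<Phi> ` {w. \<forall>k. fst w \<notin> gaps k} \<subseteq> (\<Union>i. \<Union>m. \<Phi> ` Q (int_decode i) m)"
  proof
    fix p assume "p \<in> \<Phi> ` {w. \<forall>k. fst w \<notin> gaps k}"
    then obtain w where w: "p = \<Phi> w" "\<forall>k. fst w \<notin> gaps k" by blast
    obtain m where "\<bar>snd w\<bar> \<le> real m" using real_arch_simple by blast
    then have "w \<in> Q \<lfloor>fst w\<rfloor> m" using w(2) by (auto simp: Q_def mem_dyadic)
    then have "w \<in> Q (int_decode (int_encode \<lfloor>fst w\<rfloor>)) m" by simp
    then show "p \<in> (\<Union>i. \<Union>m. \<Phi> ` Q (int_decode i) m)" using w(1) by blast
  qed
  then have "hausdorff_measure 3 (\<Phi> ` {w. \<forall>k. fst w \<notin> gaps k}) 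
      \<le> hausdorff_measure 3 (\<Union>i. \<Union>m. \<Phi> ` Q (int_decode i) m)"
    by (rule hausdorff_measure_mono)
  also have "\<dots> = 0" by (intro hausdorff_measure_UN_null null)
  finally show ?thesis by simp
qed

end

section \<open>Bilipschitz pieces\<close>

lemma para_diff_dist: "dist (a - c) (b - c) = dist a (b :: para)"
  by (simp add: dist_para_def)

context lipschitz_graph
begin

definition chart :: "real \<Rightarrow> real set \<Rightarrow> (real \<Rightarrow> real \<Rightarrow> real) \<Rightarrow> bool" where
  "chart C Y T \<longleftrightarrow> (\<forall>y\<in>Y. surj (T y)) \<and> (\<forall>y\<in>Y. \<forall>y'\<in>Y. \<forall>s s'. y \<le> y' \<longrightarrow>
    \<bar>\<tau> (y, T y s) (y', T y' s')\<bar> \<le> C * ((y' - y)\<^sup>2 + \<bar>s' - s\<bar>) \<and>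
    \<bar>s' - s\<bar> \<le> C * ((y' - y)\<^sup>2 + \<bar>\<tau> (y, T y s) (y', T y' s')\<bar>))"

definition \<Psi> :: "(real \<Rightarrow> real \<Rightarrow> real) \<Rightarrow> para \<Rightarrow> heis" where
  "\<Psi> T a = \<Phi> (py a, T (py a) (pt a))"

definition \<Lambda> :: "real \<Rightarrow> real" where
  "\<Lambda> C = 4 * L * sqrt (1 + C)"

lemma \<Lambda>_ge_1: "0 \<le> C \<Longrightarrow> 1 \<le> \<Lambda> C"
proof -
  assume "0 \<le> C"
  then have "1 * 1 \<le> (4 * L) * sqrt (1 + C)" using L_ge_1 by (intro mult_mono) auto
  then show ?thesis by (simp add: \<Lambda>_def)
qed

lemma chart_bilipschitz:
  assumes "chart C Y T" and "0 \<le> C"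
  shows "bilipschitz_on (\<Lambda> C) {a. py a \<in> Y} (\<Psi> T)"
proof -
  have \<Lambda>2: "(\<Lambda> C)\<^sup>2 = 16 * L\<^sup>2 * (1 + C)" using assms(2) by (simp add: \<Lambda>_def power_mult_distrib)
  have \<Lambda>0: "0 < \<Lambda> C" using \<Lambda>_ge_1[OF assms(2)] by linarith
  have L2: "1 \<le> L\<^sup>2" using L_ge_1 by (simp add: one_le_power)
  have main: "dist (\<Psi> T a) (\<Psi> T b) \<le> \<Lambda> C * dist a b \<and> dist a b \<le> \<Lambda> C * dist (\<Psi> T a) (\<Psi> T b)"
    if "py a \<in> Y" "py b \<in> Y" "py a \<le> py b" for a b
  proof -
    define t where "t = \<bar>\<tau> (py a, T (py a) (pt a)) (py b, T (py b) (pt b))\<bar>"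
    define y where "y = (py b - py a)\<^sup>2"
    define s where "s = \<bar>pt b - pt a\<bar>"
    have nn: "0 \<le> y" "0 \<le> s" "0 \<le> t" by (auto simp: y_def s_def t_def)
    have ts: "t \<le> C * (y + s)" "s \<le> C * (y + t)"
      using assms(1) that by (auto simp: chart_def t_def y_def s_def)
    have dH: "(dist (\<Psi> T a) (\<Psi> T b))\<^sup>2 \<le> 8 * L\<^sup>2 * (y + t)" "y + t \<le> 2 * (dist (\<Psi> T a) (\<Psi> T b))\<^sup>2"
      using dist_\<Phi>_bounds[where w="(py a, T (py a) (pt a))" and w'="(py b, T (py b) (pt b))"]
      by (simp_all add: \<Psi>_def y_def t_def)
    have dP: "y \<le> (dist a b)\<^sup>2" "4 * s \<le> (dist a b)\<^sup>2" "(dist a b)\<^sup>2 \<le> y + 4 * s"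
      using dist_para_power2_bounds[of b a] by (simp_all add: y_def s_def dist_commute)
    have "y + t \<le> (1 + C) * (y + s)" using ts(1) nn by (simp add: distrib_right)
    also have "\<dots> \<le> (1 + C) * (2 * (dist a b)\<^sup>2)" using dP assms(2) by (intro mult_left_mono) auto
    finally have "8 * L\<^sup>2 * (y + t) \<le> 8 * L\<^sup>2 * ((1 + C) * (2 * (dist a b)\<^sup>2))" by (intro mult_left_mono) auto
    then have 1: "(dist (\<Psi> T a) (\<Psi> T b))\<^sup>2 \<le> (\<Lambda> C * dist a b)\<^sup>2"
    proof -
      have "8 * L\<^sup>2 * ((1 + C) * (2 * (dist a b)\<^sup>2)) = (\<Lambda> C * dist a b)\<^sup>2"
        unfolding power_mult_distrib \<Lambda>2 by simp
      then show ?thesis using dH(1) \<open>8 * L\<^sup>2 * (y + t) \<le> _\<close> by linarith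
    qed
    have "y + s \<le> (1 + C) * (y + t)" using ts(2) nn by (simp add: distrib_right)
    then have "(dist a b)\<^sup>2 \<le> 4 * ((1 + C) * (y + t))" using dP(3) nn by simp
    also have "\<dots> \<le> 4 * ((1 + C) * (2 * (dist (\<Psi> T a) (\<Psi> T b))\<^sup>2))" 
      using dH(2) assms(2) by (intro mult_left_mono) auto
    also have "\<dots> = 1 * (8 * (1 + C) * (dist (\<Psi> T a) (\<Psi> T b))\<^sup>2)" by simp
    also have "\<dots> \<le> (2 * L\<^sup>2) * (8 * (1 + C) * (dist (\<Psi> T a) (\<Psi> T b))\<^sup>2)"
      using L2 assms(2) by (intro mult_right_mono) auto
    finally have 2: "(dist a b)\<^sup>2 \<le> (\<Lambda> C * dist (\<Psi> T a) (\<Psi> T b))\<^sup>2"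
      unfolding power_mult_distrib \<Lambda>2 by (simp add: algebra_simps)
    show ?thesis using 1 2 \<Lambda>0 by (auto intro!: power2_le_imp_le[where y="\<Lambda> C * _"])
  qed
  have "dist (\<Psi> T a) (\<Psi> T b) \<le> \<Lambda> C * dist a b \<and> dist a b \<le> \<Lambda> C * dist (\<Psi> T a) (\<Psi> T b)"
    if "py a \<in> Y" "py b \<in> Y" for a b
    using main[of a b] main[of b a] that by (cases "py a \<le> py b") (auto simp: dist_commute)
  then show ?thesis using \<Lambda>0 by (simp add: bilipschitz_on_def pos_divide_le_eq mult.commute)
qed

definition big_piece :: "real \<Rightarrow> heis \<Rightarrow> real \<Rightarrow> real \<Rightarrow> bool" where
  "big_piece M p r \<theta> \<longleftrightarrow> (\<exists>(K :: para set) (g :: para \<Rightarrow> heis).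
    compact K \<and> K \<subseteq> ball 0 r \<and> bilipschitz_on M K g \<and>
    ennreal (\<theta> * r ^ 3) \<le> hausdorff_measure 3 (g ` K \<inter> range \<Phi> \<inter> ball p r))"

lemma big_piece_mono:
  assumes "big_piece M p r \<theta>" "r \<le> r'" "\<theta>' * r' ^ 3 \<le> \<theta> * r ^ 3"
  shows "big_piece M p r' \<theta>'"
proof -
  obtain K :: "para set" and g where K: "compact K" "K \<subseteq> ball 0 r" "bilipschitz_on M K g"
     "ennreal (\<theta> * r ^ 3) \<le> hausdorff_measure 3 (g ` K \<inter> range \<Phi> \<inter> ball p r)"
    using assms(1) by (auto simp: big_piece_def)
  have "ennreal (\<theta>' * r' ^ 3) \<le> ennreal (\<theta> * r ^ 3)" by (rule ennreal_leI[OF assms(3)])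
  also note K(4)
  also have "hausdorff_measure 3 (g ` K \<inter> range \<Phi> \<inter> ball p r) \<le> hausdorff_measure 3 (g ` K \<inter> range \<Phi> \<inter> ball p r')"
    using assms(2) by (intro hausdorff_measure_mono) auto
  finally show ?thesis
    unfolding big_piece_def using K assms(2) by (intro exI[of _ K] exI[of _ g]) auto
qed

lemma chart_compact_piece:
  assumes "chart C Y T" and "0 \<le> C" and "compact A" and "fst ` A \<subseteq> Y" and "A \<noteq> {}"
    and diam: "\<And>v w. v \<in> A \<Longrightarrow> w \<in> A \<Longrightarrow> \<Lambda> C * dist (\<Phi> v) (\<Phi> w) < r"
  obtains K :: "para set" and g where "compact K" "K \<subseteq> ball 0 r" "bilipschitz_on (\<Lambda> C) K g" "g ` K = \<Phi> ` A"
proof -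
  have \<Lambda>0: "0 < \<Lambda> C" using \<Lambda>_ge_1[OF assms(2)] by linarith
  note bl = chart_bilipschitz[OF assms(1,2), unfolded bilipschitz_on_def]
  have le: "dist a b \<le> \<Lambda> C * dist (\<Psi> T a) (\<Psi> T b)" if "py a \<in> Y" "py b \<in> Y" for a b
  proof -
    have "dist a b / \<Lambda> C \<le> dist (\<Psi> T a) (\<Psi> T b)" using bl that by blast
    then show ?thesis using \<Lambda>0 by (simp add: pos_divide_le_eq mult.commute)
  qed
  define G where "G w = Para (fst w) (inv (T (fst w)) (snd w))" for w
  have G: "\<Psi> T (G w) = \<Phi> w" "py (G w) \<in> Y" if "w \<in> A" for w
  proof -
    show "py (G w) \<in> Y" using that assms(4) by (auto simp: G_def)
    then have "surj (T (fst w))" using assms(1) by (simp add: chart_def G_def)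
    then show "\<Psi> T (G w) = \<Phi> w" by (simp add: \<Psi>_def G_def surj_f_inv_f)
  qed
  have Gd: "dist (G v) (G w) \<le> \<Lambda> C * dist (\<Phi> v) (\<Phi> w)" if "v \<in> A" "w \<in> A" for v w
    using le[of "G v" "G w"] G that by simp
  obtain w0 where w0: "w0 \<in> A" using assms(5) by blast
  define F where "F w = G w - G w0" for w
  have Fd: "dist (F v) (F w) = dist (G v) (G w)" for v w by (simp add: F_def para_diff_dist)
  have "continuous_on A F"
    unfolding continuous_on_def
  proof
    fix w assume w: "w \<in> A"
    have "(\<Phi> \<longlongrightarrow> \<Phi> w) (at w within A)"
      using continuous_\<Phi> continuous_on_subset w by (metis continuous_on_def top_greatest)
    then have "((\<lambda>v. \<Lambda> C * dist (\<Phi> v) (\<Phi> w)) \<longlongrightarrow> \<Lambda> C * dist (\<Phi> w) (\<Phi> w)) (at w within A)"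
      by (intro tendsto_intros)
    then have *: "((\<lambda>v. \<Lambda> C * dist (\<Phi> v) (\<Phi> w)) \<longlongrightarrow> 0) (at w within A)" by simp
    have "((\<lambda>v. dist (F v) (F w)) \<longlongrightarrow> 0) (at w within A)"
      by (rule Lim_null_comparison[OF _ *]) (use Gd w Fd in \<open>auto simp: eventually_at_filter\<close>)
    then show "(F \<longlongrightarrow> F w) (at w within A)" by (rule tendsto_dist_iff[THEN iffD2])
  qed
  then have cF: "compact (F ` A)" using assms(3) by (rule compact_continuous_image)
  have ballF: "F ` A \<subseteq> ball 0 r"
  proof
    fix a assume "a \<in> F ` A"
    then obtain w where w: "w \<in> A" "a = F w" by blast
    have "F w0 = 0" by (simp add: F_def)
    then have "dist 0 a = dist (G w0) (G w)" using Fd[of w0 w] w by simp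
    then show "a \<in> ball 0 r" using Gd[OF w0 w(1)] diam[OF w0 w(1)] by simp
  qed
  define g where "g a = \<Psi> T (a + G w0)" for a
  have gF: "g (F w) = \<Phi> w" if "w \<in> A" for w using G(1)[OF that] by (simp add: g_def F_def)
  have biF: "bilipschitz_on (\<Lambda> C) (F ` A) g"
    unfolding bilipschitz_on_def
  proof (intro ballI)
    fix a b assume "a \<in> F ` A" "b \<in> F ` A"
    then obtain v w where vw: "v \<in> A" "w \<in> A" "a = F v" "b = F w" by blast
    then have "dist a b = dist (G v) (G w)" "g a = \<Psi> T (G v)" "g b = \<Psi> T (G w)"
      by (simp_all add: Fd gF G)
    then show "dist a b / \<Lambda> C \<le> dist (g a) (g b) \<and> dist (g a) (g b) \<le> \<Lambda> C * dist a b"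
      using bl G(2)[OF vw(1)] G(2)[OF vw(2)] by simp
  qed
  have "g ` (F ` A) = \<Phi> ` A" unfolding image_image by (rule image_cong[OF refl gF])
  then show ?thesis by (rule that[OF cF ballF biF])
qed

lemma big_piece_chart:
  assumes "chart C Y T" and "0 \<le> C" and "0 < r" and "compact Y"
    and Y: "Y \<subseteq> {fst w - \<rho>..fst w + \<rho>}" and \<rho>: "\<rho> = r / (16 * L * \<Lambda> C)"
    and large: "ennreal (\<rho> / 8) \<le> emeasure lborel Y"
  shows "big_piece (\<Lambda> C) (\<Phi> w) r ((1 / (16 * L * \<Lambda> C)) ^ 3 / 128)"
proof -
  define c where "c = 1 / (16 * L * \<Lambda> C)"
  have \<Lambda>1: "1 \<le> \<Lambda> C" by (rule \<Lambda>_ge_1[OF assms(2)])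
  have \<rho>0: "0 < \<rho>" and \<rho>c: "\<rho> = c * r" and \<rho>r: "16 * L * \<Lambda> C * \<rho> = r" using assms(3) L_ge_1 \<Lambda>1 by (auto simp: \<rho> c_def)
  define g where "g y = snd w + f (fst w) (snd w) * (y - fst w)" for y
  have gc: "continuous_on UNIV g" unfolding g_def by (intro continuous_intros)
  define A where "A = strip Y g (\<rho>\<^sup>2)"
  have cA: "compact A" unfolding A_def by (rule compact_strip[OF assms(4) gc])
  have sub: "A \<subseteq> sbox w \<rho>" using Y by (auto simp: A_def sbox_def strip_def g_def)
  have near: "dist (\<Phi> w) (\<Phi> v) \<le> 4 * L * \<rho>" if "v \<in> A" for v
    using sub that by (intro dist_sbox) blast
  have "Y \<noteq> {}" using large \<rho>0 by auto
  then obtain y where "y \<in> Y" by blast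
  then have "(y, g y) \<in> A" by (simp add: A_def strip_def)
  then have ne: "A \<noteq> {}" by blast
  have fA: "fst ` A \<subseteq> Y" by (auto simp: A_def strip_def)
  have diam: "\<Lambda> C * dist (\<Phi> u) (\<Phi> v) < r" if "u \<in> A" "v \<in> A" for u v
  proof -
    have "dist (\<Phi> u) (\<Phi> v) \<le> 8 * L * \<rho>"
      using near[OF that(1)] near[OF that(2)] dist_triangle3[of "\<Phi> u" "\<Phi> v" "\<Phi> w"] by linarith
    then have "\<Lambda> C * dist (\<Phi> u) (\<Phi> v) \<le> \<Lambda> C * (8 * L * \<rho>)" using \<Lambda>1 by (intro mult_left_mono) auto
    also have "\<dots> = r / 2" using \<rho>r by (simp add: mult_ac)
    finally show ?thesis using assms(3) by linarith
  qed
  obtain K :: "para set" and h where K: "compact K" "K \<subseteq> ball 0 r" "bilipschitz_on (\<Lambda> C) K h" "h ` K = \<Phi> ` A"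
    by (rule chart_compact_piece[OF assms(1,2) cA fA ne diam]; (assumption | rule that; assumption))
  have "4 * L * \<rho> < r"
  proof -
    have "4 * L * \<rho> < 16 * L * \<rho> * 1" using L_ge_1 \<rho>0 by simp
    also have "\<dots> \<le> 16 * L * \<rho> * \<Lambda> C" using L_ge_1 \<rho>0 \<Lambda>1 by (intro mult_left_mono) auto
    finally show ?thesis using \<rho>r by (simp add: mult_ac)
  qed
  then have eq: "h ` K \<inter> range \<Phi> \<inter> ball (\<Phi> w) r = \<Phi> ` A" using K(4) near by force
  have Yb: "Y \<in> sets borel" using assms(4) by (rule borel_compact)
  have "ennreal (c ^ 3 / 128 * r ^ 3) * 32 = ennreal (2 * \<rho>\<^sup>2) * ennreal (\<rho> / 8)"
  proof -
    have c0: "0 < c" using \<rho>0 assms(3) by (simp add: \<rho>c zero_less_mult_iff)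
    have "c ^ 3 / 128 * r ^ 3 * 32 = 2 * \<rho>\<^sup>2 * (\<rho> / 8)"
      by (simp add: \<rho>c power_mult_distrib power2_eq_square power3_eq_cube)
    moreover have "ennreal (c ^ 3 / 128 * r ^ 3) * 32 = ennreal (c ^ 3 / 128 * r ^ 3 * 32)"
      using c0 assms(3) by (subst ennreal_mult) auto
    moreover have "ennreal (2 * \<rho>\<^sup>2) * ennreal (\<rho> / 8) = ennreal (2 * \<rho>\<^sup>2 * (\<rho> / 8))"
      using \<rho>0 by (subst ennreal_mult) auto
    ultimately show ?thesis by simp
  qed
  also have "\<dots> \<le> ennreal (2 * \<rho>\<^sup>2) * emeasure lborel Y" by (rule mult_left_mono[OF large]) simp
  also have "\<dots> = emeasure lborel A" unfolding A_def by (rule emeasure_strip(2)[OF Yb gc, symmetric]) simp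
  also have "\<dots> \<le> 32 * hausdorff_measure 3 (\<Phi> ` A)"
    using cA by (intro emeasure_le_hausdorff_measure borel_compact)
  finally have "ennreal (c ^ 3 / 128 * r ^ 3) \<le> hausdorff_measure 3 (\<Phi> ` A)"
    by (subst (asm) mult.commute) (auto simp: ennreal_mult_le_mult_iff)
  then show ?thesis unfolding big_piece_def using K eq by (intro exI[of _ K] exI[of _ h]) (simp add: c_def)
qed

lemma flat_chart:
  assumes "\<And>y t. y \<in> Y \<Longrightarrow> f y t = 0" and "1 \<le> C"
  shows "chart C Y (\<lambda>y s. s)"
proof -
  have "\<bar>s' - s\<bar> \<le> C * ((y' - y)\<^sup>2 + \<bar>s' - s\<bar>)" for y y' s s' :: real
  proof -
    have "1 * \<bar>s' - s\<bar> \<le> C * ((y' - y)\<^sup>2 + \<bar>s' - s\<bar>)" using assms(2) by (intro mult_mono) auto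
    then show ?thesis by simp
  qed
  then show ?thesis using assms by (simp add: chart_def \<tau>_def)
qed

end

context hoelder_graph
begin

definition "C6 = 3 * C5 + 3"

lemma C6_ge_1: "1 \<le> C6"
  using C_nonneg H_nonneg L_nonneg by (simp add: C6_def C5_def C4_def)

lemma gaps_chart:
  assumes "small k"
  shows "chart C6 (dyadic k j \<inter> gaps k) (T k)"
proof -
  have C5: "0 \<le> C5" using C_nonneg H_nonneg L_nonneg by (simp add: C5_def C4_def)
  have *: "t \<le> C6 * (y + s) \<and> s \<le> C6 * (y + t)"
    if "t \<le> C5 * y + 2 * s" "s \<le> 3 * (t + C5 * y)" "0 \<le> y" "0 \<le> s" "0 \<le> t" for t y s
    using that mult_nonneg_nonneg[OF C5 that(3)] mult_nonneg_nonneg[OF C5 that(4)] mult_nonneg_nonneg[OF C5 that(5)]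
    by (simp add: C6_def algebra_simps)
  have "\<bar>\<tau> (y, T k y s) (y', T k y' s')\<bar> \<le> C6 * ((y' - y)\<^sup>2 + \<bar>s' - s\<bar>) \<and>
    \<bar>s' - s\<bar> \<le> C6 * ((y' - y)\<^sup>2 + \<bar>\<tau> (y, T k y s) (y', T k y' s')\<bar>)"
    if "y \<in> dyadic k j \<inter> gaps k" "y' \<in> dyadic k j \<inter> gaps k" "y \<le> y'" for y y' s s'
    using that T_bilipschitz[OF assms, where y=y and y'=y' and s=s and s'=s'] by (intro *) (auto simp: base_gaps_dyadic)
  then show ?thesis using surj_T[OF assms] by (simp add: chart_def)
qed

definition "c6 = 1 / (16 * L * \<Lambda> C6)"

lemma c6_pos: "0 < c6"
proof -
  have "1 \<le> \<Lambda> C6" using C6_ge_1 by (intro \<Lambda>_ge_1) simp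
  then show ?thesis using L_ge_1 by (simp add: c6_def)
qed

lemma big_piece_small_scale:
  assumes k0: "\<And>k. k \<ge> k0 \<Longrightarrow> small k \<and> \<sigma> k \<le> 1/8" and r: "0 < r" "c6 * r \<le> (1/2) ^ k0"
  shows "big_piece (\<Lambda> C6) (\<Phi> w) r (c6 ^ 3 / 128)"
proof -
  define \<rho> where "\<rho> = c6 * r"
  have \<rho>: "0 < \<rho>" "\<rho> \<le> (1/2) ^ k0" using r c6_pos by (auto simp: \<rho>_def)
  have "\<exists>k. (1/2) ^ k < \<rho> / 2" using \<rho> by (intro real_arch_pow_inv) auto
  define k where "k = (LEAST k. (1/2) ^ k \<le> \<rho> / 2)"
  have k: "(1/2) ^ k \<le> \<rho> / 2" and least: "\<And>i. i < k \<Longrightarrow> \<rho> / 2 < (1/2) ^ i"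
    using \<open>\<exists>k. (1/2) ^ k < \<rho> / 2\<close> unfolding k_def
    by (metis (mono_tags, lifting) LeastI less_imp_le, metis (mono_tags, lifting) not_less_Least not_le)
  have "(1/2) ^ k < (1/2::real) ^ k0" using k \<rho> by linarith
  then have kk0: "k0 < k" by (simp add: power_strict_decreasing_iff)
  then have "\<rho> / 2 < (1/2) ^ (k - 1)" by (intro least) simp
  also have "(1/2::real) ^ (k - 1) = 2 * (1/2) ^ k" using kk0 by (cases k) auto
  finally have k': "\<rho> / 4 < (1/2) ^ k" by simp
  define j where "j = \<lceil>2 ^ k * fst w\<rceil>"
  have j: "2 ^ k * fst w \<le> j" "j < 2 ^ k * fst w + 1" unfolding j_def by linarith+
  have j1: "fst w \<le> j / 2 ^ k" using j(1) by (simp add: pos_le_divide_eq mult.commute)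
  have "(j + 1) / 2 ^ k \<le> (2 ^ k * fst w + 2) / 2 ^ k" using j(2) by (intro divide_right_mono) auto
  also have "\<dots> = fst w + 2 * (1/2) ^ k" by (simp add: add_divide_distrib power_one_over)
  also have "\<dots> \<le> fst w + \<rho>" using k by simp
  finally have j2: "(j + 1) / 2 ^ k \<le> fst w + \<rho>" .
  have "ennreal (\<rho> / 8) \<le> ennreal (1 / (2 * 2 ^ k))"
    using k' by (intro ennreal_leI) (simp add: power_one_over)
  also have "\<dots> \<le> emeasure lborel (dyadic k j \<inter> gaps k)" using k0[of k] kk0 by (intro emeasure_gaps_ge) simp
  finally have "ennreal (\<rho> / 8) \<le> emeasure lborel (dyadic k j \<inter> gaps k)" .
  moreover have "compact (dyadic k j \<inter> gaps k)" unfolding dyadic_def by (intro compact_Int_closed closed_gaps) auto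
  moreover have "dyadic k j \<inter> gaps k \<subseteq> {fst w - \<rho>..fst w + \<rho>}" 
    using j1 j2 \<rho> unfolding dyadic_def by auto
  ultimately show ?thesis unfolding c6_def
    using gaps_chart[of k j] k0[of k] kk0 C6_ge_1 r 
    by (intro big_piece_chart[where Y="dyadic k j \<inter> gaps k" and T="T k" and \<rho>=\<rho>]) (auto simp: \<rho>_def c6_def)
qed

lemma big_piece_large_scale:
  assumes flat: "\<And>y t. R \<le> \<bar>y\<bar> \<Longrightarrow> f y t = 0" and r: "0 < r" "2 * R \<le> c6 * r"
  shows "big_piece (\<Lambda> C6) (\<Phi> w) r (c6 ^ 3 / 128)"
proof -
  define \<rho> where "\<rho> = c6 * r"
  have \<rho>: "0 < \<rho>" using r c6_pos by (simp add: \<rho>_def)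
  define Y where "Y = (if 0 \<le> fst w then {fst w + \<rho> / 2..fst w + \<rho>} else {fst w - \<rho>..fst w - \<rho> / 2})"
  have "f y t = 0" if "y \<in> Y" for y t
  proof (rule flat)
    have "R \<le> \<rho> / 2" using r by (simp add: \<rho>_def)
    then show "R \<le> \<bar>y\<bar>" using that \<rho> by (auto simp: Y_def split: if_splits)
  qed
  then have "chart C6 Y (\<lambda>y s. s)" by (intro flat_chart C6_ge_1)
  moreover have "compact Y" "Y \<subseteq> {fst w - \<rho>..fst w + \<rho>}" using \<rho> by (auto simp: Y_def)
  moreover have "ennreal (\<rho> / 8) \<le> emeasure lborel Y" using \<rho> by (auto simp: Y_def intro!: ennreal_leI)
  ultimately show ?thesis unfolding c6_def using C6_ge_1 r
    by (intro big_piece_chart[where Y=Y and T="\<lambda>y s. s" and \<rho>=\<rho>]) (auto simp: \<rho>_def c6_def)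
qed

lemma big_pieces_parabolic_graph:
  assumes flat: "\<And>y t. R \<le> \<bar>y\<bar> \<Longrightarrow> f y t = 0"
  shows "big_pieces_parabolic (range \<Phi>)"
proof -
  obtain k0 where k0: "\<And>k. k \<ge> k0 \<Longrightarrow> small k \<and> \<sigma> k \<le> 1/8" using small_eventually by blast
  define r0 where "r0 = (1/2) ^ k0 / c6"
  define R1 where "R1 = max r0 (2 * R / c6)"
  have r0: "0 < r0" "c6 * r0 = (1/2) ^ k0" and R1: "r0 \<le> R1" "2 * R \<le> c6 * R1"
    using c6_pos by (auto simp: r0_def R1_def pos_divide_le_eq mult.commute max_def split: if_splits)
  define \<theta> where "\<theta> = c6 ^ 3 / 128 * (r0 / R1) ^ 3"
  have \<theta>: "0 < \<theta>" "\<theta> \<le> c6 ^ 3 / 128"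
  proof -
    have "(r0 / R1) ^ 3 \<le> 1" using r0 R1 by (intro power_le_one) auto
    then show "\<theta> \<le> c6 ^ 3 / 128" using c6_pos unfolding \<theta>_def by (intro mult_left_le) auto
  qed (use r0 R1 c6_pos in \<open>auto simp: \<theta>_def\<close>)
  have piece: "big_piece (\<Lambda> C6) p r \<theta>" if p: "p \<in> range \<Phi>" and r: "0 < r" for p r
  proof -
    obtain w where w: "p = \<Phi> w" using p by blast
    show ?thesis
    proof (cases "r0 < r \<and> r < R1")
      case True
      have "big_piece (\<Lambda> C6) p r0 (c6 ^ 3 / 128)"
        unfolding w by (rule big_piece_small_scale[OF k0]) (use r0 in auto)
      moreover have "\<theta> * r ^ 3 \<le> c6 ^ 3 / 128 * r0 ^ 3"
      proof -
        have "(r0 / R1) * r \<le> r0" using True r0 R1 by (simp add: pos_divide_le_eq)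
        then have "((r0 / R1) * r) ^ 3 \<le> r0 ^ 3" using r0 R1 r by (intro power_mono) auto
        then have "c6 ^ 3 / 128 * ((r0 / R1) * r) ^ 3 \<le> c6 ^ 3 / 128 * r0 ^ 3" using c6_pos by (intro mult_left_mono) auto
        then show ?thesis by (simp only: \<theta>_def power_mult_distrib mult.assoc)
      qed
      ultimately show ?thesis using True by (elim big_piece_mono) auto
    next
      case False
      have "big_piece (\<Lambda> C6) p r (c6 ^ 3 / 128)"
      proof (cases "r \<le> r0")
        case True
        then have "c6 * r \<le> (1/2) ^ k0" using c6_pos r0(2) by (metis mult_left_mono less_imp_le)
        then show ?thesis unfolding w by (intro big_piece_small_scale[OF k0] r) auto
      next
        case F: False
        then have "c6 * R1 \<le> c6 * r" using False c6_pos by (intro mult_left_mono) auto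
        then have "2 * R \<le> c6 * r" using R1(2) by linarith
        then show ?thesis unfolding w by (intro big_piece_large_scale[OF flat] r) auto
      qed
      then show ?thesis by (rule big_piece_mono[OF _ order_refl]) (use \<theta> r in \<open>auto intro: mult_right_mono\<close>)
    qed
  qed
  have lower: "ennreal (\<theta> * r ^ 3) \<le> hausdorff_measure 3 (range \<Phi> \<inter> ball p r)" if "p \<in> range \<Phi>" "0 < r" for p r
  proof -
    have "big_piece (\<Lambda> C6) p r \<theta>" by (rule piece[OF that])
    then obtain K g where "ennreal (\<theta> * r ^ 3) \<le> hausdorff_measure 3 (g ` (K :: para set) \<inter> range \<Phi> \<inter> ball p r)"
      by (auto simp: big_piece_def)
    also have "\<dots> \<le> hausdorff_measure 3 (range \<Phi> \<inter> ball p r)" by (rule hausdorff_measure_mono) auto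
    finally show ?thesis .
  qed
  have "regular3 (range \<Phi>)"
    unfolding regular3_def
  proof (intro exI conjI ballI allI impI)
    define D where "D = max 1 (max (1 / \<theta>) (32768 * L ^ 3))"
    show D1: "1 \<le> D" by (simp add: D_def)
    fix p r assume p: "p \<in> range \<Phi>" and r: "(0::real) < r"
    have "1 / \<theta> \<le> D" by (simp add: D_def)
    then have "1 / D \<le> \<theta>" using \<theta>(1) frac_le[of 1 1 "1 / \<theta>" D] by simp
    then have "r ^ 3 / D \<le> \<theta> * r ^ 3" using mult_right_mono[of "1 / D" \<theta> "r ^ 3"] r by simp
    then show "ennreal (r ^ 3 / D) \<le> hausdorff_measure 3 (range \<Phi> \<inter> ball p r)"
      using lower[OF p r] ennreal_leI order_trans by blast
    have "32768 * L ^ 3 * r ^ 3 \<le> D * r ^ 3" using r by (intro mult_right_mono) (auto simp: D_def)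
    then show "hausdorff_measure 3 (range \<Phi> \<inter> ball p r) \<le> ennreal (D * r ^ 3)"
      using hausdorff_measure_ball_le[OF p r] ennreal_leI order_trans by blast
  qed
  moreover have "1 \<le> \<Lambda> C6" using C6_ge_1 by (intro \<Lambda>_ge_1) simp
  ultimately show ?thesis
    unfolding big_pieces_parabolic_def using closed_graph \<theta>(1) piece
    by (intro conjI exI[of _ "\<Lambda> C6"] exI[of _ \<theta>]) (auto simp: big_piece_def)
qed

lemma vertical_subgroup_W_plane: "vertical_subgroup W_plane"
proof -
  have "(\<lambda>p. (hx p, hy p, ht p)) ` W_plane = {0::real} \<times> (UNIV :: (real \<times> real) set)"
    by (force simp: W_plane_def image_iff)
  moreover have "subspace ({0::real} \<times> (UNIV :: (real \<times> real) set))" by (intro subspace_Times) auto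
  moreover have "dim ({0::real} \<times> (UNIV :: (real \<times> real) set)) = 2" by (subst dim_Times) auto
  ultimately show ?thesis by (auto simp: vertical_subgroup_def W_plane_def)
qed

lemma LI_rectifiable_graph: "LI_rectifiable (range \<Phi>)"
proof -
  obtain k0 where k0: "\<And>k. k \<ge> k0 \<Longrightarrow> small k \<and> \<sigma> k \<le> 1/8" using small_eventually by blast
  define Y where "Y k j = dyadic k j \<inter> gaps k" for k j
  define C where "C k j = {p. hx p = 0 \<and> hy p \<in> Y k j}" for k j
  define g where "g k p = \<Psi> (T k) (Para (hy p) (ht p))" for k p
  have cl: "closed (C k j)" for k j
    unfolding closed_sequential_limits
  proof (intro allI impI, elim conjE)
    fix p q assume p: "\<forall>n. p n \<in> C k j" and lim: "p \<longlonglongrightarrow> q"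
    have "closed (Y k j)" unfolding Y_def dyadic_def by (intro closed_Int closed_gaps) auto
    then have "hy q \<in> Y k j" 
      using closed_sequentially[of "Y k j" "\<lambda>n. hy (p n)"] heis_tendsto_coords(2)[OF lim] p by (simp add: C_def)
    moreover have "(\<lambda>n. hx (p n)) = (\<lambda>n. 0)" using p by (simp add: C_def)
    then have "hx q = 0" using heis_tendsto_coords(1)[OF lim] LIMSEQ_unique tendsto_const by metis
    ultimately show "q \<in> C k j" by (simp add: C_def)
  qed
  have lipg: "(\<Lambda> C6)-lipschitz_on (C k j) (g k)" if "small k" for k j
  proof (rule lipschitz_onI)
    show "0 \<le> \<Lambda> C6" using \<Lambda>_ge_1[of C6] C6_ge_1 by simp
    fix p q assume pq: "p \<in> C k j" "q \<in> C k j"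
    have "bilipschitz_on (\<Lambda> C6) {a. py a \<in> Y k j} (\<Psi> (T k))"
      unfolding Y_def using gaps_chart[OF that] C6_ge_1 by (intro chart_bilipschitz) auto
    then have "dist (g k p) (g k q) \<le> \<Lambda> C6 * dist (Para (hy p) (ht p)) (Para (hy q) (ht q))"
      using pq by (simp add: bilipschitz_on_def C_def g_def)
    moreover have "dist (Para (hy p) (ht p)) (Para (hy q) (ht q)) = dist p q"
    proof -
      have "Heis 0 (hy p) (ht p) = p" "Heis 0 (hy q) (ht q) = q" using pq by (auto simp: C_def heis.expand)
      then show ?thesis by (simp add: dist_para_def pnorm_diff)
    qed
    ultimately show "dist (g k p) (g k q) \<le> \<Lambda> C6 * dist p q" by simp
  qed
  define kk jj where "kk i = k0 + fst (prod_decode i)" and "jj i = int_decode (snd (prod_decode i))" for i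
  have "range \<Phi> - (\<Union>i. g (kk i) ` C (kk i) (jj i)) \<subseteq> \<Phi> ` {w. \<forall>k. fst w \<notin> gaps k}"
  proof
    fix p assume p: "p \<in> range \<Phi> - (\<Union>i. g (kk i) ` C (kk i) (jj i))"
    then obtain w where w: "p = \<Phi> w" by blast
    have "fst w \<notin> gaps k" for k
    proof
      assume "fst w \<in> gaps k"
      then have wk: "fst w \<in> gaps (k0 + k)" using gaps_mono[of k "k0 + k"] by auto
      define j where "j = \<lfloor>2 ^ (k0 + k) * fst w\<rfloor>"
      have "fst w \<in> Y (k0 + k) j" using wk unfolding Y_def j_def mem_dyadic Int_iff by linarith
      moreover obtain s where "T (k0 + k) (fst w) s = snd w" using surj_T k0[of "k0 + k"] by (metis le_add1 surjD)
      ultimately have "p = g (k0 + k) (Heis 0 (fst w) s)" "Heis 0 (fst w) s \<in> C (k0 + k) j"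
        by (simp_all add: w g_def \<Psi>_def C_def)
      moreover have "kk (prod_encode (k, int_encode j)) = k0 + k" "jj (prod_encode (k, int_encode j)) = j"
        by (simp_all add: kk_def jj_def)
      ultimately have "p \<in> g (kk (prod_encode (k, int_encode j))) ` C (kk (prod_encode (k, int_encode j))) (jj (prod_encode (k, int_encode j)))"
        by simp
      then show False using p by blast
    qed
    then show "p \<in> \<Phi> ` {w. \<forall>k. fst w \<notin> gaps k}" using w by blast
  qed
  from hausdorff_measure_mono[OF this, of 3]
  have "hausdorff_measure 3 (range \<Phi> - (\<Union>i. g (kk i) ` C (kk i) (jj i))) \<le> 0"
    unfolding hausdorff_measure_no_gaps .
  then have null: "hausdorff_measure 3 (range \<Phi> - (\<Union>i. g (kk i) ` C (kk i) (jj i))) = 0" by simp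
  have CW: "C k j \<subseteq> W_plane" for k j
  proof
    fix p assume "p \<in> C k j"
    then have "p = Heis 0 (hy p) (ht p)" by (simp add: C_def heis.expand)
    then show "p \<in> W_plane" by (auto simp: W_plane_def)
  qed
  have "(\<Lambda> C6)-lipschitz_on (C (kk i) (jj i)) (g (kk i))" for i
    by (rule lipg) (use k0[of "kk i"] in \<open>simp add: kk_def\<close>)
  then show ?thesis
    unfolding LI_rectifiable_def
    using closed_hausdorff_measurable[OF closed_graph] vertical_subgroup_W_plane CW cl null
    by (intro conjI exI[of _ "\<lambda>i. W_plane"] exI[of _ "\<lambda>i. C (kk i) (jj i)"] exI[of _ "\<lambda>i. g (kk i)"]) blast+
qed

end

lemma intrinsic_lipschitz_estimate:
  assumes "intrinsic_lipschitz_with L \<phi>" and "0 < L"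
  shows "\<bar>\<phi> (y', t') - \<phi> (y, t)\<bar> \<le> 2 * L * (\<bar>y' - y\<bar> + sqrt \<bar>t' - t - \<phi> (y, t) * (y' - y)\<bar>)"
proof -
  define p where "p = graph_map \<phi> (y, t)"
  define q where "q = graph_map \<phi> (y', t')"
  define d where "d = inverse p * q"
  define x where "x = \<phi> (y', t') - \<phi> (y, t)"
  define s where "s = t' - t - \<phi> (y, t) * (y' - y)"
  have pq: "p * d = q" by (simp add: d_def mult.assoc[symmetric])
  have hx: "hx d = x" and pW: "proj_W d = Heis 0 (y' - y) s"
    by (simp_all add: d_def p_def q_def x_def s_def graph_map_def proj_W_def times_heis_def inverse_heis_def field_simps)
  have nV: "hnorm (proj_V d) = \<bar>x\<bar>"
    using real_root_power_cancel[of 4 "\<bar>x\<bar>"] by (simp add: hnorm_def proj_V_def hx)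
  define N where "N = hnorm (proj_W d)"
  have "N\<^sup>2 \<le> (y' - y)\<^sup>2 + 4 * \<bar>s\<bar>" using hnorm_power2_bounds(3)[of "proj_W d"] by (simp add: N_def pW)
  also have "\<dots> \<le> (2 * (\<bar>y' - y\<bar> + sqrt \<bar>s\<bar>))\<^sup>2"
    by (simp add: power_mult_distrib power2_sum)
  finally have N: "N \<le> 2 * (\<bar>y' - y\<bar> + sqrt \<bar>s\<bar>)" by (rule power2_le_imp_le) simp
  have N0: "0 \<le> N" by (simp add: N_def hnorm_nonneg)
  have "\<bar>x\<bar> \<le> L * N"
  proof (rule ccontr)
    assume "\<not> ?thesis"
    then have less: "L * N < \<bar>x\<bar>" by simp
    then have x0: "0 < \<bar>x\<bar>" using N0 assms(2) by (metis le_less_trans mult_nonneg_nonneg less_imp_le)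
    then have "N / \<bar>x\<bar> < inverse L" using less assms(2) by (simp add: field_simps)
    then obtain \<beta> where \<beta>: "N / \<bar>x\<bar> < \<beta>" "\<beta> < inverse L" using dense by blast
    have "0 < \<beta>" using \<beta>(1) N0 by (meson divide_nonneg_nonneg abs_ge_zero le_less_trans)
    moreover have "p \<in> intrinsic_graph \<phi>" "q \<in> intrinsic_graph \<phi>" by (auto simp: intrinsic_graph_def p_def q_def)
    moreover have "d \<in> intrinsic_cone \<beta>"
      using \<beta>(1) x0 by (simp add: intrinsic_cone_def nV N_def[symmetric] field_simps)
    then have "q \<in> (*) p ` intrinsic_cone \<beta>" using pq by blast
    ultimately have "q = p"
      using assms(1) \<beta>(2) unfolding intrinsic_lipschitz_with_def by blast
    then have "hx q = hx p" by simp
    then have "x = 0" by (simp add: p_def q_def x_def graph_map_def times_heis_def)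
    then show False using x0 by simp
  qed
  also have "\<dots> \<le> L * (2 * (\<bar>y' - y\<bar> + sqrt \<bar>s\<bar>))" using N assms(2) by (intro mult_left_mono) auto
  finally show ?thesis by (simp add: x_def s_def mult_ac)
qed

theorem theorem1p11:
  fixes \<phi> :: "real \<times> real \<Rightarrow> real" and \<alpha> H :: real
  assumes "compactly_supported \<phi>"
    and "intrinsic_lipschitz \<phi>"
    and "0 < \<alpha>" and "\<alpha> \<le> 1" and "0 < H"
    and "extra_vertical_hoelder \<alpha> H \<phi>"
  shows "big_pieces_parabolic (intrinsic_graph \<phi>) \<and> LI_rectifiable (intrinsic_graph \<phi>)"
proof -
  obtain K where K: "compact K" "\<And>w. w \<notin> K \<Longrightarrow> \<phi> w = 0"
    using assms(1) by (auto simp: compactly_supported_def)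
  obtain L where L: "0 < L" "intrinsic_lipschitz_with L \<phi>"
    using assms(2) by (auto simp: intrinsic_lipschitz_def)
  obtain R where R: "\<And>w. w \<in> K \<Longrightarrow> norm w < R" "0 < R"
    using compact_imp_bounded[OF K(1)] by (metis bounded_pos_less)
  have flat: "\<phi> (y, t) = 0" if "R \<le> \<bar>y\<bar> \<or> R \<le> \<bar>t\<bar>" for y t
  proof -
    have "\<bar>y\<bar> \<le> norm (y, t)" "\<bar>t\<bar> \<le> norm (y, t)"
      using norm_fst_le[of y t] norm_snd_le[of t y] by auto
    then have "(y, t) \<notin> K" using R that by force
    then show ?thesis by (rule K(2))
  qed
  define B where "B = max 0 (H * (2 * R) powr ((1 + \<alpha>) / 2))"
  have hoelder: "\<bar>\<phi> (y, t) - \<phi> (y, t')\<bar> \<le> max 1 H * \<bar>t - t'\<bar> powr ((1 + \<alpha>) / 2)" for y t t'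
  proof -
    have "\<bar>\<phi> (y, t) - \<phi> (y, t')\<bar> \<le> H * \<bar>t - t'\<bar> powr ((1 + \<alpha>) / 2)"
      using assms(6) by (simp add: extra_vertical_hoelder_def)
    also have "\<dots> \<le> max 1 H * \<bar>t - t'\<bar> powr ((1 + \<alpha>) / 2)" by (intro mult_right_mono) auto
    finally show ?thesis .
  qed
  have bounded: "\<bar>\<phi> (y, t)\<bar> \<le> B" for y t
  proof (cases "R \<le> \<bar>t\<bar>")
    case False
    then have "\<bar>t - R\<bar> \<le> 2 * R" by linarith
    have "\<bar>\<phi> (y, t) - \<phi> (y, R)\<bar> \<le> H * \<bar>t - R\<bar> powr ((1 + \<alpha>) / 2)"
      using assms(6) by (simp add: extra_vertical_hoelder_def)
    also have "\<dots> \<le> H * (2 * R) powr ((1 + \<alpha>) / 2)"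
      using \<open>\<bar>t - R\<bar> \<le> 2 * R\<close> assms(3,5) by (intro mult_left_mono powr_mono2) auto
    finally show ?thesis using flat[of y R] R(2) by (simp add: B_def)
  qed (simp add: flat B_def)
  interpret hoelder_graph "\<lambda>y t. \<phi> (y, t)" "max 1 (2 * L)" B \<alpha> "max 1 H"
  proof
    fix y t y' t' :: real
    have "\<bar>\<phi> (y', t') - \<phi> (y, t)\<bar> \<le> 2 * L * (\<bar>y' - y\<bar> + sqrt \<bar>t' - t - \<phi> (y, t) * (y' - y)\<bar>)"
      by (rule intrinsic_lipschitz_estimate[OF L(2,1)])
    also have "\<dots> \<le> max 1 (2 * L) * (\<bar>y' - y\<bar> + sqrt \<bar>t' - t - \<phi> (y, t) * (y' - y)\<bar>)"
      by (intro mult_right_mono) auto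
    finally show "\<bar>\<phi> (y', t') - \<phi> (y, t)\<bar> \<le> max 1 (2 * L) * (\<bar>y' - y\<bar> + sqrt \<bar>t' - t - \<phi> (y, t) * (y' - y)\<bar>)" .
  qed (use assms bounded hoelder in auto)
  have "intrinsic_graph \<phi> = range \<Phi>"
    unfolding intrinsic_graph_def by (rule arg_cong[where f=range]) (auto simp: graph_map_def \<Phi>_def)
  then show ?thesis
    using big_pieces_parabolic_graph[of R] flat LI_rectifiable_graph by simp
qed

end
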